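(* If $a^{\frac{N-4}{2}}b>C_2(N)$ and $\Omega$ is star-shaped, then there exists $\varepsilon>0$ such that $(\mathcal P_\lambda)$ has no non-zero solution for each $\lambda\in(0,\lambda^*+\varepsilon)$.
   Context: $N>4$ is an integer, $2^*=\frac{2N}{N-2}$, $p\in(2,2^* )$, $\Omega\subseteq\mathbb R^N$ is a bounded domain, $a,b$ are positive numbers. $H_0^1(\Omega)$ has norm $\|u\|=(\int_\Omega|\nabla u|^2dx)^{1/2}$ and $\|u\|_q$ is the $L^q(\Omega)$ norm. $S_N=\inf_{u\in H_0^1(\Omega)\setminus\{0\}}\|u\|^2/\|u\|_{2^*}^2$, $C_2(N)=\frac{2(N-4)^{\frac{N-4}{2}}}{(N-2)^{\frac{N-2}{2}}S_N^{\frac N2}}$. Problem $(\mathcal P_\lambda)$: $-\left(a+b\int_\Omega|\nabla u|^2dx\right)\Delta u=|u|^{2^*-2}u+\lambda|u|^{p-2}u$ in $\Omega$, $u=0$ on $\partial\Omega$. Solutions are weak solutions, i.e. critical points in $H_0^1(\Omega)$ of the energy functional $\Phi_\lambda(u)=\frac a2\|u\|^2+\frac b4\|u\|^4-\frac1{2^*}\|u\|_{2^*}^{2^*}-\frac\lambda p\|u\|_p^p$. Definition of $\lambda^*$: for $u\in H_0^1(\Omega)\setminus\{0\}$ let $\psi_{\lambda,u}(t)=\Phi_\lambda(tu)$, $t>0$. When $a^{\frac{N-4}{2}}b\ge C_2(N)$, for every such $u$ there is a unique $\lambda(u)>0$ for which, with $\lambda=\lambda(u)$, there exists $t>0$ with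 $\psi_{\lambda,u}'(t)=0$, $\psi_{\lambda,u}''(t)=0$ and $\psi_{\lambda,u}'(t)=\inf_{s>0}\psi_{\lambda,u}'(s)$. Then $\lambda^*=\inf_{u\in H_0^1(\Omega)\setminus\{0\}}\lambda(u)$. *)

theory Defs
  imports "HOL-Analysis.Analysis"
begin

section \<open>Test functions and weak gradients\<close>

definition partial :: "'a::euclidean_space \<Rightarrow> ('a \<Rightarrow> real) \<Rightarrow> 'a \<Rightarrow> real" where
  "partial i f x = frechet_derivative f (at x) i"

primrec Ck :: "nat \<Rightarrow> ('a::euclidean_space \<Rightarrow> real) \<Rightarrow> bool" where
  "Ck 0 f \<longleftrightarrow> continuous_on UNIV f"
| "Ck (Suc k) f \<longleftrightarrow> (\<forall>x. f differentiable (at x)) \<and> (\<forall>i\<in>Basis. Ck k (partial i f))"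

definition test_functions :: "'a::euclidean_space set \<Rightarrow> ('a \<Rightarrow> real) set" where
  "test_functions \<Omega> =
     {\<phi>. (\<forall>k. Ck k \<phi>) \<and> compact (closure {x. \<phi> x \<noteq> 0}) \<and> closure {x. \<phi> x \<noteq> 0} \<subseteq> \<Omega>}"

definition locally_integrable ::
    "'a::euclidean_space set \<Rightarrow> ('a \<Rightarrow> 'b::euclidean_space) \<Rightarrow> bool" where
  "locally_integrable \<Omega> f \<longleftrightarrow> (\<forall>K. compact K \<and> K \<subseteq> \<Omega> \<longrightarrow> integrable (lebesgue_on K) f)"

definition has_weak_gradient ::
    "'a::euclidean_space set \<Rightarrow> ('a \<Rightarrow> real) \<Rightarrow> ('a \<Rightarrow> 'a) \<Rightarrow> bool" where
  "has_weak_gradient \<Omega> u g \<longleftrightarrow> locally_integrable \<Omega> u \<and> locally_integrable \<Omega> g \<and>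
     (\<forall>\<phi>\<in>test_functions \<Omega>. \<forall>i\<in>Basis.
        (LINT x|lebesgue_on \<Omega>. u x * partial i \<phi> x) = - (LINT x|lebesgue_on \<Omega>. (g x \<bullet> i) * \<phi> x))"

text \<open>On an open set weak gradients are unique almost everywhere, so no integral below
  depends on the choice.\<close>

definition weak_gradient :: "'a::euclidean_space set \<Rightarrow> ('a \<Rightarrow> real) \<Rightarrow> 'a \<Rightarrow> 'a" where
  "weak_gradient \<Omega> u = (SOME g. has_weak_gradient \<Omega> u g)"

section \<open>The spaces \<open>L\<^sup>q(\<Omega>)\<close>, \<open>H\<^sup>1(\<Omega>)\<close> and \<open>H\<^sub>0\<^sup>1(\<Omega>)\<close>\<close>

text \<open>Their elements are represented by functions on the whole space of which only the values on
  \<open>\<Omega>\<close>, up to null sets, are relevant; \<open>zero_on\<close> says that such a function represents the zero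
  element.\<close>

definition zero_on :: "'a::euclidean_space set \<Rightarrow> ('a \<Rightarrow> real) \<Rightarrow> bool" where
  "zero_on \<Omega> u \<longleftrightarrow> (AE x in lebesgue_on \<Omega>. u x = 0)"

definition Lq :: "real \<Rightarrow> 'a::euclidean_space set \<Rightarrow> ('a \<Rightarrow> 'b::euclidean_space) set" where
  "Lq q \<Omega> = {f. f \<in> borel_measurable (lebesgue_on \<Omega>) \<and>
                integrable (lebesgue_on \<Omega>) (\<lambda>x. norm (f x) powr q)}"

definition Lq_norm :: "real \<Rightarrow> 'a::euclidean_space set \<Rightarrow> ('a \<Rightarrow> 'b::euclidean_space) \<Rightarrow> real" where
  "Lq_norm q \<Omega> f = (LINT x|lebesgue_on \<Omega>. norm (f x) powr q) powr (1 / q)"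

definition H1 :: "'a::euclidean_space set \<Rightarrow> ('a \<Rightarrow> real) set" where
  "H1 \<Omega> = {u \<in> Lq 2 \<Omega>. \<exists>g \<in> Lq 2 \<Omega>. has_weak_gradient \<Omega> u g}"

definition H1_norm :: "'a::euclidean_space set \<Rightarrow> ('a \<Rightarrow> real) \<Rightarrow> real" where
  "H1_norm \<Omega> u = sqrt ((Lq_norm 2 \<Omega> u)\<^sup>2 + (Lq_norm 2 \<Omega> (weak_gradient \<Omega> u))\<^sup>2)"

definition H01 :: "'a::euclidean_space set \<Rightarrow> ('a \<Rightarrow> real) set" where
  "H01 \<Omega> = {u \<in> H1 \<Omega>. \<exists>\<phi>. (\<forall>n::nat. \<phi> n \<in> test_functions \<Omega>) \<and>
                (\<lambda>n. H1_norm \<Omega> (\<lambda>x. u x - \<phi> n x)) \<longlonglongrightarrow> 0}"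

definition H01_norm :: "'a::euclidean_space set \<Rightarrow> ('a \<Rightarrow> real) \<Rightarrow> real" where
  "H01_norm \<Omega> u = Lq_norm 2 \<Omega> (weak_gradient \<Omega> u)"

definition H01_nonzero :: "'a::euclidean_space set \<Rightarrow> ('a \<Rightarrow> real) set" where
  "H01_nonzero \<Omega> = {u \<in> H01 \<Omega>. \<not> zero_on \<Omega> u}"

text \<open>Vanishing of the Frechet derivative on the normed space \<open>H\<^sub>0\<^sup>1(\<Omega>)\<close>, written out because this
  space is a set of functions rather than a type.\<close>

definition critical_point_H01 ::
    "'a::euclidean_space set \<Rightarrow> (('a \<Rightarrow> real) \<Rightarrow> real) \<Rightarrow> ('a \<Rightarrow> real) \<Rightarrow> bool" where
  "critical_point_H01 \<Omega> F u \<longleftrightarrow> u \<in> H01 \<Omega> \<and>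
     (\<forall>\<epsilon>>0. \<exists>\<delta>>0. \<forall>v\<in>H01 \<Omega>. H01_norm \<Omega> v < \<delta> \<longrightarrow>
        \<bar>F (\<lambda>x. u x + v x) - F u\<bar> \<le> \<epsilon> * H01_norm \<Omega> v)"

section \<open>The Kirchhoff problem\<close>

definition crit_exp :: "nat \<Rightarrow> real" where
  "crit_exp N = 2 * real N / (real N - 2)"

definition S_const :: "'a::euclidean_space set \<Rightarrow> real" where
  "S_const \<Omega> = (INF u \<in> H01_nonzero \<Omega>.
     (H01_norm \<Omega> u)\<^sup>2 / (Lq_norm (crit_exp DIM('a)) \<Omega> u)\<^sup>2)"

definition C2 :: "'a::euclidean_space set \<Rightarrow> real" where
  "C2 \<Omega> = (let N = real DIM('a) in
     2 * (N - 4) powr ((N - 4) / 2) / ((N - 2) powr ((N - 2) / 2) * S_const \<Omega> powr (N / 2)))"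

definition energy ::
    "'a::euclidean_space set \<Rightarrow> real \<Rightarrow> real \<Rightarrow> real \<Rightarrow> real \<Rightarrow> ('a \<Rightarrow> real) \<Rightarrow> real" where
  "energy \<Omega> a b p lam u =
     a / 2 * H01_norm \<Omega> u ^ 2 + b / 4 * H01_norm \<Omega> u ^ 4
     - 1 / crit_exp DIM('a) * Lq_norm (crit_exp DIM('a)) \<Omega> u powr crit_exp DIM('a)
     - lam / p * Lq_norm p \<Omega> u powr p"

definition kirchhoff_solution ::
    "'a::euclidean_space set \<Rightarrow> real \<Rightarrow> real \<Rightarrow> real \<Rightarrow> real \<Rightarrow> ('a \<Rightarrow> real) \<Rightarrow> bool" where
  "kirchhoff_solution \<Omega> a b p lam u \<longleftrightarrow> critical_point_H01 \<Omega> (energy \<Omega> a b p lam) u"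

definition fibering ::
    "'a::euclidean_space set \<Rightarrow> real \<Rightarrow> real \<Rightarrow> real \<Rightarrow> real \<Rightarrow> ('a \<Rightarrow> real) \<Rightarrow> real \<Rightarrow> real" where
  "fibering \<Omega> a b p lam u t = energy \<Omega> a b p lam (\<lambda>x. t * u x)"

text \<open>The infimum below is over a set bounded below when the dimension exceeds 4, since the
  critical exponent is then smaller than 4.\<close>

definition extremal_param ::
    "'a::euclidean_space set \<Rightarrow> real \<Rightarrow> real \<Rightarrow> real \<Rightarrow> ('a \<Rightarrow> real) \<Rightarrow> real" where
  "extremal_param \<Omega> a b p u = (THE lam. lam > 0 \<and>
     (\<exists>t>0. deriv (fibering \<Omega> a b p lam u) t = 0 \<and>
            deriv (deriv (fibering \<Omega> a b p lam u)) t = 0 \<and>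
            deriv (fibering \<Omega> a b p lam u) t = (INF s\<in>{0<..}. deriv (fibering \<Omega> a b p lam u) s)))"

definition lambda_star :: "'a::euclidean_space set \<Rightarrow> real \<Rightarrow> real \<Rightarrow> real \<Rightarrow> real" where
  "lambda_star \<Omega> a b p = (INF u\<in>H01_nonzero \<Omega>. extremal_param \<Omega> a b p u)"

end

theory Submission
  imports Defs
begin

text \<open>Write \<open>q\<close> for the critical exponent, \<open>A u\<close> for the Dirichlet integral and \<open>P r u\<close> for the
  integral of \<open>\<bar>u\<bar> powr r\<close>. The strict inequality on \<open>a\<close> and \<open>b\<close> makes \<open>a A + b A\<^sup>2 - P q\<close> coercive, and
  \<open>\<lambda>\<^sup>*\<close> is the infimum of \<open>(a A + b A\<^sup>2 - P q) / P p\<close>, so \<open>J = a A + b A\<^sup>2 - P q - \<lambda>\<^sup>* P p\<close> is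
  nonnegative. Suppose that there are non-zero solutions \<open>u n\<close> with \<open>\<lambda> n\<close> tending to \<open>\<lambda>\<^sup>*\<close>. By the Nehari identity
  \<open>J (u n)\<close> tends to 0, hence so does the derivative of \<open>J\<close> at \<open>u n\<close>, uniformly on the unit ball. Eliminating the
  gradient term with the Euler-Lagrange equation leaves
  \<open>x \<bar>u\<bar> powr (q - 2) * u - y \<bar>u\<bar> powr (p - 2) * u \<rightarrow> 0\<close> in the dual space, with \<open>x\<close>, \<open>y\<close> positive, so that
  \<open>u n\<close> concentrates on \<open>0\<close> and two values \<open>\<plusminus> s0\<close>. Functions with bounded Dirichlet integral cannot jump between these values:
  the Gagliardo-Nirenberg-Sobolev inequality, applied to a primitive \<open>W (u n)\<close> whose derivative vanishes at
  them, forces \<open>u n \<rightarrow> 0\<close> in measure, against the lower bound for \<open>P p (u n)\<close>.\<close>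

section \<open>The Gagliardo-Nirenberg-Sobolev inequality\<close>

text \<open>At the critical exponent the embedding of \<open>H01 \<Omega>\<close> is not compact, so
  no limit of the \<open>u n\<close> is ever formed; only numbers pass to the limit. J has a small
  derivative because it is nonnegative: 0 <= J(u + t h) <= J(u) + t J'(u)h + C t^2, and t is taken
  as the square root of a bound for \<lambda> n - \<open>lstar\<close>. Eliminating the gradient
  term multiplies the Euler-Lagrange equation by a factor with limit k, and this yields x = q - k, y
  = \<open>lstar\<close> (k - p). Since x + y / \<open>lstar\<close> = q - p > 0, they are not both
  nonpositive, and testing with u n itself forces equal signs. The last part is the Modica-Mortola
  device: testing bounds the integral of a function F(u n) >= 0 that vanishes only at 0 and +-s0,
  and W' = sqrt(min 1 F) turns this, together with the bounded Dirichlet integral, into an L^1 bound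
  for the gradient of W along approximants of u n. Chain rules are proved for test functions only
  and carried over by approximation, which is why the equation is tested with a smooth function of
  linear growth.\<close>

definition enroot :: "nat \<Rightarrow> ennreal \<Rightarrow> ennreal" where
  "enroot m x = (if x = \<infinity> then \<infinity> else ennreal (root m (enn2real x)))"

lemma enroot_measurable [measurable]: "enroot m \<in> borel_measurable borel"
  unfolding enroot_def by measurable

text \<open>Sending infinity to infinity lets root and power cancel without a finiteness condition,
  so that the product inequalities below can be stated for integrals that may be infinite.\<close>

lemma enroot_power [simp]: "m > 0 \<Longrightarrow> enroot m x ^ m = x"
  by (cases x) (auto simp: enroot_def ennreal_power real_root_pow_pos2 ennreal_top_eq_mult_iff top_power_ennreal)

text \<open>Arithmetic-geometric mean inequality, from Jensen's inequality for \<open>exp\<close> at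
  the points \<open>m * ln (a k)\<close> with equal weights. A vanishing factor is split off because
  it has no logarithm.\<close>

lemma prod_le_sum_power:
  fixes a :: "'k \<Rightarrow> real"
  assumes "finite K" "K \<noteq> {}" "\<And>k. k \<in> K \<Longrightarrow> a k \<ge> 0"
  shows "real (card K) * (\<Prod>k\<in>K. a k) \<le> (\<Sum>k\<in>K. a k ^ card K)"
proof (cases "\<exists>k\<in>K. a k = 0")
  case True
  then have "(\<Prod>k\<in>K. a k) = 0" using assms(1) by (auto intro: prod_zero)
  then show ?thesis using assms(3) by (simp add: sum_nonneg)
next
  case False
  then have pos: "\<And>k. k \<in> K \<Longrightarrow> a k > 0" using assms(3) by force
  define m where "m = real (card K)"
  have m: "m > 0" using assms by (simp add: m_def card_gt_0_iff)
  have cv: "convex_on UNIV (exp :: real \<Rightarrow> real)" by (rule exp_convex)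
  have "exp (\<Sum>k\<in>K. (1 / m) *\<^sub>R (m * ln (a k))) \<le> (\<Sum>k\<in>K. (1 / m) * exp (m * ln (a k)))"
    using assms m by (intro convex_on_sum[OF _ _ cv]) (auto simp: m_def)
  moreover have "exp (\<Sum>k\<in>K. (1 / m) *\<^sub>R (m * ln (a k))) = (\<Prod>k\<in>K. a k)"
    using m pos assms(1) by (simp add: exp_sum)
  moreover have "exp (m * ln (a k)) = a k ^ card K" if "k \<in> K" for k
    using pos[OF that] by (simp add: m_def exp_of_nat_mult)
  ultimately have "(\<Prod>k\<in>K. a k) \<le> (1 / m) * (\<Sum>k\<in>K. a k ^ card K)"
    by (simp add: sum_distrib_left)
  then show ?thesis using m unfolding m_def[symmetric] by (simp add: field_simps)
qed

lemma prod_le_sum_power_ennreal: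
  fixes a :: "'k \<Rightarrow> ennreal"
  assumes "finite K" "K \<noteq> {}"
  shows "of_nat (card K) * (\<Prod>k\<in>K. a k) \<le> (\<Sum>k\<in>K. a k ^ card K)"
proof (cases "\<exists>k\<in>K. a k = \<infinity>")
  case True
  then obtain k where k: "k \<in> K" "a k = \<infinity>" by auto
  have "a k ^ card K = \<infinity>" using assms k by (simp add: top_power_ennreal card_gt_0_iff)
  moreover have "a k ^ card K \<le> (\<Sum>k\<in>K. a k ^ card K)"
    using assms k by (intro member_le_sum) auto
  ultimately show ?thesis by (simp add: top_unique)
next
  case False
  define b where "b k = enn2real (a k)" for k
  have ab: "a k = ennreal (b k)" if "k \<in> K" for k
    using False that by (auto simp: b_def less_top)
  have b: "b k \<ge> 0" for k by (simp add: b_def)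
  have "of_nat (card K) * (\<Prod>k\<in>K. a k) = ennreal (real (card K) * (\<Prod>k\<in>K. b k))"
    using b by (simp add: ab prod_ennreal ennreal_mult' ennreal_of_nat_eq_real_of_nat prod_nonneg)
  also have "\<dots> \<le> ennreal (\<Sum>k\<in>K. b k ^ card K)"
    using prod_le_sum_power[OF assms, of b] b by (intro ennreal_leI) auto
  also have "\<dots> = (\<Sum>k\<in>K. a k ^ card K)"
    using b by (simp add: ab ennreal_power)
  finally show ?thesis .
qed

text \<open>Hoelder's inequality with \<open>card K\<close> factors and all exponents equal to
  \<open>card K\<close>: divide each factor by its norm and integrate the arithmetic-geometric mean
  inequality.\<close>

lemma nn_integral_prod_power_le:
  fixes r :: "'k \<Rightarrow> 'x \<Rightarrow> ennreal"
  assumes K: "finite K" "K \<noteq> {}" and [measurable]: "\<And>k. k \<in> K \<Longrightarrow> r k \<in> borel_measurable M"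
  shows "(\<integral>\<^sup>+x. (\<Prod>k\<in>K. r k x) \<partial>M) \<le> (\<Prod>k\<in>K. enroot (card K) (\<integral>\<^sup>+x. r k x ^ card K \<partial>M))"
proof -
  define m where "m = card K"
  have m: "m > 0" using K by (simp add: m_def card_gt_0_iff)
  define c where "c k = enroot m (\<integral>\<^sup>+x. r k x ^ m \<partial>M)" for k
  have cm: "c k ^ m = (\<integral>\<^sup>+x. r k x ^ m \<partial>M)" for k using m by (simp add: c_def)
  \<comment> \<open>A factor of norm 0 comes before one of norm infinity: 0 times infinity is 0, so
    the left side must be shown to vanish in that case.\<close>
  consider (zero) k where "k \<in> K" "c k = 0" | (inf) k where "k \<in> K" "c k = \<infinity>" "\<forall>j\<in>K. c j \<noteq> 0"
    | (fin) "\<forall>k\<in>K. c k \<noteq> 0 \<and> c k \<noteq> \<infinity>" by blast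
  then show ?thesis
  proof cases
    case zero
    then have "(\<integral>\<^sup>+x. r k x ^ m \<partial>M) = 0" using cm[of k, symmetric] m by (simp add: zero_power)
    then have "AE x in M. r k x ^ m = 0"
      using zero(1) by (subst (asm) nn_integral_0_iff_AE) auto
    then have "AE x in M. (\<Prod>k\<in>K. r k x) = 0"
      by eventually_elim (use zero(1) K m in auto)
    then have "(\<integral>\<^sup>+x. (\<Prod>k\<in>K. r k x) \<partial>M) = 0"
      by (subst nn_integral_0_iff_AE) auto
    then show ?thesis by simp
  next
    case inf
    then have "(\<Prod>k\<in>K. c k) = \<infinity>"
      using K by (auto simp: ennreal_prod_eq_top)
    then show ?thesis by (simp add: c_def m_def[symmetric])
  next
    case fin
    define a where "a k x = r k x / c k" for k x
    have [measurable]: "a k \<in> borel_measurable M" if "k \<in> K" for k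
      unfolding a_def using that by measurable
    have am: "(\<integral>\<^sup>+x. a k x ^ m \<partial>M) = 1" if "k \<in> K" for k
    proof -
      have inv: "1 / c k ^ m = (1 / c k) ^ m"
        using fin that m by (cases "c k") (auto simp: divide_ennreal ennreal_power power_divide simp flip: ennreal_1)
      have "a k x ^ m = r k x ^ m / c k ^ m" for x
        unfolding a_def using inv by (metis ennreal_times_divide mult.right_neutral power_mult_distrib)
      then have "(\<integral>\<^sup>+x. a k x ^ m \<partial>M) = (\<integral>\<^sup>+x. r k x ^ m \<partial>M) / c k ^ m"
        using that by (simp add: nn_integral_divide)
      moreover have "c k ^ m \<noteq> 0" "c k ^ m \<noteq> \<infinity>"
        using fin that m by (cases "c k"; auto simp: ennreal_power)+
      ultimately show ?thesis
        by (simp add: cm[symmetric] ennreal_divide_self less_top)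
    qed
    have "of_nat m * (\<integral>\<^sup>+x. (\<Prod>k\<in>K. a k x) \<partial>M) = (\<integral>\<^sup>+x. of_nat m * (\<Prod>k\<in>K. a k x) \<partial>M)"
      by (subst nn_integral_cmult) auto
    also have "\<dots> \<le> (\<integral>\<^sup>+x. (\<Sum>k\<in>K. a k x ^ m) \<partial>M)"
      unfolding m_def by (intro nn_integral_mono prod_le_sum_power_ennreal K)
    also have "\<dots> = of_nat m"
      by (subst nn_integral_sum) (auto simp: am, simp add: m_def)
    finally have 1: "(\<integral>\<^sup>+x. (\<Prod>k\<in>K. a k x) \<partial>M) \<le> 1"
      using m ennreal_mult_le_mult_iff[of "of_nat m" "\<integral>\<^sup>+x. (\<Prod>k\<in>K. a k x) \<partial>M" 1] by auto
    have "(\<Prod>k\<in>K. r k x) = (\<Prod>k\<in>K. c k) * (\<Prod>k\<in>K. a k x)" for x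
      unfolding prod.distrib[symmetric] a_def
      by (intro prod.cong refl)
        (use fin in \<open>auto simp: ennreal_times_divide mult.commute[of "c _"] ennreal_mult_divide_eq less_top mult_divide_eq_ennreal\<close>)
    then have "(\<integral>\<^sup>+x. (\<Prod>k\<in>K. r k x) \<partial>M) = (\<Prod>k\<in>K. c k) * (\<integral>\<^sup>+x. (\<Prod>k\<in>K. a k x) \<partial>M)"
      by (simp add: nn_integral_cmult)
    also have "\<dots> \<le> (\<Prod>k\<in>K. c k) * 1"
      by (intro mult_left_mono 1) auto
    finally show ?thesis by (simp add: c_def m_def)
  qed
qed

text \<open>Indices in \<open>K - I\<close> stand for coordinates that have already been integrated out, so that the
  exponent \<open>1 / m\<close> does not change in the induction on \<open>I\<close>.\<close>

lemma nn_integral_prod_marginals_le: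
  fixes g :: "'k \<Rightarrow> ('k \<Rightarrow> real) \<Rightarrow> ennreal"
  assumes I: "finite I" and K: "finite K" "I \<subseteq> K" "card K = Suc m" "m > 0"
    and g: "\<And>k. k \<in> K \<Longrightarrow> g k \<in> borel_measurable (Pi\<^sub>M I (\<lambda>_. lborel))"
  shows "(\<integral>\<^sup>+x. (\<Prod>k\<in>K. enroot m (if k \<in> I then \<integral>\<^sup>+y. g k (x(k := y)) \<partial>lborel else g k x)) \<partial>Pi\<^sub>M I (\<lambda>_. lborel))
    \<le> (\<Prod>k\<in>K. enroot m (\<integral>\<^sup>+x. g k x \<partial>Pi\<^sub>M I (\<lambda>_. lborel)))"
  using I K(2) g
proof (induction I arbitrary: g)
  case empty
  interpret product_sigma_finite "\<lambda>_::'k. lborel :: real measure" by standard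
  show ?case by (simp add: nn_integral_empty)
next
  case (insert j I)
  interpret product_sigma_finite "\<lambda>_::'k. lborel :: real measure" by standard
  let ?P = "\<lambda>I::'k set. Pi\<^sub>M I (\<lambda>_. lborel :: real measure)"
  note g = insert.prems(2)
  have jK: "j \<in> K" and IK: "I \<subseteq> K" using insert.prems by auto
  define K' where "K' = K - {j}"
  have K': "K = insert j K'" "j \<notin> K'" "finite K'" "card K' = m"
    using jK K by (auto simp: K'_def)
  then have "K' \<noteq> {}" using K by auto
  define h where "h k x = (\<integral>\<^sup>+y. g k (x(j := y)) \<partial>lborel)" for k x
  define G where "G k x = (if k \<in> insert j I then \<integral>\<^sup>+y. g k (x(k := y)) \<partial>lborel else g k x)" for k x
  define H where "H k x = (if k \<in> I then \<integral>\<^sup>+y. h k (x(k := y)) \<partial>lborel else h k x)" for k x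
  have upd: "(\<lambda>(x, y). f (x(k := y))) \<in> borel_measurable (?P J \<Otimes>\<^sub>M lborel)"
    if "f \<in> borel_measurable (?P (insert k J))" for f :: "('k \<Rightarrow> real) \<Rightarrow> ennreal" and k J
    using measurable_compose[OF measurable_add_dim that] by (simp add: case_prod_beta')
  have hm [measurable]: "h k \<in> borel_measurable (?P I)" if "k \<in> K" for k
    unfolding h_def by (intro lborel.borel_measurable_nn_integral upd g that)
  have Gm [measurable]: "G k \<in> borel_measurable (?P (insert j I))" if k: "k \<in> K" for k
  proof (cases "k \<in> insert j I")
    case True
    then have e: "insert k (insert j I) = insert j I" by auto
    show ?thesis unfolding G_def using True g[OF k] upd[of "g k" k "insert j I"]
      by (simp add: e)
  next
    case False
    then show ?thesis using g[OF k] unfolding G_def by simp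
  qed
  \<comment> \<open>One integration in the Loomis-Whitney argument. The factor with index
    \<open>j\<close> does not depend on the variable \<open>y\<close> and leaves the integral, and
    exactly m factors remain for Hoelder's inequality with exponent m.\<close>
  have le: "(\<integral>\<^sup>+y. (\<Prod>k\<in>K. enroot m (G k (x(j := y)))) \<partial>lborel) \<le> (\<Prod>k\<in>K. enroot m (H k x))"
    if x: "x \<in> space (?P I)" for x
  proof -
    have ux [measurable]: "(\<lambda>y. x(j := y)) \<in> lborel \<rightarrow>\<^sub>M ?P (insert j I)"
      using measurable_component_update[OF x insert.hyps(2)] .
    have Gy [measurable]: "(\<lambda>y. G k (x(j := y))) \<in> borel_measurable lborel" if "k \<in> K" for k
      using measurable_compose[OF ux Gm[OF that]] .
    have Gj: "G j (x(j := y)) = H j x" for y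
      using insert.hyps by (simp add: G_def H_def h_def)
    have Gk: "(\<integral>\<^sup>+y. G k (x(j := y)) \<partial>lborel) = H k x" if k: "k \<in> K'" for k
    proof (cases "k \<in> I")
      case True
      have kj: "k \<noteq> j" using k K' by auto
      have "(\<lambda>(y, z). g k (x(j := y, k := z))) \<in> borel_measurable (lborel \<Otimes>\<^sub>M lborel)"
      proof -
        have e: "insert k (insert j I) = insert j I" using True by auto
        have "(\<lambda>p. (x(j := fst p), snd p)) \<in> (lborel \<Otimes>\<^sub>M lborel) \<rightarrow>\<^sub>M (?P (insert j I) \<Otimes>\<^sub>M lborel)"
          by measurable
        from measurable_compose[OF this upd[of "g k" k "insert j I"]] show ?thesis
          using g[of k] k K' by (simp add: e case_prod_beta')
      qed
      then have "(\<integral>\<^sup>+y. \<integral>\<^sup>+z. g k (x(j := y, k := z)) \<partial>lborel \<partial>lborel) = (\<integral>\<^sup>+z. \<integral>\<^sup>+y. g k (x(j := y, k := z)) \<partial>lborel \<partial>lborel)"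
        by (rule lborel_pair.Fubini'[symmetric])
      then show ?thesis using True kj by (simp add: G_def H_def h_def fun_upd_twist)
    next
      case False
      moreover have "k \<noteq> j" using k K' by auto
      ultimately show ?thesis by (simp add: G_def H_def h_def)
    qed
    have "(\<integral>\<^sup>+y. (\<Prod>k\<in>K. enroot m (G k (x(j := y)))) \<partial>lborel)
        = (\<integral>\<^sup>+y. enroot m (H j x) * (\<Prod>k\<in>K'. enroot m (G k (x(j := y)))) \<partial>lborel)"
      using K' by (simp add: Gj)
    also have "\<dots> = enroot m (H j x) * (\<integral>\<^sup>+y. (\<Prod>k\<in>K'. enroot m (G k (x(j := y)))) \<partial>lborel)"
      using K' by (intro nn_integral_cmult borel_measurable_prod measurable_compose[OF Gy enroot_measurable]) auto
    also have "\<dots> \<le> enroot m (H j x) * (\<Prod>k\<in>K'. enroot m (\<integral>\<^sup>+y. enroot m (G k (x(j := y))) ^ m \<partial>lborel))"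
      using K' \<open>K' \<noteq> {}\<close> nn_integral_prod_power_le[of K' "\<lambda>k y. enroot m (G k (x(j := y)))" lborel]
      by (intro mult_left_mono) (auto intro!: measurable_compose[OF Gy enroot_measurable])
    also have "\<dots> = (\<Prod>k\<in>K. enroot m (H k x))"
      using K' K by (simp add: Gk)
    finally show ?thesis .
  qed
  have "(\<integral>\<^sup>+x. (\<Prod>k\<in>K. enroot m (G k x)) \<partial>?P (insert j I))
      = (\<integral>\<^sup>+x. \<integral>\<^sup>+y. (\<Prod>k\<in>K. enroot m (G k (x(j := y)))) \<partial>lborel \<partial>?P I)"
    using insert.hyps by (intro product_nn_integral_insert borel_measurable_prod measurable_compose[OF Gm enroot_measurable]) auto
  also have "\<dots> \<le> (\<integral>\<^sup>+x. (\<Prod>k\<in>K. enroot m (H k x)) \<partial>?P I)"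
    by (intro nn_integral_mono le)
  also have "\<dots> \<le> (\<Prod>k\<in>K. enroot m (\<integral>\<^sup>+x. h k x \<partial>?P I))"
    unfolding H_def using IK by (intro insert.IH hm) auto
  also have "\<dots> = (\<Prod>k\<in>K. enroot m (\<integral>\<^sup>+x. g k x \<partial>?P (insert j I)))"
    using insert.hyps g by (intro prod.cong refl) (simp add: h_def product_nn_integral_insert)
  finally show ?case unfolding G_def .
qed

section \<open>The gradient inequality in L^1 by integration along coordinate lines\<close>

lemma enroot_mono: "m > 0 \<Longrightarrow> x \<le> y \<Longrightarrow> enroot m x \<le> enroot m y"
  by (cases x; cases y) (auto simp: enroot_def top_unique intro!: ennreal_leI)

lemma enroot_ennreal:
  assumes "m > 0" "x \<ge> 0"
  shows "enroot m (ennreal x) ^ Suc m = ennreal (x powr (real (Suc m) / real m))"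
proof (cases "x = 0")
  case False
  have "root m x ^ Suc m = (x powr (1 / real m)) powr real (Suc m)"
    using assms False by (simp add: root_powr_inverse powr_realpow del: power_Suc of_nat_Suc)
  also have "\<dots> = x powr (real (Suc m) / real m)" by (simp add: powr_powr)
  finally show ?thesis using assms
    by (simp add: enroot_def ennreal_power del: power_Suc of_nat_Suc)
qed (use assms in \<open>simp add: enroot_def\<close>)

text \<open>Fundamental theorem of calculus on the line through x in direction i, starting outside
  the support. Enlarging the integral to the whole line makes the bound independent of the i-th
  coordinate of x.\<close>

lemma abs_le_line_integral:
  fixes v :: "'a::euclidean_space \<Rightarrow> real"
  assumes i: "i \<in> Basis"
    and deriv: "\<And>x. (v has_derivative v' x) (at x)"
    and cont: "continuous_on UNIV (\<lambda>x. v' x i)"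
    and bound: "\<And>x. \<bar>v' x i\<bar> \<le> g x"
    and supp: "\<And>x. norm x \<ge> R \<Longrightarrow> v x = 0"
  shows "ennreal \<bar>v x\<bar> \<le> (\<integral>\<^sup>+y. ennreal (g (x + (y - x \<bullet> i) *\<^sub>R i)) \<partial>lborel)"
proof -
  let ?l = "\<lambda>y. x + (y - x \<bullet> i) *\<^sub>R i"
  \<comment> \<open>The i-th coordinate alone gives this starting point norm at least R, and it lies
    to the left of \<open>x \<bullet> i\<close>.\<close>
  define c where "c = - (\<bar>R\<bar> + \<bar>x \<bullet> i\<bar>)"
  have c: "c \<le> x \<bullet> i" by (auto simp: c_def)
  have "norm (?l c) \<ge> \<bar>?l c \<bullet> i\<bar>" by (rule Basis_le_norm[OF i])
  also have "?l c \<bullet> i = c" using i by (simp add: inner_add_left)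
  finally have "norm (?l c) \<ge> R" by (simp add: c_def)
  then have v0: "v (?l c) = 0" by (rule supp)
  have D: "((\<lambda>y. v (?l y)) has_real_derivative v' (?l y) i) (at y)" for y
  proof -
    have "(?l has_derivative (\<lambda>h. h *\<^sub>R i)) (at y)" by (auto intro!: derivative_eq_intros)
    then have "((\<lambda>y. v (?l y)) has_derivative (\<lambda>h. v' (?l y) (h *\<^sub>R i))) (at y)"
      using deriv by (rule has_derivative_compose)
    moreover have "v' (?l y) (h *\<^sub>R i) = v' (?l y) i * h" for h
      using has_derivative_linear[OF deriv[of "?l y"]] by (simp add: linear_cmul)
    ultimately show ?thesis by (simp add: has_field_derivative_def)
  qed
  have ct: "continuous_on UNIV (\<lambda>y. v' (?l y) i)"
    by (rule continuous_on_compose2[OF cont]) (auto intro!: continuous_intros)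
  have "(\<integral>y. (v' (?l y) i) * indicator {c..x \<bullet> i} y \<partial>lborel) = v (?l (x \<bullet> i)) - v (?l c)"
    using c D ct by (intro integral_FTC_Icc_real) (auto simp: continuous_on_eq_continuous_at)
  then have "\<bar>v x\<bar> = norm (\<integral>y. (v' (?l y) i) * indicator {c..x \<bullet> i} y \<partial>lborel)"
    using v0 by simp
  also have "ennreal \<dots> \<le> (\<integral>\<^sup>+y. norm ((v' (?l y) i) * indicator {c..x \<bullet> i} y) \<partial>lborel)"
  proof (rule integral_norm_bound_ennreal)
    have "set_integrable lborel {c..x \<bullet> i} (\<lambda>y. v' (?l y) i)"
      by (rule borel_integrable_atLeastAtMost') (auto intro: continuous_on_subset[OF ct])
    then show "integrable lborel (\<lambda>y. v' (?l y) i * indicator {c..x \<bullet> i} y)"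
      by (simp add: set_integrable_def mult.commute)
  qed
  also have "\<dots> \<le> (\<integral>\<^sup>+y. ennreal (g (?l y)) \<partial>lborel)"
    using bound order_trans[OF abs_ge_zero bound]
    by (intro nn_integral_mono ennreal_leI) (auto simp: indicator_def)
  finally show ?thesis .
qed

text \<open>Each of the m + 1 coordinate directions bounds \<open>\<bar>v x\<bar>\<close> by a line
  integral that is free of one variable. The product of the m-th roots of these bounds has the form
  treated by \<open>nn_integral_prod_marginals_le\<close>.\<close>

lemma gagliardo_nirenberg_sobolev_nn:
  fixes v g :: "'a::euclidean_space \<Rightarrow> real"
  assumes dim: "DIM('a) = Suc m" "m > 0"
    and deriv: "\<And>x. (v has_derivative v' x) (at x)"
    and cont: "\<And>i. i \<in> Basis \<Longrightarrow> continuous_on UNIV (\<lambda>x. v' x i)"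
    and bound: "\<And>x i. i \<in> Basis \<Longrightarrow> \<bar>v' x i\<bar> \<le> g x"
    and supp: "\<And>x. norm x \<ge> R \<Longrightarrow> v x = 0"
    and g [measurable]: "g \<in> borel_measurable borel"
  shows "(\<integral>\<^sup>+x. enroot m \<bar>v x\<bar> ^ Suc m \<partial>lborel) \<le> enroot m (\<integral>\<^sup>+x. g x \<partial>lborel) ^ Suc m"
proof -
  let ?P = "Pi\<^sub>M (Basis::'a set) (\<lambda>_. lborel :: real measure)"
  let ?S = "\<lambda>f. \<Sum>b\<in>(Basis::'a set). f b *\<^sub>R b"
  have "continuous_on UNIV v"
    using deriv has_derivative_continuous_on[of UNIV v] by (auto intro: has_derivative_at_withinI)
  then have [measurable]: "v \<in> borel_measurable borel" by (rule borel_measurable_continuous_onI)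
  have Sm [measurable]: "?S \<in> ?P \<rightarrow>\<^sub>M borel" by measurable
  have lb: "(\<integral>\<^sup>+x. f x \<partial>lborel) = (\<integral>\<^sup>+x. f (?S x) \<partial>?P)"
    if "f \<in> borel_measurable borel" for f :: "'a \<Rightarrow> ennreal"
    by (subst lborel_eq) (simp add: nn_integral_distr that)
  have S_upd: "?S (x(i := y)) = ?S x + (y - ?S x \<bullet> i) *\<^sub>R i" if i: "i \<in> Basis" for x i y
  proof -
    have "?S (x(i := y)) = y *\<^sub>R i + (\<Sum>b\<in>Basis - {i}. x b *\<^sub>R b)"
      using i by (simp add: sum.remove)
    moreover have "?S x = x i *\<^sub>R i + (\<Sum>b\<in>Basis - {i}. x b *\<^sub>R b)"
      using i by (simp add: sum.remove)
    moreover have "?S x \<bullet> i = x i" using i by simp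
    ultimately show ?thesis by (simp add: algebra_simps)
  qed
  have "(\<integral>\<^sup>+x. enroot m \<bar>v x\<bar> ^ Suc m \<partial>lborel) = (\<integral>\<^sup>+x. (\<Prod>i\<in>(Basis::'a set). enroot m \<bar>v (?S x)\<bar>) \<partial>?P)"
    by (subst lb) (simp_all add: dim del: power_Suc)
  also have "\<dots> \<le> (\<integral>\<^sup>+x. (\<Prod>i\<in>Basis. enroot m (if i \<in> Basis then \<integral>\<^sup>+y. ennreal (g (?S (x(i := y)))) \<partial>lborel
      else ennreal (g (?S x)))) \<partial>?P)"
  proof (intro nn_integral_mono prod_mono_ennreal)
    fix x and i :: 'a assume i: "i \<in> Basis"
    have "ennreal \<bar>v (?S x)\<bar> \<le> (\<integral>\<^sup>+y. ennreal (g (?S (x(i := y)))) \<partial>lborel)"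
      unfolding S_upd[OF i]
      by (rule abs_le_line_integral[OF i deriv cont[OF i] bound[OF i] supp])
    then show "enroot m \<bar>v (?S x)\<bar> \<le> enroot m (if i \<in> Basis then \<integral>\<^sup>+y. ennreal (g (?S (x(i := y)))) \<partial>lborel
      else ennreal (g (?S x)))"
      using i dim by (simp add: enroot_mono)
  qed
  also have "\<dots> \<le> (\<Prod>i\<in>(Basis::'a set). enroot m (\<integral>\<^sup>+x. g (?S x) \<partial>?P))"
    using dim by (intro nn_integral_prod_marginals_le) auto
  also have "\<dots> = enroot m (\<integral>\<^sup>+x. g x \<partial>lborel) ^ Suc m"
    by (subst lb) (simp_all add: dim del: power_Suc)
  finally show ?thesis .
qed

lemma gagliardo_nirenberg_sobolev:
  fixes v g :: "'a::euclidean_space \<Rightarrow> real"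
  assumes dim: "DIM('a) = Suc m" "m > 0"
    and deriv: "\<And>x. (v has_derivative v' x) (at x)"
    and cont: "\<And>i. i \<in> Basis \<Longrightarrow> continuous_on UNIV (\<lambda>x. v' x i)"
    and bound: "\<And>x i. i \<in> Basis \<Longrightarrow> \<bar>v' x i\<bar> \<le> g x"
    and supp: "\<And>x. norm x \<ge> R \<Longrightarrow> v x = 0"
    and g: "g \<in> borel_measurable borel" "integrable lborel g"
  shows "integrable lborel (\<lambda>x. \<bar>v x\<bar> powr (real (Suc m) / real m))"
    and "(\<integral>x. \<bar>v x\<bar> powr (real (Suc m) / real m) \<partial>lborel) \<le> (\<integral>x. g x \<partial>lborel) powr (real (Suc m) / real m)"
proof -
  let ?s = "real (Suc m) / real m"
  have "continuous_on UNIV v"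
    using deriv has_derivative_continuous_on[of UNIV v] by (auto intro: has_derivative_at_withinI)
  then have [measurable]: "v \<in> borel_measurable borel" by (rule borel_measurable_continuous_onI)
  obtain i :: 'a where "i \<in> Basis" using nonempty_Basis by blast
  then have g0: "g x \<ge> 0" for x using order_trans[OF abs_ge_zero bound] by blast
  then have "(\<integral>\<^sup>+x. g x \<partial>lborel) = ennreal (\<integral>x. g x \<partial>lborel)"
    using g by (intro nn_integral_eq_integral) auto
  then have le: "(\<integral>\<^sup>+x. ennreal (\<bar>v x\<bar> powr ?s) \<partial>lborel) \<le> ennreal ((\<integral>x. g x \<partial>lborel) powr ?s)"
    using gagliardo_nirenberg_sobolev_nn[OF dim deriv cont bound supp g(1)] dim g0
    by (simp add: enroot_ennreal integral_nonneg_AE del: power_Suc of_nat_Suc)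
  show int: "integrable lborel (\<lambda>x. \<bar>v x\<bar> powr ?s)"
    by (rule integrableI_bounded) (use le in \<open>auto simp: less_top[symmetric] top_unique\<close>)
  have "(\<integral>\<^sup>+x. ennreal (\<bar>v x\<bar> powr ?s) \<partial>lborel) = ennreal (\<integral>x. \<bar>v x\<bar> powr ?s \<partial>lborel)"
    by (intro nn_integral_eq_integral int) auto
  then show "(\<integral>x. \<bar>v x\<bar> powr ?s \<partial>lborel) \<le> (\<integral>x. g x \<partial>lborel) powr ?s"
    using le by (simp add: ennreal_le_iff)
qed

section \<open>Calculus of powers of the absolute value, and the Cauchy-Schwarz inequality\<close>

lemma isCont_abs_powr: "s > 0 \<Longrightarrow> isCont (\<lambda>z::real. \<bar>z\<bar> powr s) z"
  unfolding isCont_def by (rule tendsto_powr') (auto intro!: tendsto_eq_intros)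

lemma continuous_on_abs_powr [continuous_intros]:
  fixes f :: "'x::topological_space \<Rightarrow> real"
  shows "s > 0 \<Longrightarrow> continuous_on A f \<Longrightarrow> continuous_on A (\<lambda>x. \<bar>f x\<bar> powr s)"
  by (rule continuous_on_compose2[of UNIV "\<lambda>z. \<bar>z\<bar> powr s"])
    (auto intro!: continuous_at_imp_continuous_on isCont_abs_powr)

lemma continuous_on_sgn_abs_powr:
  fixes f :: "'x::topological_space \<Rightarrow> real"
  assumes "s > 0" "continuous_on A f"
  shows "continuous_on A (\<lambda>x. sgn (f x) * \<bar>f x\<bar> powr s)"
proof (rule continuous_on_compose2[OF _ assms(2) subset_UNIV])
  show "continuous_on UNIV (\<lambda>z::real. sgn z * \<bar>z\<bar> powr s)"
  proof (intro continuous_at_imp_continuous_on ballI)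
    fix z :: real
    show "isCont (\<lambda>z. sgn z * \<bar>z\<bar> powr s) z"
    proof (cases "z = 0")
      case True
      have "((\<lambda>z::real. sgn z * \<bar>z\<bar> powr s) \<longlongrightarrow> 0) (at 0)"
      proof (rule Lim_null_comparison)
        show "\<forall>\<^sub>F h::real in at 0. norm (sgn h * \<bar>h\<bar> powr s) \<le> \<bar>h\<bar> powr s"
          by (auto simp: abs_mult sgn_if)
        show "((\<lambda>h::real. \<bar>h\<bar> powr s) \<longlongrightarrow> 0) (at 0)"
          using isCont_abs_powr[of s 0] assms by (simp add: isCont_def)
      qed
      then show ?thesis using True by (simp add: isCont_def)
    next
      case False
      then show ?thesis
        using assms by (intro isCont_mult isCont_abs_powr isCont_sgn) auto
    qed
  qed
qed

lemma DERIV_abs_powr: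
  fixes z :: real
  assumes "s > 1"
  shows "((\<lambda>z. \<bar>z\<bar> powr s) has_real_derivative s * (sgn z * \<bar>z\<bar> powr (s - 1))) (at z)"
proof -
  consider "z > 0" | "z < 0" | "z = 0" by linarith
  then show ?thesis
  proof cases
    case 1
    have "((\<lambda>z. z powr s) has_real_derivative s * z powr (s - 1)) (at z)"
      using 1 by (auto intro!: derivative_eq_intros)
    moreover have "\<forall>\<^sub>F y in nhds z. y > 0" using 1 eventually_nhds_in_open[of "{0<..}" z] by auto
    ultimately show ?thesis using 1
      by (subst DERIV_cong_ev[OF refl _ refl, where g = "\<lambda>z. z powr s"]) (auto elim: eventually_mono)
  next
    case 2
    have "((\<lambda>z. (- z) powr s) has_real_derivative - s * (- z) powr (s - 1)) (at z)"
      using 2 by (auto intro!: derivative_eq_intros)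
    moreover have "\<forall>\<^sub>F y in nhds z. y < 0" using 2 eventually_nhds_in_open[of "{..<0}" z] by auto
    ultimately show ?thesis using 2
      by (subst DERIV_cong_ev[OF refl _ refl, where g = "\<lambda>z. (- z) powr s"]) (auto elim: eventually_mono)
  next
    case 3
    have "((\<lambda>h::real. \<bar>h\<bar> powr s / h) \<longlongrightarrow> 0) (at 0)"
    proof (rule Lim_null_comparison)
      show "\<forall>\<^sub>F h in at 0. norm (\<bar>h\<bar> powr s / h) \<le> \<bar>h\<bar> powr (s - 1)"
        by (auto simp: eventually_at_filter powr_diff abs_divide)
      show "((\<lambda>h::real. \<bar>h\<bar> powr (s - 1)) \<longlongrightarrow> 0) (at 0)"
        using isCont_abs_powr[of "s - 1" 0] assms by (simp add: isCont_def)
    qed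
    then show ?thesis using 3 by (simp add: has_field_derivative_iff)
  qed
qed

lemma DERIV_sgn_abs_powr:
  fixes z :: real
  assumes "s > 1"
  shows "((\<lambda>z. sgn z * \<bar>z\<bar> powr s) has_real_derivative s * \<bar>z\<bar> powr (s - 1)) (at z)"
proof (cases "z = 0")
  case True
  have "((\<lambda>h::real. sgn h * \<bar>h\<bar> powr s / h) \<longlongrightarrow> 0) (at 0)"
  proof (rule Lim_null_comparison)
    show "\<forall>\<^sub>F h in at 0. norm (sgn h * \<bar>h\<bar> powr s / h) \<le> \<bar>h\<bar> powr (s - 1)"
      by (auto simp: eventually_at_filter powr_diff abs_divide abs_mult sgn_if)
    show "((\<lambda>h::real. \<bar>h\<bar> powr (s - 1)) \<longlongrightarrow> 0) (at 0)"
      using isCont_abs_powr[of "s - 1" 0] assms by (simp add: isCont_def)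
  qed
  then show ?thesis using True by (simp add: has_field_derivative_iff)
next
  case False
  define c where "c = sgn z"
  have "((\<lambda>y. c * \<bar>y\<bar> powr s) has_real_derivative c * (s * (sgn z * \<bar>z\<bar> powr (s - 1)))) (at z)"
    by (intro DERIV_cmult DERIV_abs_powr assms)
  moreover have "c * (s * (sgn z * \<bar>z\<bar> powr (s - 1))) = s * \<bar>z\<bar> powr (s - 1)"
    using False by (simp add: c_def sgn_if)
  moreover have "\<forall>\<^sub>F y in nhds z. sgn y = c"
  proof (cases "z > 0")
    case True
    then show ?thesis using eventually_nhds_in_open[of "{0<..}" z] by (auto simp: c_def elim: eventually_mono)
  next
    case F: False
    then have "z < 0" using False by simp
    then show ?thesis using eventually_nhds_in_open[of "{..<0}" z] by (auto simp: c_def elim: eventually_mono)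
  qed
  ultimately show ?thesis
    by (subst DERIV_cong_ev[OF refl _ refl, where g = "\<lambda>y. c * \<bar>y\<bar> powr s"]) (auto elim: eventually_mono)
qed

lemma cauchy_schwarz_integral:
  fixes f g :: "'x \<Rightarrow> real"
  assumes [measurable]: "f \<in> borel_measurable M" "g \<in> borel_measurable M"
    and f2: "integrable M (\<lambda>x. (f x)\<^sup>2)" and g2: "integrable M (\<lambda>x. (g x)\<^sup>2)"
  shows "integrable M (\<lambda>x. f x * g x)"
    and "(\<integral>x. f x * g x \<partial>M)\<^sup>2 \<le> (\<integral>x. (f x)\<^sup>2 \<partial>M) * (\<integral>x. (g x)\<^sup>2 \<partial>M)"
proof -
  show fg: "integrable M (\<lambda>x. f x * g x)"
  proof (rule Bochner_Integration.integrable_bound[OF Bochner_Integration.integrable_add[OF f2 g2]])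
    show "AE x in M. norm (f x * g x) \<le> norm ((f x)\<^sup>2 + (g x)\<^sup>2)"
    proof (intro AE_I2)
      fix x
      have "2 * \<bar>f x\<bar> * \<bar>g x\<bar> \<le> \<bar>f x\<bar>\<^sup>2 + \<bar>g x\<bar>\<^sup>2" "0 \<le> \<bar>f x\<bar> * \<bar>g x\<bar>"
        by (rule sum_squares_bound) simp
      then have "\<bar>f x\<bar> * \<bar>g x\<bar> \<le> \<bar>f x\<bar>\<^sup>2 + \<bar>g x\<bar>\<^sup>2" by linarith
      then show "norm (f x * g x) \<le> norm ((f x)\<^sup>2 + (g x)\<^sup>2)"
        by (simp add: abs_mult)
    qed
  qed measurable
  define F where "F = (\<integral>x. (f x)\<^sup>2 \<partial>M)"
  define G where "G = (\<integral>x. (g x)\<^sup>2 \<partial>M)"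
  define B where "B = (\<integral>x. f x * g x \<partial>M)"
  have q: "0 \<le> F + 2 * t * B + t\<^sup>2 * G" for t
  proof -
    have "0 \<le> (\<integral>x. (f x + t * g x)\<^sup>2 \<partial>M)" by simp
    also have "(\<lambda>x. (f x + t * g x)\<^sup>2) = (\<lambda>x. (f x)\<^sup>2 + (2 * t) * (f x * g x) + t\<^sup>2 * (g x)\<^sup>2)"
      by (auto simp: power2_eq_square algebra_simps)
    also have "(\<integral>x. (f x)\<^sup>2 + (2 * t) * (f x * g x) + t\<^sup>2 * (g x)\<^sup>2 \<partial>M) = F + 2 * t * B + t\<^sup>2 * G"
      using f2 g2 fg by (simp add: F_def G_def B_def)
    finally show ?thesis .
  qed
  have "B\<^sup>2 \<le> F * G"
  proof (cases "G = 0")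
    case True
    have "B = 0"
    proof (rule ccontr)
      assume "B \<noteq> 0"
      \<comment> \<open>For G = 0 the quadratic is affine in t, and this t gives it the value
        -1.\<close>
      then show False using q[of "- (F + 1) / (2 * B)"] True by (simp add: field_simps)
    qed
    then show ?thesis using True by simp
  next
    case False
    then have "G > 0" by (simp add: G_def order_less_le)
    then show ?thesis using q[of "- B / G"] by (simp add: field_simps power2_eq_square)
  qed
  then show "(\<integral>x. f x * g x \<partial>M)\<^sup>2 \<le> (\<integral>x. (f x)\<^sup>2 \<partial>M) * (\<integral>x. (g x)\<^sup>2 \<partial>M)"
    by (simp add: B_def F_def G_def)
qed

section \<open>The Sobolev inequality at the critical exponent\<close>

lemma integrable_continuous_compact_support:
  fixes f :: "'a::euclidean_space \<Rightarrow> 'b::euclidean_space"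
  assumes "continuous_on UNIV f" "\<And>x. norm x \<ge> R \<Longrightarrow> f x = 0"
  shows "integrable lborel f"
proof -
  have "integrable lborel (\<lambda>x. indicator (cball 0 R) x *\<^sub>R f x)"
    using assms by (intro borel_integrable_compact) (auto intro: continuous_on_subset)
  moreover have "(\<lambda>x. indicator (cball 0 R) x *\<^sub>R f x) = f"
    using assms(2) by (auto simp: fun_eq_iff indicator_def)
  ultimately show ?thesis by simp
qed

text \<open>The L^1 gradient inequality is applied to \<open>\<bar>v\<bar> powr \<gamma>\<close>.
  The choice \<gamma> = 2 (N - 1) / (N - 2) gives both \<gamma> s = q and 2 (\<gamma> - 1) = q, so
  that after Cauchy-Schwarz the same integral X of \<open>\<bar>v\<bar> powr q\<close> stands on
  both sides.\<close>

lemma sobolev_inequality: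
  fixes v g :: "'a::euclidean_space \<Rightarrow> real"
  assumes dim: "DIM('a) > 2"
    and deriv: "\<And>x. (v has_derivative v' x) (at x)"
    and cont: "\<And>i. i \<in> Basis \<Longrightarrow> continuous_on UNIV (\<lambda>x. v' x i)"
    and bound: "\<And>x i. i \<in> Basis \<Longrightarrow> \<bar>v' x i\<bar> \<le> g x"
    and supp: "\<And>x. norm x \<ge> R \<Longrightarrow> v x = 0"
    and g: "g \<in> borel_measurable borel" "integrable lborel (\<lambda>x. (g x)\<^sup>2)"
  defines "q \<equiv> crit_exp DIM('a)"
  shows "(\<integral>x. \<bar>v x\<bar> powr q \<partial>lborel) \<le> ((2 * (real DIM('a) - 1) / (real DIM('a) - 2))\<^sup>2 * (\<integral>x. (g x)\<^sup>2 \<partial>lborel)) powr (q / 2)"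
proof -
  define N where "N = real DIM('a)"
  have N: "N > 2" using dim by (simp add: N_def)
  define m where "m = DIM('a) - 1"
  have m: "DIM('a) = Suc m" "m > 0" using dim by (auto simp: m_def)
  have Nm: "N = real m + 1" by (simp add: N_def m)
  define \<gamma> where "\<gamma> = 2 * (N - 1) / (N - 2)"
  have \<gamma>: "\<gamma> > 1" using N by (simp add: \<gamma>_def field_simps)
  define s where "s = real (Suc m) / real m"
  have s: "s = N / (N - 1)" by (simp add: s_def Nm add.commute)
  have q: "q = 2 * N / (N - 2)" by (simp add: q_def crit_exp_def N_def)
  have \<gamma>s: "\<gamma> * s = q" using N by (auto simp: \<gamma>_def s q divide_simps)
  have \<gamma>q: "2 * (\<gamma> - 1) = q" using N by (simp add: \<gamma>_def q field_simps)
  have qpos: "q > 0" using N by (simp add: q)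
  have vc: "continuous_on UNIV v"
    using deriv has_derivative_continuous_on[of UNIV v] by (auto intro: has_derivative_at_withinI)
  then have [measurable]: "v \<in> borel_measurable borel" by (rule borel_measurable_continuous_onI)
  note [measurable] = g(1)
  define X where "X = (\<integral>x. \<bar>v x\<bar> powr q \<partial>lborel)"
  define A where "A = (\<integral>x. (g x)\<^sup>2 \<partial>lborel)"
  have X0: "X \<ge> 0" and A0: "A \<ge> 0" by (simp_all add: X_def A_def)
  have vq: "integrable lborel (\<lambda>x. \<bar>v x\<bar> powr q)"
    using qpos supp by (intro integrable_continuous_compact_support[where R = R] continuous_intros vc) auto
  have sq: "(\<lambda>x. (\<bar>v x\<bar> powr (\<gamma> - 1))\<^sup>2) = (\<lambda>x. \<bar>v x\<bar> powr q)"
    using \<gamma>q by (simp add: power2_eq_square flip: powr_add)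
  define G where "G x = \<gamma> * (\<bar>v x\<bar> powr (\<gamma> - 1) * g x)" for x
  note cs = cauchy_schwarz_integral[of "\<lambda>x. \<bar>v x\<bar> powr (\<gamma> - 1)" lborel g, unfolded sq, OF _ _ vq g(2)]
  have Gint: "integrable lborel G" unfolding G_def using cs(1) by simp
  have "(\<integral>x. G x \<partial>lborel)\<^sup>2 \<le> \<gamma>\<^sup>2 * (X * A)"
    unfolding G_def using cs(2) by (simp add: power_mult_distrib X_def A_def mult_left_mono)
  moreover have "X \<le> (\<integral>x. G x \<partial>lborel) powr s"
  proof -
    have "(\<integral>x. \<bar>\<bar>v x\<bar> powr \<gamma>\<bar> powr s \<partial>lborel) \<le> (\<integral>x. G x \<partial>lborel) powr s"
      unfolding s_def
    proof (rule gagliardo_nirenberg_sobolev(2)[OF m, where R = R and v' = "\<lambda>x h. \<gamma> * (sgn (v x) * \<bar>v x\<bar> powr (\<gamma> - 1)) * v' x h"])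
      fix x
      have "((\<lambda>z. \<bar>z\<bar> powr \<gamma>) has_derivative (\<lambda>h. \<gamma> * (sgn (v x) * \<bar>v x\<bar> powr (\<gamma> - 1)) * h)) (at (v x))"
        using DERIV_abs_powr[OF \<gamma>] by (simp add: has_field_derivative_def)
      from has_derivative_compose[OF deriv this]
      show "((\<lambda>x. \<bar>v x\<bar> powr \<gamma>) has_derivative (\<lambda>h. \<gamma> * (sgn (v x) * \<bar>v x\<bar> powr (\<gamma> - 1)) * v' x h)) (at x)" .
    next
      fix i :: 'a assume i: "i \<in> Basis"
      show "continuous_on UNIV (\<lambda>x. \<gamma> * (sgn (v x) * \<bar>v x\<bar> powr (\<gamma> - 1)) * v' x i)"
        using \<gamma> by (intro continuous_on_mult continuous_on_const continuous_on_sgn_abs_powr vc cont[OF i]) auto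
    next
      fix x and i :: 'a assume i: "i \<in> Basis"
      show "\<bar>\<gamma> * (sgn (v x) * \<bar>v x\<bar> powr (\<gamma> - 1)) * v' x i\<bar> \<le> G x"
        using \<gamma> bound[OF i, of x]
        by (cases "v x = 0") (auto simp: G_def abs_mult abs_sgn_eq mult_left_mono)
    qed (use supp Gint \<gamma> in \<open>auto simp: G_def[abs_def]\<close>)
    moreover have "\<bar>\<bar>v x\<bar> powr \<gamma>\<bar> powr s = \<bar>v x\<bar> powr q" for x
      using \<gamma>s by (simp add: powr_powr)
    ultimately show ?thesis by (simp add: X_def)
  qed
  moreover have "(\<integral>x. G x \<partial>lborel) \<ge> 0"
  proof -
    obtain i :: 'a where "i \<in> Basis" using nonempty_Basis by blast
    then have "g x \<ge> 0" for x using order_trans[OF abs_ge_zero bound] by blast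
    then show ?thesis using \<gamma> by (simp add: G_def[abs_def])
  qed
  ultimately have "X powr 2 \<le> (\<gamma>\<^sup>2 * (X * A)) powr s"
  proof -
    assume h: "(\<integral>x. G x \<partial>lborel)\<^sup>2 \<le> \<gamma>\<^sup>2 * (X * A)" "X \<le> (\<integral>x. G x \<partial>lborel) powr s" "(\<integral>x. G x \<partial>lborel) \<ge> 0"
    have s0: "s > 0" using N by (simp add: s)
    have "X powr 2 \<le> ((\<integral>x. G x \<partial>lborel) powr s) powr 2"
      using X0 h by (intro powr_mono2) auto
    also have "\<dots> = ((\<integral>x. G x \<partial>lborel) powr 2) powr s" by (simp add: powr_powr mult.commute)
    also have "\<dots> \<le> (\<gamma>\<^sup>2 * (X * A)) powr s" using h s0 by (intro powr_mono2) auto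
    finally show ?thesis .
  qed
  \<comment> \<open>Cancel X^s in X^2 <= (\<gamma>^2 X A)^s; the remaining exponent 2 - s is
    positive because N > 2.\<close>
  have "X \<le> (\<gamma>\<^sup>2 * A) powr (q / 2)"
  proof (cases "X = 0")
    case False
    then have X: "X > 0" using X0 by simp
    have "X powr (2 - s) * X powr s \<le> (\<gamma>\<^sup>2 * A) powr s * X powr s"
      using \<open>X powr 2 \<le> _\<close> X A0 by (simp add: mult_ac flip: powr_add powr_mult)
    then have "X powr (2 - s) \<le> (\<gamma>\<^sup>2 * A) powr s" using X by simp
    then have "(X powr (2 - s)) powr (1 / (2 - s)) \<le> ((\<gamma>\<^sup>2 * A) powr s) powr (1 / (2 - s))"
      using N by (intro powr_mono2) (auto simp: s field_simps)
    moreover have "2 - s = (N - 2) / (N - 1)" using N by (simp add: s field_simps)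
    then have "2 - s \<noteq> 0" "s / (2 - s) = q / 2"
      using N by (auto simp: s q divide_simps)
    ultimately show ?thesis using X by (simp add: powr_powr)
  qed auto
  then show ?thesis by (simp add: X_def A_def \<gamma>_def N_def)
qed

section \<open>Smooth functions and test functions\<close>

definition grad :: "('a::euclidean_space \<Rightarrow> real) \<Rightarrow> 'a \<Rightarrow> 'a" where
  "grad f x = (\<Sum>i\<in>Basis. partial i f x *\<^sub>R i)"

lemma grad_inner [simp]: "i \<in> Basis \<Longrightarrow> grad f x \<bullet> i = partial i f x"
  by (simp add: grad_def inner_sum_left inner_Basis if_distrib cong: if_cong)

lemma partial_eqI: "(f has_derivative f') (at x) \<Longrightarrow> partial i f x = f' i"
  unfolding partial_def by (simp add: frechet_derivative_at[symmetric])

lemma has_derivative_grad: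
  assumes "f differentiable (at x)"
  shows "(f has_derivative (\<lambda>h. grad f x \<bullet> h)) (at x)"
proof -
  have d: "(f has_derivative frechet_derivative f (at x)) (at x)"
    using assms by (simp add: frechet_derivative_works)
  then have lin: "linear (frechet_derivative f (at x))" by (rule has_derivative_linear)
  have "frechet_derivative f (at x) = (\<lambda>h. grad f x \<bullet> h)"
  proof
    fix h
    have "frechet_derivative f (at x) h = frechet_derivative f (at x) (\<Sum>i\<in>Basis. (h \<bullet> i) *\<^sub>R i)"
      by (simp add: euclidean_representation)
    also have "\<dots> = (\<Sum>i\<in>Basis. (h \<bullet> i) * partial i f x)"
      using lin by (simp add: linear_sum linear_cmul partial_def o_def)
    also have "\<dots> = grad f x \<bullet> h"
      by (simp add: grad_def inner_sum_left) (simp add: inner_commute mult.commute)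
    finally show "frechet_derivative f (at x) h = grad f x \<bullet> h" .
  qed
  then show ?thesis using d by simp
qed

section \<open>Closure properties of the classes C^k and a flat function of one variable\<close>

lemma Ck_imp_continuous: "Ck k f \<Longrightarrow> continuous_on UNIV f"
proof (cases k)
  case (Suc m)
  assume "Ck k f"
  then have "\<And>x. f differentiable (at x)" using Suc by simp
  then show ?thesis
    by (intro continuous_at_imp_continuous_on ballI differentiable_imp_continuous_within)
qed simp

lemma Ck_SucD: "Ck (Suc k) f \<Longrightarrow> Ck k f"
proof (induction k arbitrary: f)
  case 0
  then show ?case using Ck_imp_continuous[OF 0] by (simp only: Ck.simps(1))
qed auto

lemma Ck_Suc_differentiable: "Ck (Suc k) f \<Longrightarrow> f differentiable (at x)"
  by simp

lemma Ck_const [simp]: "Ck k (\<lambda>_. c)"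
proof (induction k arbitrary: c)
  case (Suc k)
  have "partial i (\<lambda>_::'a. c) = (\<lambda>_. 0)" for i
    by (rule ext, rule partial_eqI) auto
  then show ?case using Suc by simp
qed simp

lemma Ck_add: "Ck k f \<Longrightarrow> Ck k g \<Longrightarrow> Ck k (\<lambda>x. f x + g x)"
proof (induction k arbitrary: f g)
  case (Suc k)
  have "partial i (\<lambda>x. f x + g x) = (\<lambda>x. partial i f x + partial i g x)" if "i \<in> Basis" for i
    by (rule ext, subst partial_eqI[OF has_derivative_add[OF has_derivative_grad[OF Ck_Suc_differentiable[OF Suc.prems(1)]]
        has_derivative_grad[OF Ck_Suc_differentiable[OF Suc.prems(2)]]]]) (simp add: that)
  then show ?case using Suc by (auto intro!: differentiable_add)
qed (auto intro: continuous_intros)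

lemma Ck_mult: "Ck k f \<Longrightarrow> Ck k g \<Longrightarrow> Ck k (\<lambda>x. f x * g x)"
proof (induction k arbitrary: f g)
  case (Suc k)
  have "partial i (\<lambda>x. f x * g x) = (\<lambda>x. f x * partial i g x + partial i f x * g x)" if "i \<in> Basis" for i
    by (rule ext, subst partial_eqI[OF has_derivative_mult[OF has_derivative_grad[OF Ck_Suc_differentiable[OF Suc.prems(1)]]
        has_derivative_grad[OF Ck_Suc_differentiable[OF Suc.prems(2)]]]]) (simp add: that)
  moreover have "Ck k (\<lambda>x. f x * partial i g x + partial i f x * g x)" if "i \<in> Basis" for i
    using Suc.prems that by (intro Ck_add Suc.IH Ck_SucD[OF Suc.prems(1)] Ck_SucD[OF Suc.prems(2)]) auto
  ultimately show ?case using Suc.prems by (auto intro!: differentiable_mult)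
qed (auto intro: continuous_intros)

lemma Ck_inverse: "(\<And>x. f x \<noteq> 0) \<Longrightarrow> Ck k f \<Longrightarrow> Ck k (\<lambda>x. inverse (f x))"
proof (induction k arbitrary: f)
  case (Suc k)
  have "partial i (\<lambda>x. inverse (f x)) = (\<lambda>x. (-1) * (inverse (f x) * partial i f x * inverse (f x)))" if "i \<in> Basis" for i
    by (rule ext, subst partial_eqI[OF Deriv.has_derivative_inverse[OF Suc.prems(1) has_derivative_grad[OF Ck_Suc_differentiable[OF Suc.prems(2)]]]])
      (simp add: that)
  moreover have "Ck k (\<lambda>x. (-1) * (inverse (f x) * partial i f x * inverse (f x)))" if "i \<in> Basis" for i
    using Suc.prems that by (intro Ck_mult Ck_const Suc.IH[OF Suc.prems(1)] Ck_SucD[OF Suc.prems(2)]) auto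
  ultimately show ?case using Suc.prems by (auto intro!: differentiable_inverse)
qed (auto intro!: continuous_intros)

lemma Ck_prod: "finite I \<Longrightarrow> (\<And>i. i \<in> I \<Longrightarrow> Ck k (f i)) \<Longrightarrow> Ck k (\<lambda>x. \<Prod>i\<in>I. f i x)"
  by (induction I rule: finite_induct) (auto intro: Ck_mult)

text \<open>The powers of s in the denominator make the span of this family closed under
  differentiation, so smoothness of exp(-1/s) follows by induction on the order for all k at
  once.\<close>

definition bump_exp :: "nat \<Rightarrow> real \<Rightarrow> real" where
  "bump_exp k s = (if s \<le> 0 then 0 else exp (- 1 / s) / s ^ k)"

text \<open>From the right, r = 1 / h turns the quotient into r^(k+1) exp(-r). This is the
  derivative at the origin, the only delicate point.\<close>

lemma bump_exp_over_tendsto_0: "((\<lambda>h. bump_exp k h / h) \<longlongrightarrow> 0) (at 0)"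
proof (rule filterlim_split_at)
  show "((\<lambda>h. bump_exp k h / h) \<longlongrightarrow> 0) (at_left 0)"
    by (rule tendsto_eventually) (auto simp: bump_exp_def eventually_at_filter)
  have "((\<lambda>h::real. inverse h ^ Suc k / exp (inverse h)) \<longlongrightarrow> 0) (at_right 0)"
    by (rule filterlim_compose[OF tendsto_power_div_exp_0 filterlim_inverse_at_top_right])
  then show "((\<lambda>h. bump_exp k h / h) \<longlongrightarrow> 0) (at_right 0)"
    by (rule Lim_transform_eventually)
      (auto simp: bump_exp_def eventually_at_filter exp_minus field_simps)
qed

lemma DERIV_bump_exp:
  "(bump_exp k has_real_derivative bump_exp (k + 2) s - real k * bump_exp (k + 1) s) (at s)"
proof -
  consider "s > 0" | "s < 0" | "s = 0" by linarith
  then show ?thesis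
  proof cases
    case 1
    have "((\<lambda>s. exp (- 1 / s) / s ^ k) has_real_derivative
        (exp (- 1 / s) * (1 / s\<^sup>2) * s ^ k - exp (- 1 / s) * (real k * s ^ (k - 1))) / (s ^ k * s ^ k)) (at s)"
      using 1 by (auto intro!: derivative_eq_intros simp: power2_eq_square)
    moreover have "(exp (- 1 / s) * (1 / s\<^sup>2) * s ^ k - exp (- 1 / s) * (real k * s ^ (k - 1))) / (s ^ k * s ^ k)
        = bump_exp (k + 2) s - real k * bump_exp (k + 1) s"
      using 1 by (cases k) (auto simp: bump_exp_def field_simps power2_eq_square)
    moreover have "\<forall>\<^sub>F y in nhds s. y > 0" using 1 eventually_nhds_in_open[of "{0<..}" s] by auto
    ultimately show ?thesis using 1
      by (subst DERIV_cong_ev[OF refl _ refl, where g = "\<lambda>s. exp (- 1 / s) / s ^ k"])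
        (auto elim: eventually_mono simp: bump_exp_def)
  next
    case 2
    have "\<forall>\<^sub>F y in nhds s. y < 0" using 2 eventually_nhds_in_open[of "{..<0}" s] by auto
    then show ?thesis using 2
      by (subst DERIV_cong_ev[OF refl _ refl, where g = "\<lambda>s. 0"])
        (auto elim: eventually_mono simp: bump_exp_def)
  next
    case 3
    then show ?thesis using bump_exp_over_tendsto_0[of k]
      by (simp add: has_field_derivative_iff) (simp add: bump_exp_def)
  qed
qed

lemma Ck_bump_exp:
  fixes w :: "'a::euclidean_space"
  shows "Ck n (\<lambda>x. bump_exp k (x \<bullet> w + c))"
proof (induction n arbitrary: k)
  case 0
  have "continuous_on UNIV (bump_exp k)"
    by (rule DERIV_continuous_on) (rule DERIV_subset[OF DERIV_bump_exp], simp)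
  then have "continuous_on UNIV (\<lambda>x. bump_exp k (x \<bullet> w + c))"
    by (rule continuous_on_compose2) (auto intro!: continuous_intros)
  then show ?case by simp
next
  case (Suc n)
  let ?D = "\<lambda>s. bump_exp (k + 2) s - real k * bump_exp (k + 1) s"
  have d: "((\<lambda>x. bump_exp k (x \<bullet> w + c)) has_derivative (\<lambda>h. ?D (x \<bullet> w + c) * (h \<bullet> w))) (at x)" for x
  proof -
    have "((\<lambda>x. x \<bullet> w + c) has_derivative (\<lambda>h. h \<bullet> w)) (at x)"
      by (auto intro!: derivative_eq_intros)
    from has_derivative_compose[OF this DERIV_bump_exp[unfolded has_field_derivative_def]]
    show ?thesis .
  qed
  have "partial i (\<lambda>x. bump_exp k (x \<bullet> w + c))
      = (\<lambda>x. (bump_exp (k + 2) (x \<bullet> w + c) + (- real k) * bump_exp (k + 1) (x \<bullet> w + c)) * (i \<bullet> w))" for i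
    by (auto simp: partial_eqI[OF d])
  moreover have "Ck n (\<lambda>x. (bump_exp (k + 2) (x \<bullet> w + c) + (- real k) * bump_exp (k + 1) (x \<bullet> w + c)) * (i \<bullet> w))" for i
    by (intro Ck_mult Ck_add Ck_const Suc.IH)
  ultimately show ?case using d by (auto simp: differentiable_def)
qed

section \<open>Operations on test functions, and the vanishing integral of a derivative\<close>

lemma test_functionsD:
  assumes "\<phi> \<in> test_functions \<Omega>"
  shows "Ck k \<phi>" "\<phi> differentiable (at x)" "continuous_on UNIV \<phi>"
    "i \<in> Basis \<Longrightarrow> continuous_on UNIV (partial i \<phi>)"
proof -
  show c: "Ck k \<phi>" for k using assms by (simp add: test_functions_def)
  show "\<phi> differentiable (at x)" "continuous_on UNIV \<phi>"
    "i \<in> Basis \<Longrightarrow> continuous_on UNIV (partial i \<phi>)"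
    using c[of 1] c[of 0] by auto
qed

lemma has_derivative_test_function:
  "\<phi> \<in> test_functions \<Omega> \<Longrightarrow> (\<phi> has_derivative (\<lambda>h. grad \<phi> x \<bullet> h)) (at x)"
  by (rule has_derivative_grad) (rule test_functionsD(2))

lemma continuous_grad_test_function:
  "\<phi> \<in> test_functions \<Omega> \<Longrightarrow> continuous_on UNIV (grad \<phi>)"
  unfolding grad_def using test_functionsD(4)[of \<phi> \<Omega>] by (intro continuous_intros) auto

lemma test_functionI:
  assumes "\<And>k. Ck k \<phi>" "\<And>x. x \<notin> K \<Longrightarrow> \<phi> x = 0" "compact K" "K \<subseteq> \<Omega>"
  shows "\<phi> \<in> test_functions \<Omega>"
proof -
  have "closure {x. \<phi> x \<noteq> 0} \<subseteq> K"
    using assms by (intro closure_minimal) (auto intro: compact_imp_closed)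
  moreover have "compact (closure {x. \<phi> x \<noteq> 0})"
    using assms(3) calculation by (metis bounded_subset closed_closure compact_eq_bounded_closed)
  ultimately show ?thesis using assms by (auto simp: test_functions_def)
qed

lemma test_function_support:
  assumes "\<phi> \<in> test_functions \<Omega>"
  obtains K R where "compact K" "K \<subseteq> \<Omega>" "\<And>x. x \<notin> K \<Longrightarrow> \<phi> x = 0" "\<And>x. x \<notin> K \<Longrightarrow> grad \<phi> x = 0"
    "\<And>x. norm x \<ge> R \<Longrightarrow> x \<notin> K"
proof -
  let ?K = "closure {x. \<phi> x \<noteq> 0}"
  have K: "compact ?K" "?K \<subseteq> \<Omega>" using assms by (auto simp: test_functions_def)
  have 0: "\<phi> x = 0" if "x \<notin> ?K" for x
    using that closure_subset[of "{x. \<phi> x \<noteq> 0}"] by blast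
  have "grad \<phi> x = 0" if x: "x \<notin> ?K" for x
  proof -
    have "open (- ?K)" "x \<in> - ?K" using x by (simp_all add: open_Compl)
    moreover have "(0::real) = \<phi> y" if "y \<in> - ?K" for y
      using 0[of y] that by (metis ComplD)
    ultimately have "(\<phi> has_derivative (\<lambda>_. 0)) (at x)"
      by (rule has_derivative_transform_within_open[OF has_derivative_const])
    then show ?thesis by (simp add: grad_def partial_eqI)
  qed
  moreover obtain R where R: "\<forall>x\<in>?K. norm x \<le> R"
    using compact_imp_bounded[OF K(1)] unfolding bounded_iff by blast
  moreover have "x \<notin> ?K" if "norm x \<ge> R + 1" for x
    using R that by (metis add_le_same_cancel1 dual_order.trans not_one_le_zero)
  ultimately show ?thesis using K 0 that[of ?K "R + 1"] by blast
qed

lemma partial_test_function: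
  assumes "\<phi> \<in> test_functions \<Omega>" "i \<in> Basis"
  shows "partial i \<phi> \<in> test_functions \<Omega>"
proof -
  obtain K where K: "compact K" "K \<subseteq> \<Omega>" "\<And>x. x \<notin> K \<Longrightarrow> grad \<phi> x = 0"
    using test_function_support[OF assms(1)] by metis
  show ?thesis
  proof (rule test_functionI[OF _ _ K(1,2)])
    show "Ck k (partial i \<phi>)" for k using test_functionsD(1)[OF assms(1), of "Suc k"] assms(2) by simp
    show "partial i \<phi> x = 0" if "x \<notin> K" for x using K(3)[OF that] grad_inner[OF assms(2), of \<phi> x] by simp
  qed
qed

lemma test_function_zero: "(\<lambda>_. 0) \<in> test_functions \<Omega>"
  by (simp add: test_functions_def)

lemma test_function_mult_smooth:
  assumes "\<phi> \<in> test_functions \<Omega>" "\<And>k. Ck k \<psi>"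
  shows "(\<lambda>x. \<phi> x * \<psi> x) \<in> test_functions \<Omega>"
proof -
  obtain K where K: "compact K" "K \<subseteq> \<Omega>" "\<And>x. x \<notin> K \<Longrightarrow> \<phi> x = 0"
    using test_function_support[OF assms(1)] by metis
  then show ?thesis
    using assms by (intro test_functionI[of _ K]) (auto intro: Ck_mult test_functionsD(1))
qed

lemma test_function_scale: "\<phi> \<in> test_functions \<Omega> \<Longrightarrow> (\<lambda>x. c * \<phi> x) \<in> test_functions \<Omega>"
  using test_function_mult_smooth[of \<phi> \<Omega> "\<lambda>_. c"] by (simp add: mult.commute)

lemma test_function_add:
  assumes "\<phi> \<in> test_functions \<Omega>" "\<psi> \<in> test_functions \<Omega>"
  shows "(\<lambda>x. \<phi> x + \<psi> x) \<in> test_functions \<Omega>"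
proof -
  obtain K L where "compact K" "K \<subseteq> \<Omega>" "\<And>x. x \<notin> K \<Longrightarrow> \<phi> x = 0"
      "compact L" "L \<subseteq> \<Omega>" "\<And>x. x \<notin> L \<Longrightarrow> \<psi> x = 0"
    using test_function_support[OF assms(1)] test_function_support[OF assms(2)] by metis
  then show ?thesis
    using assms by (intro test_functionI[of _ "K \<union> L"]) (auto intro: Ck_add test_functionsD(1))
qed

lemma test_function_mult:
  "\<phi> \<in> test_functions \<Omega> \<Longrightarrow> \<psi> \<in> test_functions \<Omega> \<Longrightarrow> (\<lambda>x. \<phi> x * \<psi> x) \<in> test_functions \<Omega>"
  by (intro test_function_mult_smooth test_functionsD(1))

lemma grad_eqI: "(f has_derivative (\<lambda>h. w \<bullet> h)) (at x) \<Longrightarrow> grad f x = w"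
  by (rule euclidean_eqI) (simp add: partial_eqI)

lemma grad_compose:
  assumes "\<phi> \<in> test_functions \<Omega>" "(f has_real_derivative d) (at (\<phi> x))"
  shows "grad (\<lambda>x. f (\<phi> x)) x = d *\<^sub>R grad \<phi> x"
  using has_derivative_compose[OF has_derivative_test_function[OF assms(1)] assms(2)[unfolded has_field_derivative_def]]
  by (intro grad_eqI) simp

text \<open>By translation invariance every difference quotient has integral zero, and the
  difference quotients converge dominatedly to the partial derivative.\<close>

lemma integral_partial_eq_0:
  fixes \<phi> :: "'a::euclidean_space \<Rightarrow> real"
  assumes \<phi>: "\<phi> \<in> test_functions \<Omega>" and i: "i \<in> Basis"
  shows "(\<integral>x. partial i \<phi> x \<partial>lborel) = 0"
proof -
  obtain K R where K: "compact K" "\<And>x. x \<notin> K \<Longrightarrow> \<phi> x = 0" "\<And>x. x \<notin> K \<Longrightarrow> grad \<phi> x = 0"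
    "\<And>x. norm x \<ge> R \<Longrightarrow> x \<notin> K" using test_function_support[OF \<phi>] by metis
  have gc: "continuous_on UNIV (grad \<phi>)" by (rule continuous_grad_test_function[OF \<phi>])
  have "bounded (grad \<phi> ` K)"
    by (intro compact_imp_bounded compact_continuous_image K continuous_on_subset[OF gc]) auto
  then obtain B where "\<And>x. x \<in> K \<Longrightarrow> norm (grad \<phi> x) \<le> B" by (auto simp: bounded_iff)
  then have B: "norm (grad \<phi> x) \<le> max B 0" for x
    by (cases "x \<in> K") (auto simp: K(3) max.coboundedI1)
  define t where "t n = 1 / real (Suc n)" for n
  have t: "t n > 0" "t n \<le> 1" for n by (auto simp: t_def)
  define s where "s n x = (\<phi> (t n *\<^sub>R i + x) - \<phi> x) / t n" for n x
  have [measurable]: "\<phi> \<in> borel_measurable borel"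
    using test_functionsD(3)[OF \<phi>] by (rule borel_measurable_continuous_onI)
  have [measurable]: "partial i \<phi> \<in> borel_measurable borel"
    using test_functionsD(4)[OF \<phi> i] by (rule borel_measurable_continuous_onI)
  have "(\<lambda>n. \<integral>x. s n x \<partial>lborel) \<longlonglongrightarrow> (\<integral>x. partial i \<phi> x \<partial>lborel)"
  \<comment> \<open>The steps \<open>t n\<close> are at most 1, so all quotients vanish outside the
    ball of radius R + 1; the mean value inequality bounds them by a bound of the gradient.\<close>
  proof (rule integral_dominated_convergence[where w = "\<lambda>x. indicator (cball 0 (R + 1)) x *\<^sub>R max B 0"])
    show "integrable lborel (\<lambda>x::'a. indicator (cball 0 (R + 1)) x *\<^sub>R max B 0)"
      by (intro borel_integrable_compact) auto
    show "AE x in lborel. (\<lambda>n. s n x) \<longlonglongrightarrow> partial i \<phi> x"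
    proof (intro AE_I2)
      fix x
      have "((\<lambda>r. r *\<^sub>R i + x) has_derivative (\<lambda>h. h *\<^sub>R i)) (at 0)"
        by (auto intro!: derivative_eq_intros)
      from has_derivative_compose[OF this has_derivative_test_function[OF \<phi>]]
      have "((\<lambda>r. \<phi> (r *\<^sub>R i + x)) has_real_derivative partial i \<phi> x) (at 0)"
        using i by (simp add: has_field_derivative_def mult_commute_abs)
      then have "((\<lambda>h. (\<phi> (h *\<^sub>R i + x) - \<phi> x) / h) \<longlongrightarrow> partial i \<phi> x) (at 0)"
        by (simp add: has_field_derivative_iff)
      moreover have "filterlim t (at 0) sequentially"
        unfolding filterlim_at using t(1) LIMSEQ_inverse_real_of_nat
        by (auto simp: t_def[abs_def] inverse_eq_divide less_imp_neq)
      ultimately show "(\<lambda>n. s n x) \<longlonglongrightarrow> partial i \<phi> x"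
        unfolding s_def by (rule filterlim_compose)
    qed
    show "AE x in lborel. norm (s n x) \<le> indicator (cball 0 (R + 1)) x *\<^sub>R max B 0" for n
    proof (intro AE_I2)
      fix x
      have "norm (\<phi> (t n *\<^sub>R i + x) - \<phi> x) \<le> max B 0 * norm ((t n *\<^sub>R i + x) - x)"
      proof (rule differentiable_bound[of UNIV \<phi> "\<lambda>x h. grad \<phi> x \<bullet> h"])
        fix y
        have "norm (grad \<phi> y \<bullet> h) \<le> max B 0 * norm h" for h
          using Cauchy_Schwarz_ineq2[of "grad \<phi> y" h] mult_right_mono[OF B[of y] norm_ge_zero[of h]] by simp
        then show "onorm (\<lambda>h. grad \<phi> y \<bullet> h) \<le> max B 0" by (rule onorm_le)
      qed (auto intro: has_derivative_at_withinI has_derivative_test_function[OF \<phi>])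
      then have 1: "norm (s n x) \<le> max B 0" using t[of n] i by (simp add: s_def field_simps)
      have "s n x = 0" if "norm x > R + 1"
      proof -
        have "norm x \<le> norm (t n *\<^sub>R i + x) + norm (t n *\<^sub>R i)"
          by (metis add_diff_cancel_left' norm_triangle_ineq4 add.commute)
        also have "norm (t n *\<^sub>R i) \<le> 1" using t[of n] i by simp
        finally show ?thesis using that K(2)[OF K(4)] by (simp add: s_def)
      qed
      then show "norm (s n x) \<le> indicator (cball 0 (R + 1)) x *\<^sub>R max B 0"
        using 1 by (cases "norm x \<le> R + 1") auto
    qed
  qed (auto simp: s_def)
  moreover have "(\<integral>x. s n x \<partial>lborel) = 0" for n
  proof -
    have int: "integrable lborel \<phi>"
      using test_functionsD(3)[OF \<phi>] K by (intro integrable_continuous_compact_support[where R = R]) auto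
    have d: "lborel = distr lborel borel ((+) (t n *\<^sub>R i))" by (rule lborel_distr_plus[symmetric])
    have "integrable lborel (\<lambda>x. \<phi> (t n *\<^sub>R i + x))"
      using int by (subst (asm) d) (simp add: integrable_distr_eq)
    moreover have "(\<integral>x. \<phi> (t n *\<^sub>R i + x) \<partial>lborel) = (\<integral>x. \<phi> x \<partial>lborel)"
      by (subst (2) d) (simp add: integral_distr)
    ultimately show ?thesis using int by (simp add: s_def)
  qed
  ultimately show ?thesis by (simp add: LIMSEQ_const_iff)
qed

section \<open>Weak gradients\<close>

text \<open>The positive and the negative part of f are densities of measures that agree on boxes,
  an intersection-stable generator, and are finite there. Hence both parts agree almost everywhere,
  and since one of them is always 0, both vanish.\<close>

lemma AE_zero_if_box_integrals_zero:
  fixes f :: "'a::euclidean_space \<Rightarrow> real"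
  assumes f: "integrable lborel f"
    and box: "\<And>a b. (\<integral>x. indicator (box a b) x * f x \<partial>lborel) = 0"
  shows "AE x in lborel. f x = 0"
proof -
  have [measurable]: "f \<in> borel_measurable borel" using f by (auto dest: borel_measurable_integrable)
  let ?P = "density lborel (\<lambda>x. ennreal (f x))" and ?N = "density lborel (\<lambda>x. ennreal (- f x))"
  have fin: "(\<integral>\<^sup>+x. ennreal (indicator A x * (s * f x)) \<partial>lborel) \<noteq> \<infinity>"
    if "A \<in> sets borel" "\<bar>s\<bar> = 1" for A and s :: real
  proof -
    have "(\<integral>\<^sup>+x. ennreal (indicator A x * (s * f x)) \<partial>lborel) \<le> (\<integral>\<^sup>+x. norm (f x) \<partial>lborel)"
      using that by (intro nn_integral_mono ennreal_leI) (auto simp: indicator_def abs_if split: if_splits)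
    also have "\<dots> < \<infinity>" using f by (simp add: integrable_iff_bounded)
    finally show ?thesis by simp
  qed
  have P: "emeasure ?P A = (\<integral>\<^sup>+x. ennreal (indicator A x * (1 * f x)) \<partial>lborel)"
    and N: "emeasure ?N A = (\<integral>\<^sup>+x. ennreal (indicator A x * (-1 * f x)) \<partial>lborel)" if "A \<in> sets borel" for A
    using that by (auto simp: emeasure_density intro!: nn_integral_cong split: split_indicator)
  have "?P = ?N"
  proof (rule measure_eqI_generator_eq)
    let ?E = "range (\<lambda>(a, b). box a b::'a set)"
    let ?A = "\<lambda>n::nat. box (- (real n *\<^sub>R One)) (real n *\<^sub>R One) :: 'a set"
    show "Int_stable ?E" by (auto simp: Int_stable_def box_Int_box)
    show "?E \<subseteq> Pow UNIV" "sets ?P = sigma_sets UNIV ?E" "sets ?N = sigma_sets UNIV ?E"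
      by (simp_all add: borel_eq_box)
    show "range ?A \<subseteq> ?E" "(\<Union>i. ?A i) = UNIV" unfolding UN_box_eq_UNIV by auto
    show "emeasure ?P (?A i) \<noteq> \<infinity>" for i using fin[of "?A i" 1] by (subst P) auto
    show "emeasure ?P X = emeasure ?N X" if XE: "X \<in> ?E" for X
    proof -
      obtain a b where X: "X = box a b" using XE by auto
      have int: "integrable lborel (\<lambda>x. indicator X x * f x)"
        using integrable_mult_indicator[OF _ f, of X] X by simp
      have "enn2real (emeasure ?P X) = enn2real (emeasure ?N X)"
        using real_lebesgue_integral_def[OF int] box[of a b] by (subst P, simp add: X, subst N) (simp_all add: X)
      moreover have "emeasure ?P X \<noteq> \<infinity>" using fin[of X 1] X by (subst P) auto
      moreover have "emeasure ?N X \<noteq> \<infinity>" using fin[of X "-1"] X by (subst N) auto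
      ultimately show ?thesis by (metis ennreal_enn2real infinity_ennreal_def less_top)
    qed
  qed
  moreover have "(\<lambda>x. ennreal (f x)) \<in> borel_measurable lborel" "(\<lambda>x. ennreal (- f x)) \<in> borel_measurable lborel"
    by simp_all
  ultimately have "AE x in lborel. ennreal (f x) = ennreal (- f x)"
    using sigma_finite_measure.density_unique_iff[OF sigma_finite_lborel] by blast
  then show ?thesis
  proof eventually_elim
    case (elim x)
    then show ?case by (cases "f x \<ge> 0") (auto simp: ennreal_neg ennreal_eq_0_iff dest: sym)
  qed
qed

section \<open>Integrals over the domain and the fundamental lemma of the calculus of
  variations\<close>

lemma lebesgue_on_zero_outside:
  fixes f :: "'a::euclidean_space \<Rightarrow> 'b::euclidean_space"
  assumes "S \<in> sets lebesgue" "\<And>x. x \<notin> S \<Longrightarrow> f x = 0"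
  shows "integrable (lebesgue_on S) f \<longleftrightarrow> integrable lebesgue f"
    and "integral\<^sup>L (lebesgue_on S) f = integral\<^sup>L lebesgue f"
proof -
  have "(\<lambda>x. indicator S x *\<^sub>R f x) = f" using assms(2) by (auto simp: fun_eq_iff indicator_def)
  then show "integrable (lebesgue_on S) f \<longleftrightarrow> integrable lebesgue f"
    "integral\<^sup>L (lebesgue_on S) f = integral\<^sup>L lebesgue f"
    using assms(1) by (simp_all add: integrable_restrict_space integral_restrict_space)
qed

lemma lebesgue_on_continuous_compact_support:
  fixes f :: "'a::euclidean_space \<Rightarrow> 'b::euclidean_space"
  assumes "continuous_on UNIV f" "compact K" "K \<subseteq> S" "S \<in> sets lebesgue" "\<And>x. x \<notin> K \<Longrightarrow> f x = 0"
  shows "integrable (lebesgue_on S) f" "integrable lborel f" "integral\<^sup>L (lebesgue_on S) f = integral\<^sup>L lborel f"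
proof -
  have [measurable]: "f \<in> borel_measurable borel"
    using assms(1) by (rule borel_measurable_continuous_onI)
  obtain R where R: "\<forall>x\<in>K. norm x \<le> R" using compact_imp_bounded[OF assms(2)] unfolding bounded_iff by blast
  show i: "integrable lborel f"
  proof (rule integrable_continuous_compact_support[OF assms(1)])
    fix x :: 'a assume "norm x \<ge> R + 1"
    then have "x \<notin> K" using R by fastforce
    then show "f x = 0" by (rule assms(5))
  qed
  have z: "\<And>x. x \<notin> S \<Longrightarrow> f x = 0" using assms by blast
  show "integrable (lebesgue_on S) f" "integral\<^sup>L (lebesgue_on S) f = integral\<^sup>L lborel f"
    using i lebesgue_on_zero_outside[of S f, OF assms(4) z] by (simp_all add: integrable_completion integral_completion)
qed

lemma locally_integrable_mult:
  fixes f \<phi> :: "'a::euclidean_space \<Rightarrow> real"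
  assumes "locally_integrable \<Omega> f" "\<Omega> \<in> sets lebesgue"
    and \<phi>: "continuous_on UNIV \<phi>" "compact K" "K \<subseteq> \<Omega>" "\<And>x. x \<notin> K \<Longrightarrow> \<phi> x = 0"
  shows "integrable (lebesgue_on \<Omega>) (\<lambda>x. f x * \<phi> x)"
proof -
  have K: "K \<in> sets lebesgue" using \<phi> by (simp add: lmeasurable_compact fmeasurableD)
  have "integrable (lebesgue_on K) f" using assms by (auto simp: locally_integrable_def)
  then have fK: "integrable lebesgue (\<lambda>x. indicator K x *\<^sub>R f x)"
    using K by (simp add: integrable_restrict_space)
  have "bounded (\<phi> ` K)" by (intro compact_imp_bounded compact_continuous_image continuous_on_subset[OF \<phi>(1)] \<phi>) auto
  then obtain B where B: "\<forall>x\<in>K. norm (\<phi> x) \<le> B" unfolding bounded_iff by blast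
  have [measurable]: "\<phi> \<in> borel_measurable lebesgue"
    using borel_measurable_continuous_onI[OF \<phi>(1)] by (intro measurable_completion) simp
  have "integrable lebesgue (\<lambda>x. (indicator K x *\<^sub>R f x) * \<phi> x)"
  proof (rule Bochner_Integration.integrable_bound[of _ "\<lambda>x. B * (indicator K x *\<^sub>R f x)"])
    show "integrable lebesgue (\<lambda>x. B * (indicator K x *\<^sub>R f x))" using fK by simp
    show "(\<lambda>x. (indicator K x *\<^sub>R f x) * \<phi> x) \<in> borel_measurable lebesgue"
      using borel_measurable_integrable[OF fK] by measurable
    show "AE x in lebesgue. norm ((indicator K x *\<^sub>R f x) * \<phi> x) \<le> norm (B * (indicator K x *\<^sub>R f x))"
    proof (intro AE_I2)
      fix x
      show "norm ((indicator K x *\<^sub>R f x) * \<phi> x) \<le> norm (B * (indicator K x *\<^sub>R f x))"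
      proof (cases "x \<in> K")
        case True
        then have "\<bar>\<phi> x\<bar> \<le> \<bar>B\<bar>" using B by force
        then show ?thesis using True by (simp add: abs_mult mult.commute[of "f x"] mult_right_mono)
      qed simp
    qed
  qed
  moreover have "(\<lambda>x. (indicator K x *\<^sub>R f x) * \<phi> x) = (\<lambda>x. f x * \<phi> x)"
    using \<phi>(4) by (auto simp: fun_eq_iff indicator_def)
  ultimately show ?thesis
    using lebesgue_on_zero_outside(1)[of \<Omega> "\<lambda>x. f x * \<phi> x"] assms by auto
qed

lemma locally_integrable_mult_test:
  fixes f \<phi> :: "'a::euclidean_space \<Rightarrow> real"
  assumes "locally_integrable \<Omega> f" "open \<Omega>" "\<phi> \<in> test_functions \<Omega>"
  shows "integrable (lebesgue_on \<Omega>) (\<lambda>x. f x * \<phi> x)"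
proof -
  obtain K where "compact K" "K \<subseteq> \<Omega>" "\<And>x. x \<notin> K \<Longrightarrow> \<phi> x = 0"
    using test_function_support[OF assms(3)] by metis
  then show ?thesis using assms test_functionsD(3)[OF assms(3)]
    by (intro locally_integrable_mult) auto
qed

text \<open>Each factor is exp(-1 / (n s)) for s > 0 and tends to 1 there, so these functions
  converge to the indicator of the open box while staying between 0 and 1.\<close>

definition box_bump :: "'a::euclidean_space \<Rightarrow> 'a \<Rightarrow> nat \<Rightarrow> 'a \<Rightarrow> real" where
  "box_bump a b n x = (\<Prod>i\<in>Basis. bump_exp 0 (real n * (x \<bullet> i - a \<bullet> i)) * bump_exp 0 (real n * (b \<bullet> i - x \<bullet> i)))"

lemma box_bump_zero:
  assumes "x \<notin> cbox a b"
  shows "box_bump a b n x = 0"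
proof -
  obtain i where i: "i \<in> Basis" "x \<bullet> i < a \<bullet> i \<or> b \<bullet> i < x \<bullet> i"
    using assms by (auto simp: mem_box not_le)
  have "bump_exp 0 (real n * (x \<bullet> i - a \<bullet> i)) * bump_exp 0 (real n * (b \<bullet> i - x \<bullet> i)) = 0"
    using i(2) by (auto simp: bump_exp_def mult_le_0_iff)
  then show ?thesis unfolding box_bump_def using i(1) by (intro prod_zero) auto
qed

lemma box_bump_test_function:
  assumes "cbox a b \<subseteq> \<Omega>"
  shows "box_bump a b n \<in> test_functions \<Omega>"
proof (rule test_functionI[OF _ _ compact_cbox assms])
  show "Ck k (box_bump a b n)" for k
  proof -
    have "Ck k (\<lambda>x. \<Prod>i\<in>Basis. bump_exp 0 (x \<bullet> (real n *\<^sub>R i) + - (real n * (a \<bullet> i)))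
        * bump_exp 0 (x \<bullet> (- real n *\<^sub>R i) + real n * (b \<bullet> i)))"
      by (intro Ck_prod Ck_mult Ck_bump_exp) auto
    then show ?thesis by (simp add: box_bump_def[abs_def] algebra_simps)
  qed
qed (rule box_bump_zero)

lemma bump_exp_bounds: "0 \<le> bump_exp 0 s" "bump_exp 0 s \<le> 1"
  by (auto simp: bump_exp_def)

lemma box_bump_bounds: "0 \<le> box_bump a b n x" "box_bump a b n x \<le> 1"
  unfolding box_bump_def by (auto intro!: prod_nonneg prod_le_1 mult_le_one bump_exp_bounds mult_nonneg_nonneg)

lemma box_bump_tendsto: "(\<lambda>n. box_bump a b n x) \<longlonglongrightarrow> indicator (box a b) x"
proof -
  have lim: "(\<lambda>n. bump_exp 0 (real n * s)) \<longlonglongrightarrow> (if s > 0 then 1 else 0)" for s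
  proof (cases "s > 0")
    case True
    have "(\<lambda>n. exp (- (1 / s) * (1 / real n))) \<longlonglongrightarrow> exp (- (1 / s) * 0)"
      by (intro tendsto_intros lim_1_over_n)
    moreover have "\<forall>\<^sub>F n in sequentially. exp (- (1 / s) * (1 / real n)) = bump_exp 0 (real n * s)"
      using eventually_gt_at_top[of 0]
      by eventually_elim (use True in \<open>auto simp: bump_exp_def mult_le_0_iff mult.commute\<close>)
    ultimately show ?thesis using True Lim_transform_eventually by fastforce
  next
    case False
    then have "bump_exp 0 (real n * s) = 0" for n by (auto simp: bump_exp_def mult_le_0_iff not_less)
    then show ?thesis using False by simp
  qed
  have "(\<lambda>n. box_bump a b n x) \<longlonglongrightarrow> (\<Prod>i\<in>Basis. (if x \<bullet> i - a \<bullet> i > 0 then 1 else 0) * (if b \<bullet> i - x \<bullet> i > 0 then 1 else 0))"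
    unfolding box_bump_def by (intro tendsto_prod tendsto_mult lim)
  also have "(\<Prod>i\<in>Basis. (if x \<bullet> i - a \<bullet> i > 0 then 1 else 0) * (if b \<bullet> i - x \<bullet> i > 0 then 1 else 0)) = (indicator (box a b) x :: real)"
  proof (cases "x \<in> box a b")
    case True
    then show ?thesis by (auto simp: mem_box)
  next
    case False
    then obtain i where "i \<in> Basis" "\<not> (a \<bullet> i < x \<bullet> i \<and> x \<bullet> i < b \<bullet> i)" by (auto simp: mem_box)
    then show ?thesis using False by (auto intro!: prod_zero bexI[of _ i])
  qed
  finally show ?thesis .
qed

text \<open>Dominated convergence along \<open>box_bump\<close> shows that f has integral zero over
  each box whose closure lies in the domain. This settles f on one closed box at a time, and
  countably many of them cover the open set.\<close>

lemma AE_zero_if_orthogonal_test_functions: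
  fixes f :: "'a::euclidean_space \<Rightarrow> real"
  assumes \<Omega>: "open \<Omega>" and f: "locally_integrable \<Omega> f"
    and orth: "\<And>\<phi>. \<phi> \<in> test_functions \<Omega> \<Longrightarrow> (LINT x|lebesgue_on \<Omega>. f x * \<phi> x) = 0"
  shows "AE x in lebesgue_on \<Omega>. f x = 0"
proof -
  have \<Omega>m [simp]: "\<Omega> \<in> sets lebesgue" using \<Omega> by auto
  have box: "integrable lebesgue (\<lambda>x. indicator (box a b) x * f x)"
      "(\<integral>x. indicator (box a b) x * f x \<partial>lebesgue) = 0" if ab: "cbox a b \<subseteq> \<Omega>" for a b
  proof -
    have "integrable (lebesgue_on (cbox a b)) f" using f ab by (auto simp: locally_integrable_def)
    then have fc: "integrable lebesgue (\<lambda>x. indicator (cbox a b) x * f x)"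
      by (simp add: integrable_restrict_space)
    note [measurable] = borel_measurable_integrable[OF fc]
    have bm [measurable]: "box_bump a b n \<in> borel_measurable lebesgue" for n
      using borel_measurable_continuous_onI[OF test_functionsD(3)[OF box_bump_test_function[OF ab, of n]]]
      by (intro measurable_completion) simp
    note z = box_bump_zero[of _ a b]
    have i0: "(\<integral>x. indicator (cbox a b) x * f x * box_bump a b n x \<partial>lebesgue) = 0" for n
    proof -
      have "(\<lambda>x. indicator (cbox a b) x * f x * box_bump a b n x) = (\<lambda>x. f x * box_bump a b n x)"
        using z by (auto simp: fun_eq_iff indicator_def)
      then show ?thesis
        using orth[OF box_bump_test_function[OF ab, of n]] z ab
          lebesgue_on_zero_outside(2)[of \<Omega> "\<lambda>x. f x * box_bump a b n x"] by (metis \<Omega>m mult_zero_right subsetD)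
    qed
    have e: "(\<lambda>x. indicator (cbox a b) x * f x * indicator (box a b) x) = (\<lambda>x. indicator (box a b) x * f x)"
      using box_subset_cbox[of a b] by (auto simp: fun_eq_iff indicator_def)
    have "(\<lambda>n. \<integral>x. indicator (cbox a b) x * f x * box_bump a b n x \<partial>lebesgue)
        \<longlonglongrightarrow> (\<integral>x. indicator (cbox a b) x * f x * indicator (box a b) x \<partial>lebesgue)"
    proof (rule integral_dominated_convergence[where w = "\<lambda>x. norm (indicator (cbox a b) x * f x)"])
      show "AE x in lebesgue. (\<lambda>n. indicator (cbox a b) x * f x * box_bump a b n x)
          \<longlonglongrightarrow> indicator (cbox a b) x * f x * indicator (box a b) x"
        by (intro AE_I2 tendsto_mult tendsto_const box_bump_tendsto)
      show "AE x in lebesgue. norm (indicator (cbox a b) x * f x * box_bump a b n x) \<le> norm (indicator (cbox a b) x * f x)" for n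
        using box_bump_bounds[of a b n] by (intro AE_I2) (auto simp: abs_mult mult_le_cancel_left1 intro: mult_left_le)
      show "(\<lambda>x. indicator (cbox a b) x * f x * indicator (box a b) x) \<in> borel_measurable lebesgue"
        by (intro borel_measurable_times borel_measurable_integrable[OF fc] borel_measurable_indicator) auto
      show "(\<lambda>x. indicator (cbox a b) x * f x * box_bump a b n x) \<in> borel_measurable lebesgue" for n
        by (intro borel_measurable_times borel_measurable_integrable[OF fc] bm)
    qed (rule integrable_norm[OF fc])
    then show "(\<integral>x. indicator (box a b) x * f x \<partial>lebesgue) = 0"
      unfolding i0 e by (simp add: LIMSEQ_const_iff)
    have "integrable lebesgue (\<lambda>x. indicator (box a b) x *\<^sub>R (indicator (cbox a b) x * f x))"
      by (rule integrable_mult_indicator[OF _ fc]) simp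
    then show "integrable lebesgue (\<lambda>x. indicator (box a b) x * f x)"
      unfolding e[symmetric] by (simp add: mult_ac)
  qed
  have AEbox: "AE x in lborel. x \<in> cbox c d \<longrightarrow> f x = 0" if cd: "cbox c d \<subseteq> \<Omega>" for c d
  proof -
    define F where "F x = indicator (box c d) x * f x" for x
    have F: "integrable lebesgue F" unfolding F_def by (rule box(1)[OF cd])
    \<comment> \<open>The box criterion is about integrands measurable for \<open>lborel\<close>, so
      the Lebesgue measurable F is replaced by a Borel version.\<close>
    obtain F' where F' [measurable]: "F' \<in> borel_measurable lborel" and FF: "AE x in lborel. F x = F' x"
      using completion_ex_borel_measurable_real[OF borel_measurable_integrable[OF F]] by auto
    have FF': "AE x in lebesgue. F x = F' x" using FF by (rule AE_completion)
    have F'm: "F' \<in> borel_measurable lebesgue" by (rule measurable_completion) simp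
    have F'i: "integrable lborel F'"
      using integrable_cong_AE[of F lebesgue F'] F F' FF' F'm by (auto simp: integrable_completion)
    have "AE x in lborel. F' x = 0"
    proof (rule AE_zero_if_box_integrals_zero[OF F'i])
      fix a b :: 'a
      obtain p r where pr: "box a b \<inter> box c d = box p r" by (simp add: box_Int_box)
      have "(\<integral>x. indicator (box a b) x * F' x \<partial>lborel) = (\<integral>x. indicator (box a b) x * F' x \<partial>lebesgue)"
        by (rule integral_completion[symmetric]) simp
      also have "\<dots> = (\<integral>x. indicator (box p r) x * f x \<partial>lebesgue)"
      proof (rule integral_cong_AE)
        have e: "(\<lambda>x. indicator (box p r) x * f x) = (\<lambda>x. indicator (box a b) x * F x)"
          using pr by (auto simp: fun_eq_iff F_def indicator_def)
        show "AE x in lebesgue. indicator (box a b) x * F' x = indicator (box p r) x * f x"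
          unfolding fun_cong[OF e] using FF' by eventually_elim simp
        show "(\<lambda>x. indicator (box p r) x * f x) \<in> borel_measurable lebesgue"
          unfolding e
          by (intro borel_measurable_times borel_measurable_integrable[OF F] borel_measurable_indicator) auto
        show "(\<lambda>x. indicator (box a b) x * F' x) \<in> borel_measurable lebesgue"
          by (intro borel_measurable_times F'm borel_measurable_indicator) auto
      qed
      also have "\<dots> = 0"
      proof (cases "box p r = {}")
        case False
        have "box p r \<subseteq> cbox c d" using pr box_subset_cbox by blast
        then have "cbox p r \<subseteq> cbox c d"
          using False by (metis closure_box closure_minimal closed_cbox)
        then show ?thesis using cd by (intro box(2)) auto
      qed simp
      finally show "(\<integral>x. indicator (box a b) x * F' x \<partial>lborel) = 0" .
    qed
    \<comment> \<open>F only controls f on the open box; the boundary has measure zero.\<close>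
    moreover have "AE x in lborel. x \<notin> cbox c d - box c d"
    proof (rule AE_not_in)
      have "cbox c d - box c d \<in> null_sets lebesgue"
        using negligible_frontier_interval negligible_iff_null_sets by blast
      then show "cbox c d - box c d \<in> null_sets lborel"
        by (simp add: null_sets_completion_iff)
    qed
    ultimately show ?thesis using FF
      by eventually_elim (auto simp: F_def split: split_indicator_asm)
  qed
  obtain D where D: "countable D" "D \<subseteq> Pow \<Omega>" "\<And>X. X \<in> D \<Longrightarrow> \<exists>a b. X = cbox a b" "\<Union>D = \<Omega>"
    using open_countable_Union_open_cbox[OF \<Omega>] by metis
  have "AE x in lborel. \<forall>X\<in>D. x \<in> X \<longrightarrow> f x = 0"
  proof (subst AE_ball_countable[OF D(1)], intro ballI)
    fix X assume X: "X \<in> D"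
    obtain a b where "X = cbox a b" using D(3)[OF X] by auto
    then show "AE x in lborel. x \<in> X \<longrightarrow> f x = 0" using AEbox[of a b] D(2) X by auto
  qed
  then have "AE x in lebesgue. \<forall>X\<in>D. x \<in> X \<longrightarrow> f x = 0" by (rule AE_completion)
  then have "AE x in lebesgue. x \<in> \<Omega> \<longrightarrow> f x = 0"
    by eventually_elim (use D(4) in auto)
  then show ?thesis by (simp add: AE_restrict_space_iff)
qed

section \<open>Uniqueness and linearity of weak gradients\<close>

lemma borel_measurable_lebesgue_on_AE:
  fixes f :: "'a::euclidean_space \<Rightarrow> 'b::euclidean_space"
  assumes f: "f \<in> borel_measurable (lebesgue_on S)" and S: "S \<in> sets lebesgue"
    and eq: "AE x in lebesgue_on S. f x = g x"
  shows "g \<in> borel_measurable (lebesgue_on S)"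
proof -
  have "(\<lambda>x. indicator S x *\<^sub>R f x) \<in> borel_measurable lebesgue"
    using f S by (simp add: borel_measurable_restrict_space_iff)
  moreover have "AE x in lebesgue. indicator S x *\<^sub>R f x = indicator S x *\<^sub>R g x"
    using eq S by (auto simp: AE_restrict_space_iff elim!: eventually_mono split: split_indicator)
  ultimately have "(\<lambda>x. indicator S x *\<^sub>R g x) \<in> borel_measurable lebesgue"
    by (rule borel_measurable_AE)
  then show ?thesis using S by (simp add: borel_measurable_restrict_space_iff)
qed

lemma locally_integrable_lincomb:
  assumes "locally_integrable \<Omega> f" "locally_integrable \<Omega> g"
  shows "locally_integrable \<Omega> (\<lambda>x. f x + c *\<^sub>R g x)"
  using assms by (auto simp: locally_integrable_def intro!: Bochner_Integration.integrable_add integrable_scaleR_right)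

lemma locally_integrable_inner:
  "locally_integrable \<Omega> f \<Longrightarrow> locally_integrable \<Omega> (\<lambda>x. f x \<bullet> i)"
  by (auto simp: locally_integrable_def)

text \<open>Each component of the difference of the two gradients is orthogonal to all test
  functions.\<close>

lemma has_weak_gradient_unique:
  assumes \<Omega>: "open \<Omega>" and g: "has_weak_gradient \<Omega> u g" and h: "has_weak_gradient \<Omega> u h"
  shows "AE x in lebesgue_on \<Omega>. g x = h x"
proof -
  have li: "locally_integrable \<Omega> g" "locally_integrable \<Omega> h" using g h by (auto simp: has_weak_gradient_def)
  have "AE x in lebesgue_on \<Omega>. (g x + (-1) *\<^sub>R h x) \<bullet> i = 0" if i: "i \<in> Basis" for i
  proof (rule AE_zero_if_orthogonal_test_functions[OF \<Omega>])
    show "locally_integrable \<Omega> (\<lambda>x. (g x + (-1) *\<^sub>R h x) \<bullet> i)"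
      by (intro locally_integrable_inner locally_integrable_lincomb li)
    fix \<phi> assume \<phi>: "\<phi> \<in> test_functions \<Omega>"
    have "integrable (lebesgue_on \<Omega>) (\<lambda>x. (g x \<bullet> i) * \<phi> x)" "integrable (lebesgue_on \<Omega>) (\<lambda>x. (h x \<bullet> i) * \<phi> x)"
      by (intro locally_integrable_mult_test locally_integrable_inner li \<Omega> \<phi>)+
    moreover have "(LINT x|lebesgue_on \<Omega>. (g x \<bullet> i) * \<phi> x) = (LINT x|lebesgue_on \<Omega>. (h x \<bullet> i) * \<phi> x)"
      using g h \<phi> i by (simp add: has_weak_gradient_def)
    ultimately show "(LINT x|lebesgue_on \<Omega>. (g x + (-1) *\<^sub>R h x) \<bullet> i * \<phi> x) = 0"
      by (simp add: inner_diff_left left_diff_distrib)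
  qed
  then have "AE x in lebesgue_on \<Omega>. \<forall>i\<in>Basis. (g x + (-1) *\<^sub>R h x) \<bullet> i = 0"
    by (subst AE_ball_countable) (auto intro: countable_finite)
  then show ?thesis
  proof eventually_elim
    case (elim x)
    show ?case by (rule euclidean_eqI) (use elim in \<open>simp add: inner_diff_left\<close>)
  qed
qed

lemma has_weak_gradient_lincomb:
  assumes \<Omega>: "open \<Omega>" and g: "has_weak_gradient \<Omega> u g" and h: "has_weak_gradient \<Omega> v h"
  shows "has_weak_gradient \<Omega> (\<lambda>x. u x + c * v x) (\<lambda>x. g x + c *\<^sub>R h x)"
proof -
  have li: "locally_integrable \<Omega> u" "locally_integrable \<Omega> v" "locally_integrable \<Omega> g" "locally_integrable \<Omega> h"
    using g h by (auto simp: has_weak_gradient_def)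
  have "(LINT x|lebesgue_on \<Omega>. (u x + c * v x) * partial i \<phi> x)
      = - (LINT x|lebesgue_on \<Omega>. ((g x + c *\<^sub>R h x) \<bullet> i) * \<phi> x)"
    if \<phi>: "\<phi> \<in> test_functions \<Omega>" and i: "i \<in> Basis" for \<phi> i
  proof -
    note t = locally_integrable_mult_test[OF _ \<Omega> partial_test_function[OF \<phi> i]]
      locally_integrable_mult_test[OF _ \<Omega> \<phi>]
    have "(LINT x|lebesgue_on \<Omega>. (u x + c * v x) * partial i \<phi> x)
        = (LINT x|lebesgue_on \<Omega>. u x * partial i \<phi> x) + c * (LINT x|lebesgue_on \<Omega>. v x * partial i \<phi> x)"
      using t(1)[OF li(1)] t(1)[OF li(2)] by (simp add: distrib_right mult.assoc)
    also have "\<dots> = - ((LINT x|lebesgue_on \<Omega>. (g x \<bullet> i) * \<phi> x) + c * (LINT x|lebesgue_on \<Omega>. (h x \<bullet> i) * \<phi> x))"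
      using g h \<phi> i by (simp add: has_weak_gradient_def)
    also have "(LINT x|lebesgue_on \<Omega>. (g x \<bullet> i) * \<phi> x) + c * (LINT x|lebesgue_on \<Omega>. (h x \<bullet> i) * \<phi> x)
        = (LINT x|lebesgue_on \<Omega>. ((g x + c *\<^sub>R h x) \<bullet> i) * \<phi> x)"
      using t(2)[OF locally_integrable_inner[OF li(3)]] t(2)[OF locally_integrable_inner[OF li(4)]]
      by (simp add: inner_add_left distrib_right mult.assoc)
    finally show ?thesis .
  qed
  then show ?thesis
    using li locally_integrable_lincomb[OF li(1,2), of c] locally_integrable_lincomb[OF li(3,4), of c]
    by (simp add: has_weak_gradient_def)
qed

lemma locally_integrable_continuous:
  fixes f :: "'a::euclidean_space \<Rightarrow> 'b::euclidean_space"
  assumes "continuous_on UNIV f"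
  shows "locally_integrable \<Omega> f"
  unfolding locally_integrable_def
proof (intro allI impI)
  fix K assume K: "compact K \<and> K \<subseteq> \<Omega>"
  have "integrable lborel (\<lambda>x. indicator K x *\<^sub>R f x)"
    using K assms by (intro borel_integrable_compact) (auto intro: continuous_on_subset)
  then have "integrable lebesgue (\<lambda>x. indicator K x *\<^sub>R f x)"
    by (simp add: integrable_completion)
  then show "integrable (lebesgue_on K) f"
    using K by (simp add: integrable_restrict_space lmeasurable_compact fmeasurableD)
qed

text \<open>Integration by parts, obtained from \<open>integral_partial_eq_0\<close> for the product
  of two test functions.\<close>

lemma has_weak_gradient_test_function:
  assumes \<Omega>: "open \<Omega>" and \<phi>: "\<phi> \<in> test_functions \<Omega>"
  shows "has_weak_gradient \<Omega> \<phi> (grad \<phi>)"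
proof -
  have "(LINT x|lebesgue_on \<Omega>. \<phi> x * partial i \<psi> x) = - (LINT x|lebesgue_on \<Omega>. (grad \<phi> x \<bullet> i) * \<psi> x)"
    if \<psi>: "\<psi> \<in> test_functions \<Omega>" and i: "i \<in> Basis" for \<psi> i
  proof -
    have conv: "integrable lborel f" "integral\<^sup>L (lebesgue_on \<Omega>) f = integral\<^sup>L lborel f" if f: "f \<in> test_functions \<Omega>" for f
    proof -
      obtain K where "compact K" "K \<subseteq> \<Omega>" "\<And>x. x \<notin> K \<Longrightarrow> f x = 0"
        using test_function_support[OF f] by metis
      then show "integrable lborel f" "integral\<^sup>L (lebesgue_on \<Omega>) f = integral\<^sup>L lborel f"
        using lebesgue_on_continuous_compact_support[OF test_functionsD(3)[OF f], of K \<Omega>] \<Omega> by auto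
    qed
    have t1: "(\<lambda>x. \<phi> x * partial i \<psi> x) \<in> test_functions \<Omega>"
      by (intro test_function_mult partial_test_function \<phi> \<psi> i)
    have t2: "(\<lambda>x. partial i \<phi> x * \<psi> x) \<in> test_functions \<Omega>"
      by (intro test_function_mult partial_test_function \<phi> \<psi> i)
    have "partial i (\<lambda>x. \<phi> x * \<psi> x) = (\<lambda>x. \<phi> x * partial i \<psi> x + partial i \<phi> x * \<psi> x)"
      by (rule ext, subst partial_eqI[OF has_derivative_mult[OF has_derivative_test_function[OF \<phi>]
        has_derivative_test_function[OF \<psi>]]]) (simp add: i)
    then have "0 = (\<integral>x. \<phi> x * partial i \<psi> x + partial i \<phi> x * \<psi> x \<partial>lborel)"
      using integral_partial_eq_0[OF test_function_mult[OF \<phi> \<psi>] i] by simp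
    also have "\<dots> = (\<integral>x. \<phi> x * partial i \<psi> x \<partial>lborel) + (\<integral>x. partial i \<phi> x * \<psi> x \<partial>lborel)"
      using conv(1)[OF t1] conv(1)[OF t2] by simp
    finally show ?thesis using conv(2)[OF t1] conv(2)[OF t2] i by simp
  qed
  then show ?thesis
    using locally_integrable_continuous[OF test_functionsD(3)[OF \<phi>]]
      locally_integrable_continuous[OF continuous_grad_test_function[OF \<phi>]]
    by (simp add: has_weak_gradient_def)
qed

lemma has_weak_gradient_weak_gradient:
  "has_weak_gradient \<Omega> u g \<Longrightarrow> has_weak_gradient \<Omega> u (weak_gradient \<Omega> u)"
  unfolding weak_gradient_def by (rule someI[of "has_weak_gradient \<Omega> u"])

lemma AE_weak_gradient:
  "open \<Omega> \<Longrightarrow> has_weak_gradient \<Omega> u g \<Longrightarrow> AE x in lebesgue_on \<Omega>. weak_gradient \<Omega> u x = g x"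
  by (blast intro: has_weak_gradient_unique has_weak_gradient_weak_gradient)

section \<open>The Dirichlet form on \<open>H\<^sub>0\<^sup>1\<close>\<close>

definition dirichlet :: "'a::euclidean_space set \<Rightarrow> ('a \<Rightarrow> real) \<Rightarrow> ('a \<Rightarrow> real) \<Rightarrow> real" where
  "dirichlet \<Omega> u v = (LINT x|lebesgue_on \<Omega>. weak_gradient \<Omega> u x \<bullet> weak_gradient \<Omega> v x)"

definition Lq_int :: "real \<Rightarrow> 'a::euclidean_space set \<Rightarrow> ('a \<Rightarrow> real) \<Rightarrow> real" where
  "Lq_int q \<Omega> u = (LINT x|lebesgue_on \<Omega>. \<bar>u x\<bar> powr q)"

lemma Lq_int_nonneg [simp]: "Lq_int q \<Omega> u \<ge> 0"
  by (simp add: Lq_int_def)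

lemma dirichlet_nonneg [simp]: "dirichlet \<Omega> u u \<ge> 0"
  by (simp add: dirichlet_def)

lemma H01_norm_power2: "(H01_norm \<Omega> u)\<^sup>2 = dirichlet \<Omega> u u"
proof -
  have "(LINT x|lebesgue_on \<Omega>. norm (weak_gradient \<Omega> u x) powr 2) = dirichlet \<Omega> u u"
    by (simp add: dirichlet_def power2_norm_eq_inner)
  then show ?thesis
    by (simp add: H01_norm_def Lq_norm_def powr_half_sqrt)
qed

lemma H01_norm_eq: "H01_norm \<Omega> u = sqrt (dirichlet \<Omega> u u)"
  unfolding H01_norm_power2[symmetric] by (simp add: H01_norm_def Lq_norm_def)

lemma Lq_norm_powr: "q > 0 \<Longrightarrow> Lq_norm q \<Omega> u powr q = Lq_int q \<Omega> u" for u :: "'a::euclidean_space \<Rightarrow> real"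
  by (simp add: Lq_norm_def Lq_int_def powr_powr)

definition L2_space :: "'a measure \<Rightarrow> ('a \<Rightarrow> 'b::euclidean_space) set" where
  "L2_space M = {f. f \<in> borel_measurable M \<and> integrable M (\<lambda>x. (norm (f x))\<^sup>2)}"

lemma Lq_2_eq: "Lq 2 \<Omega> = L2_space (lebesgue_on \<Omega>)"
  by (simp add: Lq_def L2_space_def)

lemma L2_space_inner:
  assumes "f \<in> L2_space M" "g \<in> L2_space M"
  shows "integrable M (\<lambda>x. f x \<bullet> g x)"
    and "(\<integral>x. f x \<bullet> g x \<partial>M)\<^sup>2 \<le> (\<integral>x. (norm (f x))\<^sup>2 \<partial>M) * (\<integral>x. (norm (g x))\<^sup>2 \<partial>M)"
proof -
  have [measurable]: "f \<in> borel_measurable M" "g \<in> borel_measurable M"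
    using assms by (auto simp: L2_space_def)
  note cs = cauchy_schwarz_integral[of "\<lambda>x. norm (f x)" M "\<lambda>x. norm (g x)"]
  have i: "integrable M (\<lambda>x. norm (f x) * norm (g x))"
    using assms by (intro cs) (auto simp: L2_space_def)
  show fg: "integrable M (\<lambda>x. f x \<bullet> g x)"
    by (rule Bochner_Integration.integrable_bound[OF i]) (auto intro: Cauchy_Schwarz_ineq2)
  have "\<bar>\<integral>x. f x \<bullet> g x \<partial>M\<bar> \<le> (\<integral>x. norm (f x) * norm (g x) \<partial>M)"
    by (rule order_trans[OF integral_abs_bound integral_mono[OF integrable_abs[OF fg] i]]) (rule Cauchy_Schwarz_ineq2)
  then have "(\<integral>x. f x \<bullet> g x \<partial>M)\<^sup>2 \<le> (\<integral>x. norm (f x) * norm (g x) \<partial>M)\<^sup>2"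
    by (metis abs_ge_zero power2_abs power_mono)
  also have "\<dots> \<le> (\<integral>x. (norm (f x))\<^sup>2 \<partial>M) * (\<integral>x. (norm (g x))\<^sup>2 \<partial>M)"
    using assms by (intro cs) (auto simp: L2_space_def)
  finally show "(\<integral>x. f x \<bullet> g x \<partial>M)\<^sup>2 \<le> (\<integral>x. (norm (f x))\<^sup>2 \<partial>M) * (\<integral>x. (norm (g x))\<^sup>2 \<partial>M)" .
qed

lemma L2_space_lincomb:
  assumes "f \<in> L2_space M" "g \<in> L2_space M"
  shows "(\<lambda>x. f x + c *\<^sub>R g x) \<in> L2_space M"
    and "(\<integral>x. (norm (f x + c *\<^sub>R g x))\<^sup>2 \<partial>M)
      = (\<integral>x. (norm (f x))\<^sup>2 \<partial>M) + 2 * c * (\<integral>x. f x \<bullet> g x \<partial>M) + c\<^sup>2 * (\<integral>x. (norm (g x))\<^sup>2 \<partial>M)"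
proof -
  have [measurable]: "f \<in> borel_measurable M" "g \<in> borel_measurable M"
    and i: "integrable M (\<lambda>x. (norm (f x))\<^sup>2)" "integrable M (\<lambda>x. (norm (g x))\<^sup>2)"
    using assms by (auto simp: L2_space_def)
  have e: "(norm (f x + c *\<^sub>R g x))\<^sup>2 = (norm (f x))\<^sup>2 + 2 * c * (f x \<bullet> g x) + c\<^sup>2 * (norm (g x))\<^sup>2" for x
    by (simp add: power2_norm_eq_inner inner_add_left inner_add_right inner_commute algebra_simps power2_eq_square[of c])
  show "(\<lambda>x. f x + c *\<^sub>R g x) \<in> L2_space M"
    using i L2_space_inner(1)[OF assms] by (simp add: L2_space_def e)
  show "(\<integral>x. (norm (f x + c *\<^sub>R g x))\<^sup>2 \<partial>M)
      = (\<integral>x. (norm (f x))\<^sup>2 \<partial>M) + 2 * c * (\<integral>x. f x \<bullet> g x \<partial>M) + c\<^sup>2 * (\<integral>x. (norm (g x))\<^sup>2 \<partial>M)"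
    using i L2_space_inner(1)[OF assms] by (simp add: e)
qed

lemma test_function_L2:
  fixes f :: "'a::euclidean_space \<Rightarrow> 'b::euclidean_space"
  assumes "continuous_on UNIV f" "compact K" "K \<subseteq> \<Omega>" "open \<Omega>" "\<And>x. x \<notin> K \<Longrightarrow> f x = 0"
  shows "f \<in> L2_space (lebesgue_on \<Omega>)"
proof -
  have "f \<in> borel_measurable (lebesgue_on \<Omega>)"
    using lebesgue_on_continuous_compact_support(1)[OF assms(1-3)] assms by auto
  moreover have "integrable (lebesgue_on \<Omega>) (\<lambda>x. (norm (f x))\<^sup>2)"
    using assms by (intro lebesgue_on_continuous_compact_support(1)[of _ K] continuous_intros) auto
  ultimately show ?thesis by (simp add: L2_space_def)
qed

section \<open>The spaces H^1 and \<open>H\<^sub>0\<^sup>1\<close> over a bounded open set\<close>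

locale bounded_open =
  fixes \<Omega> :: "'a::euclidean_space set"
  assumes open_\<Omega>: "open \<Omega>" and bounded_\<Omega>: "bounded \<Omega>"
begin

abbreviation M :: "'a measure" where "M \<equiv> lebesgue_on \<Omega>"
abbreviation TF :: "('a \<Rightarrow> real) set" where "TF \<equiv> test_functions \<Omega>"
abbreviation "DF \<equiv> dirichlet \<Omega>"
abbreviation "DE u \<equiv> DF u u"
abbreviation "wg \<equiv> weak_gradient \<Omega>"

lemma sets_\<Omega> [simp]: "\<Omega> \<in> sets lebesgue"
  using open_\<Omega> by auto

sublocale finite_measure M
  using open_\<Omega> bounded_\<Omega> by (intro finite_measure_lebesgue_on) (auto intro: bounded_set_imp_lmeasurable)

text \<open>The gradient selected by \<open>weak_gradient\<close> need not be the square integrable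
  one provided by membership in \<open>H1\<close>. Almost everywhere uniqueness transfers
  integrability, and completeness of Lebesgue measure transfers measurability.\<close>

lemma H1D:
  assumes "u \<in> H1 \<Omega>"
  shows "u \<in> L2_space M" "has_weak_gradient \<Omega> u (wg u)" "wg u \<in> L2_space M"
proof -
  obtain g where g: "g \<in> L2_space M" "has_weak_gradient \<Omega> u g" and u: "u \<in> L2_space M"
    using assms by (auto simp: H1_def Lq_2_eq)
  show "u \<in> L2_space M" by fact
  show "has_weak_gradient \<Omega> u (wg u)" using g(2) by (rule has_weak_gradient_weak_gradient)
  have ae: "AE x in M. g x = wg u x" using AE_weak_gradient[OF open_\<Omega> g(2)] by eventually_elim simp
  have m: "wg u \<in> borel_measurable M"
    using g(1) by (intro borel_measurable_lebesgue_on_AE[OF _ sets_\<Omega> ae]) (simp add: L2_space_def)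
  have "integrable M (\<lambda>x. (norm (g x))\<^sup>2) \<longleftrightarrow> integrable M (\<lambda>x. (norm (wg u x))\<^sup>2)"
  proof (rule integrable_cong_AE)
    show "(\<lambda>x. (norm (g x))\<^sup>2) \<in> borel_measurable M" using g(1) by (auto simp: L2_space_def)
    show "(\<lambda>x. (norm (wg u x))\<^sup>2) \<in> borel_measurable M" using m by auto
    show "AE x in M. (norm (g x))\<^sup>2 = (norm (wg u x))\<^sup>2" using ae by eventually_elim simp
  qed
  then show "wg u \<in> L2_space M" using m g(1) by (simp add: L2_space_def)
qed

lemma H1I: "u \<in> L2_space M \<Longrightarrow> has_weak_gradient \<Omega> u g \<Longrightarrow> g \<in> L2_space M \<Longrightarrow> u \<in> H1 \<Omega>"
  by (auto simp: H1_def Lq_2_eq)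

lemma H1_lincomb:
  assumes "u \<in> H1 \<Omega>" "v \<in> H1 \<Omega>"
  shows "(\<lambda>x. u x + c * v x) \<in> H1 \<Omega>" "AE x in M. wg (\<lambda>x. u x + c * v x) x = wg u x + c *\<^sub>R wg v x"
proof -
  have w: "has_weak_gradient \<Omega> (\<lambda>x. u x + c * v x) (\<lambda>x. wg u x + c *\<^sub>R wg v x)"
    by (rule has_weak_gradient_lincomb[OF open_\<Omega> H1D(2)[OF assms(1)] H1D(2)[OF assms(2)]])
  show "(\<lambda>x. u x + c * v x) \<in> H1 \<Omega>"
    using L2_space_lincomb(1)[OF H1D(1)[OF assms(1)] H1D(1)[OF assms(2)], of c]
      L2_space_lincomb(1)[OF H1D(3)[OF assms(1)] H1D(3)[OF assms(2)], of c]
    by (intro H1I[OF _ w]) simp_all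
  show "AE x in M. wg (\<lambda>x. u x + c * v x) x = wg u x + c *\<^sub>R wg v x"
    by (rule AE_weak_gradient[OF open_\<Omega> w])
qed

lemma DF_eq: "DE u = (\<integral>x. (norm (wg u x))\<^sup>2 \<partial>M)"
  by (simp add: dirichlet_def power2_norm_eq_inner)

lemma DF_cong:
  assumes "u \<in> H1 \<Omega>" "AE x in M. wg u x = g x" "g \<in> borel_measurable M"
  shows "DE u = (\<integral>x. (norm (g x))\<^sup>2 \<partial>M)"
  unfolding DF_eq
proof (rule integral_cong_AE)
  show "(\<lambda>x. (norm (wg u x))\<^sup>2) \<in> borel_measurable M"
    using H1D(3)[OF assms(1)] by (auto simp: L2_space_def)
  show "(\<lambda>x. (norm (g x))\<^sup>2) \<in> borel_measurable M" using assms(3) by simp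
  show "AE x in M. (norm (wg u x))\<^sup>2 = (norm (g x))\<^sup>2" using assms(2) by eventually_elim simp
qed

lemma DF_lincomb:
  assumes "u \<in> H1 \<Omega>" "v \<in> H1 \<Omega>"
  shows "DE (\<lambda>x. u x + c * v x) = DE u + 2 * c * DF u v + c\<^sup>2 * DE v"
proof -
  have "DE (\<lambda>x. u x + c * v x) = (\<integral>x. (norm (wg u x + c *\<^sub>R wg v x))\<^sup>2 \<partial>M)"
    using L2_space_lincomb(1)[OF H1D(3)[OF assms(1)] H1D(3)[OF assms(2)], of c]
    by (intro DF_cong[OF H1_lincomb[OF assms]]) (simp add: L2_space_def)
  also have "\<dots> = DE u + 2 * c * DF u v + c\<^sup>2 * DE v"
    unfolding DF_eq unfolding dirichlet_def
    by (rule L2_space_lincomb(2)[OF H1D(3)[OF assms(1)] H1D(3)[OF assms(2)]])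
  finally show ?thesis .
qed

lemma DF_cauchy_schwarz:
  "u \<in> H1 \<Omega> \<Longrightarrow> v \<in> H1 \<Omega> \<Longrightarrow> (DF u v)\<^sup>2 \<le> DE u * DE v"
  unfolding DF_eq unfolding dirichlet_def by (rule L2_space_inner(2)[OF H1D(3) H1D(3)])

lemma H1_norm_power2:
  assumes "u \<in> H1 \<Omega>"
  shows "(H1_norm \<Omega> u)\<^sup>2 = (\<integral>x. (u x)\<^sup>2 \<partial>M) + DE u"
proof -
  have "(Lq_norm 2 \<Omega> u)\<^sup>2 = (\<integral>x. (u x)\<^sup>2 \<partial>M)"
    by (simp add: Lq_norm_def powr_half_sqrt)
  moreover have "(Lq_norm 2 \<Omega> (wg u))\<^sup>2 = DE u"
    using H01_norm_power2[of \<Omega> u] by (simp add: H01_norm_def)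
  ultimately show ?thesis by (simp add: H1_norm_def)
qed

lemma TF_L2:
  assumes "\<phi> \<in> TF"
  shows "\<phi> \<in> L2_space M" "grad \<phi> \<in> L2_space M"
proof -
  obtain K where "compact K" "K \<subseteq> \<Omega>" "\<And>x. x \<notin> K \<Longrightarrow> \<phi> x = 0" "\<And>x. x \<notin> K \<Longrightarrow> grad \<phi> x = 0"
    using test_function_support[OF assms] by metis
  then show "\<phi> \<in> L2_space M" "grad \<phi> \<in> L2_space M"
    using test_function_L2[OF test_functionsD(3)[OF assms], of K] test_function_L2[OF continuous_grad_test_function[OF assms], of K]
      open_\<Omega> by auto
qed

lemma TF_H1: "\<phi> \<in> TF \<Longrightarrow> \<phi> \<in> H1 \<Omega>"
  by (intro H1I[OF _ has_weak_gradient_test_function[OF open_\<Omega>]] TF_L2)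

lemma DF_TF: "\<phi> \<in> TF \<Longrightarrow> DE \<phi> = (\<integral>x. (norm (grad \<phi> x))\<^sup>2 \<partial>M)"
  using TF_L2[of \<phi>] by (intro DF_cong TF_H1 AE_weak_gradient[OF open_\<Omega> has_weak_gradient_test_function[OF open_\<Omega>]])
    (auto simp: L2_space_def)

lemma TF_H01: assumes "\<phi> \<in> TF" shows "\<phi> \<in> H01 \<Omega>"
proof -
  have "DE (\<lambda>x. \<phi> x + (-1) * \<phi> x) = 0"
    by (subst DF_lincomb) (use assms TF_H1 in auto)
  then have "(H1_norm \<Omega> (\<lambda>x. \<phi> x - \<phi> x))\<^sup>2 = 0"
    using H1_norm_power2[OF H1_lincomb(1)[OF TF_H1[OF assms] TF_H1[OF assms], of "-1"]] by simp
  then show ?thesis using assms TF_H1[OF assms]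
    by (auto simp: H01_def intro!: exI[of _ "\<lambda>_. \<phi>"])
qed

lemma H01_H1: "u \<in> H01 \<Omega> \<Longrightarrow> u \<in> H1 \<Omega>"
  by (simp add: H01_def)

lemma H01_iff:
  "u \<in> H01 \<Omega> \<longleftrightarrow> u \<in> H1 \<Omega> \<and> (\<exists>\<phi>. (\<forall>n. \<phi> n \<in> TF) \<and> (\<lambda>n. \<integral>x. (u x - \<phi> n x)\<^sup>2 \<partial>M) \<longlonglongrightarrow> 0
    \<and> (\<lambda>n. DE (\<lambda>x. u x - \<phi> n x)) \<longlonglongrightarrow> 0)"
proof -
  have "(\<lambda>n. H1_norm \<Omega> (\<lambda>x. u x - \<phi> n x)) \<longlonglongrightarrow> 0 \<longleftrightarrow> (\<lambda>n. \<integral>x. (u x - \<phi> n x)\<^sup>2 \<partial>M) \<longlonglongrightarrow> 0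
      \<and> (\<lambda>n. DE (\<lambda>x. u x - \<phi> n x)) \<longlonglongrightarrow> 0"
    if u: "u \<in> H1 \<Omega>" and \<phi>: "\<And>n. \<phi> n \<in> TF" for \<phi> :: "nat \<Rightarrow> 'a \<Rightarrow> real"
  proof -
    have e: "(H1_norm \<Omega> (\<lambda>x. u x - \<phi> n x))\<^sup>2 = (\<integral>x. (u x - \<phi> n x)\<^sup>2 \<partial>M) + DE (\<lambda>x. u x - \<phi> n x)" for n
      using H1_norm_power2[OF H1_lincomb(1)[OF u TF_H1[OF \<phi>[of n]], of "-1"]] by simp
    have e': "H1_norm \<Omega> (\<lambda>x. u x - \<phi> n x) = sqrt ((\<integral>x. (u x - \<phi> n x)\<^sup>2 \<partial>M) + DE (\<lambda>x. u x - \<phi> n x))" for n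
      unfolding e[symmetric] by (simp add: H1_norm_def)
    show ?thesis
    proof
      assume "(\<lambda>n. H1_norm \<Omega> (\<lambda>x. u x - \<phi> n x)) \<longlonglongrightarrow> 0"
      then have "(\<lambda>n. (H1_norm \<Omega> (\<lambda>x. u x - \<phi> n x))\<^sup>2) \<longlonglongrightarrow> 0\<^sup>2" by (intro tendsto_intros)
      then have l: "(\<lambda>n. (\<integral>x. (u x - \<phi> n x)\<^sup>2 \<partial>M) + DE (\<lambda>x. u x - \<phi> n x)) \<longlonglongrightarrow> 0"
        unfolding e by simp
      show "(\<lambda>n. \<integral>x. (u x - \<phi> n x)\<^sup>2 \<partial>M) \<longlonglongrightarrow> 0 \<and> (\<lambda>n. DE (\<lambda>x. u x - \<phi> n x)) \<longlonglongrightarrow> 0"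
        by (intro conjI tendsto_sandwich[OF _ _ tendsto_const l] always_eventually allI) auto
    next
      assume "(\<lambda>n. \<integral>x. (u x - \<phi> n x)\<^sup>2 \<partial>M) \<longlonglongrightarrow> 0 \<and> (\<lambda>n. DE (\<lambda>x. u x - \<phi> n x)) \<longlonglongrightarrow> 0"
      then have "(\<lambda>n. sqrt ((\<integral>x. (u x - \<phi> n x)\<^sup>2 \<partial>M) + DE (\<lambda>x. u x - \<phi> n x))) \<longlonglongrightarrow> sqrt (0 + 0)"
        by (intro tendsto_intros) auto
      then show "(\<lambda>n. H1_norm \<Omega> (\<lambda>x. u x - \<phi> n x)) \<longlonglongrightarrow> 0" unfolding e' by simp
    qed
  qed
  then show ?thesis unfolding H01_def by blast
qed

lemma H01_lincomb:
  assumes u: "u \<in> H01 \<Omega>" and v: "v \<in> H01 \<Omega>"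
  shows "(\<lambda>x. u x + c * v x) \<in> H01 \<Omega>"
proof -
  note uv = H01_H1[OF u] H01_H1[OF v]
  obtain \<phi> where \<phi>: "\<And>n::nat. \<phi> n \<in> TF" "(\<lambda>n. \<integral>x. (u x - \<phi> n x)\<^sup>2 \<partial>M) \<longlonglongrightarrow> 0"
      "(\<lambda>n. DE (\<lambda>x. u x - \<phi> n x)) \<longlonglongrightarrow> 0"
    using u unfolding H01_iff by blast
  obtain \<psi> where \<psi>: "\<And>n::nat. \<psi> n \<in> TF" "(\<lambda>n. \<integral>x. (v x - \<psi> n x)\<^sup>2 \<partial>M) \<longlonglongrightarrow> 0"
      "(\<lambda>n. DE (\<lambda>x. v x - \<psi> n x)) \<longlonglongrightarrow> 0"
    using v unfolding H01_iff by blast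
  define f g where "f n = (\<lambda>x. u x - \<phi> n x)" and "g n = (\<lambda>x. v x - \<psi> n x)" for n
  have fH: "f n \<in> H1 \<Omega>" and gH: "g n \<in> H1 \<Omega>" for n
    using H1_lincomb(1)[OF uv(1) TF_H1[OF \<phi>(1)[of n]], of "-1"] H1_lincomb(1)[OF uv(2) TF_H1[OF \<psi>(1)[of n]], of "-1"]
    by (simp_all add: f_def g_def)
  have e: "(\<lambda>x. u x + c * v x - (\<phi> n x + c * \<psi> n x)) = (\<lambda>x. f n x + c * g n x)" for n
    by (auto simp: f_def g_def algebra_simps)
  \<comment> \<open>The square of f - c g is nonnegative, which bounds the mixed term in the square
    of f + c g.\<close>
  have par: "(\<integral>x. (f n x + c * g n x)\<^sup>2 \<partial>M) \<le> 2 * (\<integral>x. (f n x)\<^sup>2 \<partial>M) + 2 * c\<^sup>2 * (\<integral>x. (g n x)\<^sup>2 \<partial>M)"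
    "DE (\<lambda>x. f n x + c * g n x) \<le> 2 * DE (f n) + 2 * c\<^sup>2 * DE (g n)" for n
  proof -
    have "0 \<le> (\<integral>x. (norm (f n x + (-c) *\<^sub>R g n x))\<^sup>2 \<partial>M)" by (rule integral_nonneg_AE) simp
    then have "(\<integral>x. (norm (f n x + c *\<^sub>R g n x))\<^sup>2 \<partial>M)
        \<le> 2 * (\<integral>x. (norm (f n x))\<^sup>2 \<partial>M) + 2 * c\<^sup>2 * (\<integral>x. (norm (g n x))\<^sup>2 \<partial>M)"
      unfolding L2_space_lincomb(2)[OF H1D(1)[OF fH[of n]] H1D(1)[OF gH[of n]]] by simp
    then show "(\<integral>x. (f n x + c * g n x)\<^sup>2 \<partial>M) \<le> 2 * (\<integral>x. (f n x)\<^sup>2 \<partial>M) + 2 * c\<^sup>2 * (\<integral>x. (g n x)\<^sup>2 \<partial>M)"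
      by simp
    have "0 \<le> DE (\<lambda>x. f n x + (-c) * g n x)" by (rule dirichlet_nonneg)
    then show "DE (\<lambda>x. f n x + c * g n x) \<le> 2 * DE (f n) + 2 * c\<^sup>2 * DE (g n)"
      unfolding DF_lincomb[OF fH gH] by simp
  qed
  have "(\<lambda>n. \<integral>x. (u x + c * v x - (\<phi> n x + c * \<psi> n x))\<^sup>2 \<partial>M) \<longlonglongrightarrow> 0"
  proof (rule tendsto_sandwich[OF _ _ tendsto_const])
    have "(\<lambda>n. 2 * (\<integral>x. (f n x)\<^sup>2 \<partial>M) + 2 * c\<^sup>2 * (\<integral>x. (g n x)\<^sup>2 \<partial>M)) \<longlonglongrightarrow> 2 * 0 + 2 * c\<^sup>2 * 0"
      unfolding f_def g_def by (intro tendsto_intros \<phi> \<psi>)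
    then show "(\<lambda>n. 2 * (\<integral>x. (f n x)\<^sup>2 \<partial>M) + 2 * c\<^sup>2 * (\<integral>x. (g n x)\<^sup>2 \<partial>M)) \<longlonglongrightarrow> 0" by simp
    show "\<forall>\<^sub>F n in sequentially. (\<integral>x. (u x + c * v x - (\<phi> n x + c * \<psi> n x))\<^sup>2 \<partial>M)
        \<le> 2 * (\<integral>x. (f n x)\<^sup>2 \<partial>M) + 2 * c\<^sup>2 * (\<integral>x. (g n x)\<^sup>2 \<partial>M)"
      using par(1) by (simp add: fun_cong[OF e])
  qed simp
  moreover have "(\<lambda>n. DE (\<lambda>x. u x + c * v x - (\<phi> n x + c * \<psi> n x))) \<longlonglongrightarrow> 0"
    unfolding e
  proof (rule tendsto_sandwich[OF _ _ tendsto_const])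
    have "(\<lambda>n. 2 * DE (f n) + 2 * c\<^sup>2 * DE (g n)) \<longlonglongrightarrow> 2 * 0 + 2 * c\<^sup>2 * 0"
      unfolding f_def g_def by (intro tendsto_intros \<phi> \<psi>)
    then show "(\<lambda>n. 2 * DE (f n) + 2 * c\<^sup>2 * DE (g n)) \<longlonglongrightarrow> 0" by simp
  qed (use par(2) in auto)
  moreover have "(\<lambda>x. \<phi> n x + c * \<psi> n x) \<in> TF" for n
    by (intro test_function_add test_function_scale \<phi> \<psi>)
  ultimately show ?thesis
    unfolding H01_iff using H1_lincomb(1)[OF uv] by (intro conjI exI[of _ "\<lambda>n x. \<phi> n x + c * \<psi> n x"]) auto
qed

lemma H01_scale: "u \<in> H01 \<Omega> \<Longrightarrow> (\<lambda>x. c * u x) \<in> H01 \<Omega>"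
  using H01_lincomb[OF TF_H01[OF test_function_zero], of u c] by simp

lemma DF_zero: "DE (\<lambda>_. 0) = 0"
  by (subst DF_TF[OF test_function_zero]) (simp add: grad_def partial_eqI[OF has_derivative_const])

lemma DF_scale: assumes "u \<in> H1 \<Omega>" shows "DE (\<lambda>x. c * u x) = c\<^sup>2 * DE u"
proof -
  have z: "(\<lambda>_. 0) \<in> H1 \<Omega>" by (rule TF_H1[OF test_function_zero])
  have "DF (\<lambda>_. 0) u = 0" using DF_cauchy_schwarz[OF z assms] by (simp add: DF_zero)
  then show ?thesis using DF_lincomb[OF z assms, of c] by (simp add: DF_zero)
qed

text \<open>Passing to a subsequence adds pointwise convergence almost everywhere, since the squared
  differences tend to 0 in mean. Fatou's lemma and dominated convergence will be applied along this
  sequence.\<close>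

lemma H01_approx:
  assumes u: "u \<in> H01 \<Omega>"
  obtains \<phi> where "\<And>n::nat. \<phi> n \<in> TF" "(\<lambda>n. \<integral>x. (u x - \<phi> n x)\<^sup>2 \<partial>M) \<longlonglongrightarrow> 0"
    "(\<lambda>n. DE (\<lambda>x. u x - \<phi> n x)) \<longlonglongrightarrow> 0"
    "(\<lambda>n. DF (\<phi> n) (\<phi> n)) \<longlonglongrightarrow> DE u"
    "AE x in M. (\<lambda>n. \<phi> n x) \<longlonglongrightarrow> u x"
proof -
  obtain \<phi> where \<phi>: "\<And>n::nat. \<phi> n \<in> TF" "(\<lambda>n. \<integral>x. (u x - \<phi> n x)\<^sup>2 \<partial>M) \<longlonglongrightarrow> 0"
      "(\<lambda>n. DE (\<lambda>x. u x - \<phi> n x)) \<longlonglongrightarrow> 0"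
    using u unfolding H01_iff by blast
  define f where "f n = (\<lambda>x. u x - \<phi> n x)" for n
  have uH: "u \<in> H1 \<Omega>" by (rule H01_H1[OF u])
  have fH: "f n \<in> H1 \<Omega>" for n
    using H1_lincomb(1)[OF uH TF_H1[OF \<phi>(1)[of n]], of "-1"] by (simp add: f_def)
  have int: "integrable M (\<lambda>x. (f n x)\<^sup>2)" for n using H1D(1)[OF fH[of n]] by (simp add: L2_space_def)
  have "(\<lambda>n. \<integral>x. norm ((f n x)\<^sup>2) \<partial>M) \<longlonglongrightarrow> 0" using \<phi>(2) by (simp add: f_def)
  from tendsto_L1_AE_subseq[OF int this] obtain r where r: "strict_mono r"
      "AE x in M. (\<lambda>n. (f (r n) x)\<^sup>2) \<longlonglongrightarrow> 0" by blast
  have "AE x in M. (\<lambda>n. \<phi> (r n) x) \<longlonglongrightarrow> u x"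
    using r(2)
  proof eventually_elim
    case (elim x)
    then have "(\<lambda>n. \<bar>f (r n) x\<bar>) \<longlonglongrightarrow> 0" using tendsto_real_sqrt[OF elim] by simp
    then have "(\<lambda>n. u x - f (r n) x) \<longlonglongrightarrow> u x - 0" by (intro tendsto_intros) (simp add: tendsto_rabs_zero_iff)
    then show ?case by (simp add: f_def)
  qed
  moreover have "(\<lambda>n. DF (\<phi> n) (\<phi> n)) \<longlonglongrightarrow> DE u"
  proof -
    have e: "DF (\<phi> n) (\<phi> n) = DE u + 2 * (-1) * DF u (f n) + (-1)\<^sup>2 * DE (f n)" for n
      using DF_lincomb[OF uH fH[of n], of "-1"] by (simp add: f_def)
    have "(\<lambda>n. (DF u (f n))\<^sup>2) \<longlonglongrightarrow> 0"
    proof (rule tendsto_sandwich[OF _ _ tendsto_const])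
      show "\<forall>\<^sub>F n in sequentially. (DF u (f n))\<^sup>2 \<le> DE u * DE (f n)"
        by (intro always_eventually allI DF_cauchy_schwarz uH fH)
      have "(\<lambda>n. DE u * DE (f n)) \<longlonglongrightarrow> DE u * 0"
        unfolding f_def by (intro tendsto_intros \<phi>)
      then show "(\<lambda>n. DE u * DE (f n)) \<longlonglongrightarrow> 0" by simp
    qed simp
    from tendsto_real_sqrt[OF this] have "(\<lambda>n. DF u (f n)) \<longlonglongrightarrow> 0"
      by (simp add: tendsto_rabs_zero_iff)
    then have "(\<lambda>n. DE u + 2 * (-1) * DF u (f n) + (-1)\<^sup>2 * DE (f n)) \<longlonglongrightarrow> DE u + 2 * (-1) * 0 + (-1)\<^sup>2 * 0"
      using \<phi>(3) unfolding f_def by (intro tendsto_intros)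
    then show ?thesis unfolding e by simp
  qed
  ultimately show ?thesis
    using \<phi> LIMSEQ_subseq_LIMSEQ[OF \<phi>(2) r(1)] LIMSEQ_subseq_LIMSEQ[OF \<phi>(3) r(1)]
      LIMSEQ_subseq_LIMSEQ[of "\<lambda>n. DF (\<phi> n) (\<phi> n)" _ r] r(1)
    by (intro that[of "\<lambda>n. \<phi> (r n)"]) (auto simp: o_def)
qed

end

section \<open>Sobolev embedding and expansion of the energy\<close>

text \<open>The nonlinearity |s|^(r-2) s, that is, the derivative of |s|^r / r for r > 1.\<close>

definition spow :: "real \<Rightarrow> real \<Rightarrow> real" where
  "spow r s = sgn s * \<bar>s\<bar> powr (r - 1)"

lemma spow_measurable [measurable]: "spow r \<in> borel_measurable borel"
  unfolding spow_def[abs_def] by measurable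

lemma spow_self: "spow r s * s = \<bar>s\<bar> powr r"
proof (cases "s = 0")
  case False
  then have "spow r s * s = \<bar>s\<bar> powr (r - 1) * \<bar>s\<bar> powr 1"
    by (simp add: spow_def sgn_if)
  also have "\<dots> = \<bar>s\<bar> powr r" by (subst powr_add[symmetric]) simp
  finally show ?thesis .
qed (simp add: spow_def)

lemma abs_spow: "\<bar>spow r s\<bar> = \<bar>s\<bar> powr (r - 1)"
  by (cases "s = 0") (auto simp: spow_def abs_mult abs_sgn_eq)

lemma powr_le_one_plus_powr:
  assumes "0 < r" "r \<le> q"
  shows "\<bar>s::real\<bar> powr r \<le> 1 + \<bar>s\<bar> powr q"
proof (cases "\<bar>s\<bar> \<le> 1")
  case True
  then have "\<bar>s\<bar> powr r \<le> 1" using assms powr_mono2[of r "\<bar>s\<bar>" 1] by simp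
  then show ?thesis using powr_ge_zero[of "\<bar>s\<bar>" q] by linarith
next
  case False
  then have "\<bar>s\<bar> powr r \<le> \<bar>s\<bar> powr q" using assms powr_mono[of r q "\<bar>s\<bar>"] by simp
  then show ?thesis by linarith
qed

text \<open>A crude form of Young's inequality, obtained by replacing both arguments by the larger
  of the two absolute values. It makes the product integrable when both factors come from L^r
  functions.\<close>

lemma spow_mult_le:
  assumes "r > 1"
  shows "\<bar>spow r s * t\<bar> \<le> \<bar>s\<bar> powr r + \<bar>t\<bar> powr r"
proof -
  define m where "m = max \<bar>s\<bar> \<bar>t\<bar>"
  have m: "m \<ge> 0" "\<bar>s\<bar> \<le> m" "\<bar>t\<bar> \<le> m" "m = \<bar>s\<bar> \<or> m = \<bar>t\<bar>" by (auto simp: m_def)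
  have "\<bar>spow r s * t\<bar> = \<bar>s\<bar> powr (r - 1) * \<bar>t\<bar>" by (simp add: abs_mult abs_spow)
  also have "\<dots> \<le> m powr (r - 1) * m"
    using m assms powr_mono2[of "r - 1" "\<bar>s\<bar>" m] by (intro mult_mono) simp_all
  also have "\<dots> = m powr r" using m powr_mult_base[of m "r - 1"] by (simp add: mult.commute)
  also have "\<dots> \<le> \<bar>s\<bar> powr r + \<bar>t\<bar> powr r"
    using m(4) powr_ge_zero[of "\<bar>s\<bar>" r] powr_ge_zero[of "\<bar>t\<bar>" r] by fastforce
  finally show ?thesis .
qed

text \<open>Two applications of the mean value theorem; r > 2 ensures that the first derivative is
  again differentiable, also at zeros. At the intermediate point |s + \<eta> t| <= 2 max(|s|, |t|),
  which explains the factor 2^r.\<close>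

lemma abs_powr_expansion:
  fixes s t \<tau> r :: real
  assumes r: "r > 2" and \<tau>: "0 < \<tau>" "\<tau> \<le> 1"
  shows "\<bar>\<bar>s + \<tau> * t\<bar> powr r - \<bar>s\<bar> powr r - \<tau> * r * (spow r s * t)\<bar>
    \<le> r * (r - 1) * 2 powr r * \<tau>\<^sup>2 * (\<bar>s\<bar> powr r + \<bar>t\<bar> powr r)"
proof -
  define f where "f x = \<bar>s + x * t\<bar> powr r" for x
  define f' where "f' x = r * spow r (s + x * t) * t" for x
  define f'' where "f'' x = r * ((r - 1) * \<bar>s + x * t\<bar> powr (r - 2) * t) * t" for x
  have lin: "((\<lambda>x. s + x * t) has_real_derivative t) (at x)" for x
    by (auto intro!: derivative_eq_intros)
  have d1: "(f has_real_derivative f' x) (at x)" for x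
    unfolding f_def f'_def spow_def
    using DERIV_chain2[OF DERIV_abs_powr[of r "s + x * t"] lin[of x]] r by (simp add: mult.assoc)
  have d2: "(f' has_real_derivative f'' x) (at x)" for x
  proof -
    have "((\<lambda>x. spow r (s + x * t)) has_real_derivative (r - 1) * \<bar>s + x * t\<bar> powr (r - 2) * t) (at x)"
      unfolding spow_def using DERIV_chain2[OF DERIV_sgn_abs_powr[of "r - 1" "s + x * t"] lin[of x]] r by simp
    from DERIV_cmult_right[OF DERIV_cmult[OF this, of r], of t] show ?thesis
      unfolding f'_def f''_def .
  qed
  obtain \<xi> where \<xi>: "0 < \<xi>" "\<xi> < \<tau>" "f \<tau> - f 0 = \<tau> * f' \<xi>"
    using MVT2[OF \<tau>(1), of f f'] d1 by auto
  obtain \<eta> where \<eta>: "0 < \<eta>" "\<eta> < \<xi>" "f' \<xi> - f' 0 = \<xi> * f'' \<eta>"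
    using MVT2[OF \<xi>(1), of f' f''] d2 by auto
  define m where "m = max \<bar>s\<bar> \<bar>t\<bar>"
  have m: "m \<ge> 0" "\<bar>s\<bar> \<le> m" "\<bar>t\<bar> \<le> m" "m = \<bar>s\<bar> \<or> m = \<bar>t\<bar>" by (auto simp: m_def)
  have "\<bar>\<eta> * t\<bar> \<le> 1 * \<bar>t\<bar>" unfolding abs_mult using \<eta> \<xi> \<tau> by (intro mult_right_mono) auto
  then have "\<bar>s + \<eta> * t\<bar> \<le> 2 * m" using m by linarith
  then have "\<bar>s + \<eta> * t\<bar> powr (r - 2) \<le> (2 * m) powr (r - 2)" using r by (intro powr_mono2) auto
  also have "\<dots> = 2 powr (r - 2) * m powr (r - 2)" by (simp add: powr_mult)
  also have "\<dots> \<le> 2 powr r * m powr (r - 2)" by (intro mult_right_mono powr_mono) auto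
  finally have pw: "\<bar>s + \<eta> * t\<bar> powr (r - 2) \<le> 2 powr r * m powr (r - 2)" .
  have "\<bar>t\<bar> * \<bar>t\<bar> \<le> m * m" using m by (intro mult_mono) auto
  then have tt: "t * t \<le> m * m" by (simp flip: abs_mult)
  have "\<bar>f'' \<eta>\<bar> = r * (r - 1) * (\<bar>s + \<eta> * t\<bar> powr (r - 2) * (t * t))"
    using r by (simp add: f''_def abs_mult mult_ac)
  also have "\<dots> \<le> r * (r - 1) * ((2 powr r * m powr (r - 2)) * (m * m))"
    using r by (intro mult_left_mono mult_mono[OF pw tt]) auto
  also have "(2 powr r * m powr (r - 2)) * (m * m) = 2 powr r * m powr r"
  proof (cases "m = 0")
    case False
    then have "m powr (r - 2) * (m * m) = m powr (r - 2) * m powr 2" using m by (simp add: power2_eq_square)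
    also have "\<dots> = m powr r" by (simp flip: powr_add)
    finally show ?thesis by (simp add: mult.assoc)
  qed simp
  also have "r * (r - 1) * (2 powr r * m powr r) \<le> r * (r - 1) * (2 powr r * (\<bar>s\<bar> powr r + \<bar>t\<bar> powr r))"
    using r m(4) powr_ge_zero[of "\<bar>s\<bar>" r] powr_ge_zero[of "\<bar>t\<bar>" r] by (intro mult_left_mono) fastforce+
  finally have B: "\<bar>f'' \<eta>\<bar> \<le> r * (r - 1) * 2 powr r * (\<bar>s\<bar> powr r + \<bar>t\<bar> powr r)" by (simp add: mult_ac)
  have "f \<tau> - f 0 - \<tau> * f' 0 = \<tau> * (\<xi> * f'' \<eta>)"
    using \<xi>(3) \<eta>(3) by (simp add: algebra_simps)
  then have "\<bar>f \<tau> - f 0 - \<tau> * f' 0\<bar> = (\<tau> * \<xi>) * \<bar>f'' \<eta>\<bar>"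
    using \<tau> \<xi> by (simp add: abs_mult)
  also have "\<dots> \<le> \<tau>\<^sup>2 * (r * (r - 1) * 2 powr r * (\<bar>s\<bar> powr r + \<bar>t\<bar> powr r))"
    using \<tau> \<xi> B by (intro mult_mono) (auto simp: power2_eq_square)
  finally show ?thesis by (simp add: f_def f'_def mult_ac)
qed

section \<open>Embedding of \<open>H\<^sub>0\<^sup>1\<close> into L^r up to the critical
  exponent\<close>

locale sobolev_domain = bounded_open \<Omega> for \<Omega> :: "'a::euclidean_space set" +
  fixes q :: real
  assumes dim: "DIM('a) > 4" and q_eq: "q = crit_exp DIM('a)"
begin

lemma q_bounds: "2 < q" "q < 4"
  using dim by (auto simp: q_eq crit_exp_def field_simps)

text \<open>The constant of \<open>sobolev_inequality\<close>, because q / 2 + 1 = 2 (N - 1) / (N -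
  2).\<close>

definition Ks :: real where
  "Ks = ((q / 2 + 1)\<^sup>2) powr (q / 2)"

lemma Ks_nonneg: "Ks \<ge> 0" by (simp add: Ks_def)

text \<open>Integrands depending on the value and the gradient and vanishing off the support can be
  moved between the domain and the whole space, where the inequalities for smooth functions are
  stated.\<close>

lemma TF_integral:
  fixes f :: "real \<Rightarrow> 'a \<Rightarrow> real"
  assumes "\<phi> \<in> TF" "f 0 0 = 0" "continuous_on UNIV (\<lambda>x. f (\<phi> x) (grad \<phi> x))"
  shows "integrable M (\<lambda>x. f (\<phi> x) (grad \<phi> x))" "integrable lborel (\<lambda>x. f (\<phi> x) (grad \<phi> x))"
    "(\<integral>x. f (\<phi> x) (grad \<phi> x) \<partial>M) = (\<integral>x. f (\<phi> x) (grad \<phi> x) \<partial>lborel)"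
proof -
  obtain K where K: "compact K" "K \<subseteq> \<Omega>" "\<And>x. x \<notin> K \<Longrightarrow> \<phi> x = 0" "\<And>x. x \<notin> K \<Longrightarrow> grad \<phi> x = 0"
    using test_function_support[OF assms(1)] by metis
  then have z: "\<And>x. x \<notin> K \<Longrightarrow> f (\<phi> x) (grad \<phi> x) = 0" using assms(2) by simp
  show "integrable M (\<lambda>x. f (\<phi> x) (grad \<phi> x))" "integrable lborel (\<lambda>x. f (\<phi> x) (grad \<phi> x))"
    "(\<integral>x. f (\<phi> x) (grad \<phi> x) \<partial>M) = (\<integral>x. f (\<phi> x) (grad \<phi> x) \<partial>lborel)"
    using lebesgue_on_continuous_compact_support[OF assms(3) K(1,2) sets_\<Omega> z] by auto
qed

lemma abs_partial_le_norm_grad: "i \<in> Basis \<Longrightarrow> \<bar>grad f x \<bullet> i\<bar> \<le> norm (grad f x)"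
  by (rule Basis_le_norm)

lemma sobolev_TF:
  assumes \<phi>: "\<phi> \<in> TF"
  shows "integrable M (\<lambda>x. \<bar>\<phi> x\<bar> powr q)" "Lq_int q \<Omega> \<phi> \<le> Ks * DE \<phi> powr (q / 2)"
proof -
  note c = test_functionsD(3)[OF \<phi>] continuous_grad_test_function[OF \<phi>]
  obtain K R where K: "\<And>x. x \<notin> K \<Longrightarrow> \<phi> x = 0" "\<And>x. norm x \<ge> R \<Longrightarrow> x \<notin> K"
    using test_function_support[OF \<phi>] by metis
  have c1: "continuous_on UNIV (\<lambda>x. \<bar>\<phi> x\<bar> powr q)" using q_bounds c by (intro continuous_on_abs_powr) auto
  have c2: "continuous_on UNIV (\<lambda>x. (norm (grad \<phi> x))\<^sup>2)" using c by (intro continuous_intros)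
  show "integrable M (\<lambda>x. \<bar>\<phi> x\<bar> powr q)"
    using TF_integral(1)[OF \<phi>, of "\<lambda>s _. \<bar>s\<bar> powr q"] c1 by simp
  have \<gamma>: "2 * (real DIM('a) - 1) / (real DIM('a) - 2) = q / 2 + 1"
    using dim by (simp add: q_eq crit_exp_def field_simps)
  have "(\<integral>x. \<bar>\<phi> x\<bar> powr q \<partial>lborel)
      \<le> ((2 * (real DIM('a) - 1) / (real DIM('a) - 2))\<^sup>2 * (\<integral>x. (norm (grad \<phi> x))\<^sup>2 \<partial>lborel)) powr (q / 2)"
    unfolding q_eq
  proof (rule sobolev_inequality[where v' = "\<lambda>x h. grad \<phi> x \<bullet> h" and R = R])
    show "(\<lambda>x. norm (grad \<phi> x)) \<in> borel_measurable borel"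
      using c(2) by (intro borel_measurable_continuous_onI continuous_intros)
    show "integrable lborel (\<lambda>x. (norm (grad \<phi> x))\<^sup>2)"
      using TF_integral(2)[OF \<phi>, of "\<lambda>_ g. (norm g)\<^sup>2"] c2 by simp
  qed (use dim K c in \<open>auto intro!: has_derivative_test_function[OF \<phi>] continuous_intros abs_partial_le_norm_grad simp del: grad_inner\<close>)
  note this[unfolded \<gamma>]
  then show "Lq_int q \<Omega> \<phi> \<le> Ks * DE \<phi> powr (q / 2)"
    using TF_integral(3)[OF \<phi>, of "\<lambda>s _. \<bar>s\<bar> powr q"] TF_integral(3)[OF \<phi>, of "\<lambda>_ g. (norm g)\<^sup>2"] c1 c2
    by (simp add: Lq_int_def DF_TF[OF \<phi>] Ks_def powr_mult)
qed

lemma H01_measurable: "u \<in> H01 \<Omega> \<Longrightarrow> u \<in> borel_measurable M"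
  using H1D(1)[OF H01_H1] by (simp add: L2_space_def)

text \<open>Fatou's lemma along test functions that converge almost everywhere and whose Dirichlet
  integrals converge.\<close>

lemma sobolev_H01:
  assumes u: "u \<in> H01 \<Omega>"
  shows "integrable M (\<lambda>x. \<bar>u x\<bar> powr q)" "Lq_int q \<Omega> u \<le> Ks * DE u powr (q / 2)"
proof -
  obtain \<phi> where \<phi>0: "\<And>n::nat. \<phi> n \<in> TF" "(\<lambda>n. \<integral>x. (u x - \<phi> n x)\<^sup>2 \<partial>M) \<longlonglongrightarrow> 0"
    "(\<lambda>n. DE (\<lambda>x. u x - \<phi> n x)) \<longlonglongrightarrow> 0"
    "(\<lambda>n. DF (\<phi> n) (\<phi> n)) \<longlonglongrightarrow> DE u"
    "AE x in M. (\<lambda>n. \<phi> n x) \<longlonglongrightarrow> u x"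
    using H01_approx[OF u] by blast
  note \<phi> = \<phi>0(1,4,5)
  note [measurable] = H01_measurable[OF u]
  have [measurable]: "\<phi> n \<in> borel_measurable M" for n
    using TF_L2(1)[OF \<phi>(1)[of n]] by (simp add: L2_space_def)
  have "(\<integral>\<^sup>+x. ennreal (\<bar>u x\<bar> powr q) \<partial>M) = (\<integral>\<^sup>+x. liminf (\<lambda>n. ennreal (\<bar>\<phi> n x\<bar> powr q)) \<partial>M)"
  proof (rule nn_integral_cong_AE)
    show "AE x in M. ennreal (\<bar>u x\<bar> powr q) = liminf (\<lambda>n. ennreal (\<bar>\<phi> n x\<bar> powr q))"
      using \<phi>(3)
    proof eventually_elim
      case (elim x)
      have "isCont (\<lambda>z::real. \<bar>z\<bar> powr q) (u x)" using q_bounds by (intro isCont_abs_powr) simp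
      from isCont_tendsto_compose[OF this elim]
      have "(\<lambda>n. ennreal (\<bar>\<phi> n x\<bar> powr q)) \<longlonglongrightarrow> ennreal (\<bar>u x\<bar> powr q)" by (rule tendsto_ennrealI)
      then show ?case by (rule lim_imp_Liminf[OF sequentially_bot, symmetric])
    qed
  qed
  also have "\<dots> \<le> liminf (\<lambda>n. \<integral>\<^sup>+x. ennreal (\<bar>\<phi> n x\<bar> powr q) \<partial>M)"
    by (rule nn_integral_liminf) measurable
  also have "\<dots> \<le> liminf (\<lambda>n. ennreal (Ks * DF (\<phi> n) (\<phi> n) powr (q / 2)))"
  proof (rule Liminf_mono, intro always_eventually allI)
    fix n
    have "(\<integral>\<^sup>+x. ennreal (\<bar>\<phi> n x\<bar> powr q) \<partial>M) = ennreal (Lq_int q \<Omega> (\<phi> n))"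
      unfolding Lq_int_def by (intro nn_integral_eq_integral sobolev_TF \<phi>) auto
    then show "(\<integral>\<^sup>+x. ennreal (\<bar>\<phi> n x\<bar> powr q) \<partial>M) \<le> ennreal (Ks * DF (\<phi> n) (\<phi> n) powr (q / 2))"
      using sobolev_TF(2)[OF \<phi>(1)[of n]] by (simp add: ennreal_leI)
  qed
  also have "\<dots> = ennreal (Ks * DE u powr (q / 2))"
  proof (rule lim_imp_Liminf[OF sequentially_bot])
    show "(\<lambda>n. ennreal (Ks * DF (\<phi> n) (\<phi> n) powr (q / 2))) \<longlonglongrightarrow> ennreal (Ks * DE u powr (q / 2))"
      using q_bounds by (intro tendsto_ennrealI tendsto_mult tendsto_const tendsto_powr'[OF \<phi>(2)]) auto
  qed
  finally have le: "(\<integral>\<^sup>+x. ennreal (\<bar>u x\<bar> powr q) \<partial>M) \<le> ennreal (Ks * DE u powr (q / 2))" .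
  show int: "integrable M (\<lambda>x. \<bar>u x\<bar> powr q)"
    by (rule integrableI_bounded) (use le in \<open>auto simp: less_top[symmetric] top_unique\<close>)
  have "(\<integral>\<^sup>+x. ennreal (\<bar>u x\<bar> powr q) \<partial>M) = ennreal (Lq_int q \<Omega> u)"
    unfolding Lq_int_def by (intro nn_integral_eq_integral int) auto
  then show "Lq_int q \<Omega> u \<le> Ks * DE u powr (q / 2)"
    using le Ks_nonneg by (simp add: ennreal_le_iff)
qed

lemma H01_integrable_powr:
  assumes "u \<in> H01 \<Omega>" "0 < r" "r \<le> q"
  shows "integrable M (\<lambda>x. \<bar>u x\<bar> powr r)"
proof (rule Bochner_Integration.integrable_bound[of _ "\<lambda>x. 1 + \<bar>u x\<bar> powr q"])
  show "integrable M (\<lambda>x. 1 + \<bar>u x\<bar> powr q)" using sobolev_H01(1)[OF assms(1)] by simp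
  show "(\<lambda>x. \<bar>u x\<bar> powr r) \<in> borel_measurable M" using H01_measurable[OF assms(1)] by measurable
  show "AE x in M. norm (\<bar>u x\<bar> powr r) \<le> norm (1 + \<bar>u x\<bar> powr q)"
    using powr_le_one_plus_powr[OF assms(2,3)] by (intro AE_I2) (simp add: add_nonneg_nonneg abs_of_nonneg)
qed

lemma zero_on_iff:
  assumes "u \<in> H01 \<Omega>" "0 < r" "r \<le> q"
  shows "zero_on \<Omega> u \<longleftrightarrow> Lq_int r \<Omega> u = 0"
  unfolding zero_on_def Lq_int_def
  by (subst integral_nonneg_eq_0_iff_AE[OF H01_integrable_powr[OF assms]]) auto

lemma DF_zero_imp: "u \<in> H01 \<Omega> \<Longrightarrow> DE u = 0 \<Longrightarrow> zero_on \<Omega> u"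
  using sobolev_H01(2)[of u] Lq_int_nonneg[of q \<Omega> u] q_bounds zero_on_iff[of u q] by (simp add: order_antisym)

lemma Lq_int_scale: "Lq_int r \<Omega> (\<lambda>x. c * u x) = \<bar>c\<bar> powr r * Lq_int r \<Omega> u"
  by (simp add: Lq_int_def abs_mult powr_mult)

text \<open>From |w|^r <= 1 + |w|^q this bounds the integral of |w|^r for every r in (0, q] at once,
  as soon as the Dirichlet integral of w is 1.\<close>

definition Kp :: real where "Kp = measure M \<Omega> + Ks"

lemma Kp_nonneg: "Kp \<ge> 0" by (simp add: Kp_def Ks_nonneg)

text \<open>Both sides are homogeneous of degree r, so u may be scaled to Dirichlet integral 1. If
  the Dirichlet integral is 0, then u is zero by the critical embedding.\<close>

lemma Lq_int_le:
  assumes u: "u \<in> H01 \<Omega>" and r: "0 < r" "r \<le> q"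
  shows "Lq_int r \<Omega> u \<le> Kp * DE u powr (r / 2)"
proof (cases "DE u = 0")
  case True
  then show ?thesis using DF_zero_imp[OF u] zero_on_iff[OF u r] by simp
next
  case False
  define A where "A = DE u"
  have A: "A > 0" using False by (simp add: A_def order_less_le)
  define w where "w = (\<lambda>x. (1 / sqrt A) * u x)"
  have w: "w \<in> H01 \<Omega>" unfolding w_def by (rule H01_scale[OF u])
  have "DE w = 1" unfolding w_def
    using DF_scale[OF H01_H1[OF u], of "1 / sqrt A"] A by (simp add: A_def[symmetric] power_divide)
  then have wq: "Lq_int q \<Omega> w \<le> Ks" using sobolev_H01(2)[OF w] by simp
  have "Lq_int r \<Omega> w \<le> (\<integral>x. 1 + \<bar>w x\<bar> powr q \<partial>M)"
    unfolding Lq_int_def using powr_le_one_plus_powr[OF r] sobolev_H01(1)[OF w]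
    by (intro integral_mono H01_integrable_powr w r) auto
  also have "\<dots> = measure M \<Omega> + Lq_int q \<Omega> w"
    using sobolev_H01(1)[OF w] by (simp add: Lq_int_def)
  finally have "Lq_int r \<Omega> w \<le> Kp" using wq by (simp add: Kp_def)
  moreover have "u = (\<lambda>x. sqrt A * w x)" using A by (simp add: w_def)
  then have "Lq_int r \<Omega> u = \<bar>sqrt A\<bar> powr r * Lq_int r \<Omega> w" by (metis Lq_int_scale)
  moreover have "\<bar>sqrt A\<bar> powr r = A powr (r / 2)" using A by (simp add: powr_half_sqrt[symmetric] powr_powr)
  ultimately show ?thesis by (simp add: A_def[symmetric] mult.commute mult_right_mono)
qed

section \<open>First variations of the power integrals and of the energy, with quadratic
  remainder\<close>

definition Mr :: "real \<Rightarrow> ('a \<Rightarrow> real) \<Rightarrow> ('a \<Rightarrow> real) \<Rightarrow> real" where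
  "Mr r u h = (\<integral>x. spow r (u x) * h x \<partial>M)"

lemma Mr_integrable:
  assumes "u \<in> H01 \<Omega>" "h \<in> H01 \<Omega>" "1 < r" "r \<le> q"
  shows "integrable M (\<lambda>x. spow r (u x) * h x)"
proof (rule Bochner_Integration.integrable_bound[of _ "\<lambda>x. \<bar>u x\<bar> powr r + \<bar>h x\<bar> powr r"])
  note [measurable] = H01_measurable[OF assms(1)] H01_measurable[OF assms(2)]
  show "integrable M (\<lambda>x. \<bar>u x\<bar> powr r + \<bar>h x\<bar> powr r)"
    using H01_integrable_powr assms by simp
  show "(\<lambda>x. spow r (u x) * h x) \<in> borel_measurable M" by measurable
  show "AE x in M. norm (spow r (u x) * h x) \<le> norm (\<bar>u x\<bar> powr r + \<bar>h x\<bar> powr r)"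
    using spow_mult_le[OF assms(3)] by (intro AE_I2) (simp add: abs_of_nonneg)
qed

lemma Mr_bound:
  assumes "u \<in> H01 \<Omega>" "h \<in> H01 \<Omega>" "1 < r" "r \<le> q"
  shows "\<bar>Mr r u h\<bar> \<le> Lq_int r \<Omega> u + Lq_int r \<Omega> h"
proof -
  have "\<bar>Mr r u h\<bar> \<le> (\<integral>x. \<bar>spow r (u x) * h x\<bar> \<partial>M)"
    unfolding Mr_def by (rule integral_abs_bound)
  also have "\<dots> \<le> (\<integral>x. \<bar>u x\<bar> powr r + \<bar>h x\<bar> powr r \<partial>M)"
    using assms by (intro integral_mono spow_mult_le integrable_abs Mr_integrable Bochner_Integration.integrable_add H01_integrable_powr) auto
  also have "\<dots> = Lq_int r \<Omega> u + Lq_int r \<Omega> h"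
    unfolding Lq_int_def using assms by (intro Bochner_Integration.integral_add H01_integrable_powr) auto
  finally show ?thesis .
qed

lemma Mr_self: "Mr r u u = Lq_int r \<Omega> u"
  by (simp add: Mr_def Lq_int_def spow_self)

lemma Mr_scale: "Mr r u (\<lambda>x. c * h x) = c * Mr r u h"
  by (simp add: Mr_def mult.left_commute)

lemma Lq_int_expansion:
  assumes u: "u \<in> H01 \<Omega>" and h: "h \<in> H01 \<Omega>" and r: "2 < r" "r \<le> q" and \<tau>: "0 < \<tau>" "\<tau> \<le> 1"
  shows "\<bar>Lq_int r \<Omega> (\<lambda>x. u x + \<tau> * h x) - Lq_int r \<Omega> u - \<tau> * r * Mr r u h\<bar>
    \<le> r * (r - 1) * 2 powr r * \<tau>\<^sup>2 * (Lq_int r \<Omega> u + Lq_int r \<Omega> h)"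
proof -
  have i: "integrable M (\<lambda>x. \<bar>u x + \<tau> * h x\<bar> powr r)" "integrable M (\<lambda>x. \<bar>u x\<bar> powr r)" "integrable M (\<lambda>x. \<bar>h x\<bar> powr r)"
      "integrable M (\<lambda>x. spow r (u x) * h x)"
    using r by (auto intro!: H01_integrable_powr[OF H01_lincomb[OF u h]] H01_integrable_powr[OF u] H01_integrable_powr[OF h] Mr_integrable[OF u h])
  have "\<bar>Lq_int r \<Omega> (\<lambda>x. u x + \<tau> * h x) - Lq_int r \<Omega> u - \<tau> * r * Mr r u h\<bar>
      = \<bar>\<integral>x. \<bar>u x + \<tau> * h x\<bar> powr r - \<bar>u x\<bar> powr r - \<tau> * r * (spow r (u x) * h x) \<partial>M\<bar>"
    unfolding Lq_int_def Mr_def using i by simp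
  also have "\<dots> \<le> (\<integral>x. \<bar>\<bar>u x + \<tau> * h x\<bar> powr r - \<bar>u x\<bar> powr r - \<tau> * r * (spow r (u x) * h x)\<bar> \<partial>M)"
    by (rule integral_abs_bound)
  also have "\<dots> \<le> (\<integral>x. r * (r - 1) * 2 powr r * \<tau>\<^sup>2 * (\<bar>u x\<bar> powr r + \<bar>h x\<bar> powr r) \<partial>M)"
    using i by (intro integral_mono abs_powr_expansion r \<tau>) auto
  also have "\<dots> = r * (r - 1) * 2 powr r * \<tau>\<^sup>2 * (Lq_int r \<Omega> u + Lq_int r \<Omega> h)"
    unfolding Lq_int_def using i by simp
  finally show ?thesis .
qed

lemma DF_scale_right:
  assumes "u \<in> H1 \<Omega>" "h \<in> H1 \<Omega>"
  shows "DF u (\<lambda>x. c * h x) = c * DF u h"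
proof -
  have ch: "(\<lambda>x. c * h x) \<in> H1 \<Omega>"
    using H1_lincomb(1)[OF TF_H1[OF test_function_zero] assms(2), of c] by simp
  show ?thesis
    using DF_lincomb[OF assms(1) ch, of 1] DF_lincomb[OF assms, of c] DF_scale[OF assms(2), of c] by simp
qed

text \<open>The coefficients \<open>(a / 2, b / 4, 1 / q, \<lambda> / p)\<close> give the energy and \<open>(a, b, 1, \<lambda>)\<close> its derivative
  in the direction of the argument.\<close>

definition quartic :: "real \<Rightarrow> real \<Rightarrow> real \<Rightarrow> real \<Rightarrow> real \<Rightarrow> ('a \<Rightarrow> real) \<Rightarrow> real" where
  "quartic p \<alpha> \<beta> c d v = \<alpha> * DE v + \<beta> * (DE v)\<^sup>2 - c * Lq_int q \<Omega> v - d * Lq_int p \<Omega> v"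

definition quartic_deriv :: "real \<Rightarrow> real \<Rightarrow> real \<Rightarrow> real \<Rightarrow> real \<Rightarrow> ('a \<Rightarrow> real) \<Rightarrow> ('a \<Rightarrow> real) \<Rightarrow> real" where
  "quartic_deriv p \<alpha> \<beta> c d u h = (2 * \<alpha> + 4 * \<beta> * DE u) * DF u h - c * q * Mr q u h - d * p * Mr p u h"

text \<open>The coefficient of \<tau>^2 in the remainder of the expansion at u in direction h,
  uniform over all u with Dirichlet integral at most T >= 1 and h with Dirichlet integral at most
  1.\<close>

definition quartic_rem :: "real \<Rightarrow> real \<Rightarrow> real \<Rightarrow> real \<Rightarrow> real \<Rightarrow> real \<Rightarrow> real" where
  "quartic_rem p \<alpha> \<beta> c d T = \<bar>\<alpha>\<bar> + \<bar>\<beta>\<bar> * (10 * T + 1)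
    + \<bar>c\<bar> * (q * (q - 1) * 2 powr q * (Kp * T powr (q / 2) + Kp))
    + \<bar>d\<bar> * (p * (p - 1) * 2 powr p * (Kp * T powr (p / 2) + Kp))"

lemma quartic_deriv_scale:
  assumes "u \<in> H01 \<Omega>" "h \<in> H01 \<Omega>"
  shows "quartic_deriv p \<alpha> \<beta> c d u (\<lambda>x. s * h x) = s * quartic_deriv p \<alpha> \<beta> c d u h"
  using DF_scale_right[OF H01_H1 H01_H1, OF assms, of s]
  by (simp add: quartic_deriv_def Mr_scale algebra_simps)

lemma Lq_int_expansion_bound:
  assumes u: "u \<in> H01 \<Omega>" and h: "h \<in> H01 \<Omega>" and r: "2 < r" "r \<le> q" and \<tau>: "0 < \<tau>" "\<tau> \<le> 1"
    and T: "DE u \<le> T" "DE h \<le> 1"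
  shows "\<bar>Lq_int r \<Omega> (\<lambda>x. u x + \<tau> * h x) - Lq_int r \<Omega> u - \<tau> * r * Mr r u h\<bar>
    \<le> \<tau>\<^sup>2 * (r * (r - 1) * 2 powr r * (Kp * T powr (r / 2) + Kp))"
proof -
  have "DE u powr (r / 2) \<le> T powr (r / 2)" "DE h powr (r / 2) \<le> 1"
    using T r powr_mono2[of "r / 2" "DE u" T] powr_mono2[of "r / 2" "DE h" 1] by simp_all
  then have "Kp * DE u powr (r / 2) \<le> Kp * T powr (r / 2)" "Kp * DE h powr (r / 2) \<le> Kp * 1"
    using Kp_nonneg by (intro mult_left_mono; simp)+
  then have "Lq_int r \<Omega> u + Lq_int r \<Omega> h \<le> Kp * T powr (r / 2) + Kp"
    using Lq_int_le[OF u, of r] Lq_int_le[OF h, of r] r by simp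
  then have "r * (r - 1) * 2 powr r * \<tau>\<^sup>2 * (Lq_int r \<Omega> u + Lq_int r \<Omega> h)
      \<le> r * (r - 1) * 2 powr r * \<tau>\<^sup>2 * (Kp * T powr (r / 2) + Kp)"
    using r by (intro mult_left_mono) auto
  then show ?thesis using Lq_int_expansion[OF u h r \<tau>] by (simp add: mult_ac)
qed

lemma quartic_expansion:
  assumes u: "u \<in> H01 \<Omega>" and h: "h \<in> H01 \<Omega>" and p: "2 < p" "p \<le> q" and \<tau>: "0 < \<tau>" "\<tau> \<le> 1"
    and T: "DE u \<le> T" "1 \<le> T" "DE h \<le> 1"
  shows "\<bar>quartic p \<alpha> \<beta> c d (\<lambda>x. u x + \<tau> * h x) - quartic p \<alpha> \<beta> c d u - \<tau> * quartic_deriv p \<alpha> \<beta> c d u h\<bar>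
    \<le> \<tau>\<^sup>2 * quartic_rem p \<alpha> \<beta> c d T"
proof -
  define A B H where "A = DE u" and "B = DF u h" and "H = DE h"
  have A: "0 \<le> A" "A \<le> T" and H: "0 \<le> H" "H \<le> 1" using T by (auto simp: A_def H_def)
  have "B\<^sup>2 \<le> A * H" unfolding A_def B_def H_def by (intro DF_cauchy_schwarz H01_H1 u h)
  also have "\<dots> \<le> T * 1" using A H T by (intro mult_mono) auto
  finally have B2: "B\<^sup>2 \<le> T" by simp
  have BT: "\<bar>B\<bar> \<le> T"
  proof -
    have "B\<^sup>2 \<le> T\<^sup>2" using B2 T(2) self_le_power[of T 2] by linarith
    then show ?thesis using T(2) by (metis abs_le_square_iff abs_of_nonneg order_trans zero_le_one)
  qed
  have D: "DE (\<lambda>x. u x + \<tau> * h x) = A + 2 * \<tau> * B + \<tau>\<^sup>2 * H"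
    using DF_lincomb[OF H01_H1[OF u] H01_H1[OF h]] by (simp add: A_def B_def H_def)
  \<comment> \<open>\<tau>^2 X is what remains of the squared Dirichlet integral (A + 2 \<tau> B +
    \<tau>^2 H)^2 after the terms of order 0 and 1 in \<tau>. Its four summands are at most 4 T, 2
    T, 4 T and 1 in absolute value.\<close>
  define X where "X = 4 * B\<^sup>2 + 2 * A * H + 4 * \<tau> * B * H + \<tau>\<^sup>2 * H\<^sup>2"
  have X: "\<bar>X\<bar> \<le> 10 * T + 1"
  proof -
    have "A * H \<le> T * 1" using A H T by (intro mult_mono) auto
    moreover have "\<bar>\<tau> * B * H\<bar> \<le> 1 * T * 1" unfolding abs_mult using BT H \<tau> by (intro mult_mono) auto
    moreover have "\<tau>\<^sup>2 * H\<^sup>2 \<le> 1 * 1" using H \<tau> by (intro mult_mono power_le_one) auto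
    moreover have "0 \<le> A * H" "0 \<le> \<tau>\<^sup>2 * H\<^sup>2" "0 \<le> B\<^sup>2" using A H by auto
    moreover have "X = 4 * B\<^sup>2 + 2 * (A * H) + 4 * (\<tau> * B * H) + \<tau>\<^sup>2 * H\<^sup>2" by (simp add: X_def)
    ultimately show ?thesis using B2 by linarith
  qed
  define Eq where "Eq = Lq_int q \<Omega> (\<lambda>x. u x + \<tau> * h x) - Lq_int q \<Omega> u - \<tau> * q * Mr q u h"
  define Ep where "Ep = Lq_int p \<Omega> (\<lambda>x. u x + \<tau> * h x) - Lq_int p \<Omega> u - \<tau> * p * Mr p u h"
  have Eq: "\<bar>Eq\<bar> \<le> \<tau>\<^sup>2 * (q * (q - 1) * 2 powr q * (Kp * T powr (q / 2) + Kp))"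
    unfolding Eq_def using q_bounds by (intro Lq_int_expansion_bound u h \<tau> T) auto
  have Ep: "\<bar>Ep\<bar> \<le> \<tau>\<^sup>2 * (p * (p - 1) * 2 powr p * (Kp * T powr (p / 2) + Kp))"
    unfolding Ep_def by (intro Lq_int_expansion_bound u h \<tau> T p)
  have "quartic p \<alpha> \<beta> c d (\<lambda>x. u x + \<tau> * h x) - quartic p \<alpha> \<beta> c d u - \<tau> * quartic_deriv p \<alpha> \<beta> c d u h
      = \<alpha> * (\<tau>\<^sup>2 * H) + \<beta> * (\<tau>\<^sup>2 * X) - c * Eq - d * Ep"
    unfolding quartic_def quartic_deriv_def D A_def[symmetric] B_def[symmetric] Eq_def Ep_def X_def
    by (simp add: power2_eq_square algebra_simps)
  also have "\<bar>\<dots>\<bar> \<le> \<bar>\<alpha> * (\<tau>\<^sup>2 * H)\<bar> + \<bar>\<beta> * (\<tau>\<^sup>2 * X)\<bar> + \<bar>c * Eq\<bar> + \<bar>d * Ep\<bar>"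
    by linarith
  also have "\<bar>\<alpha> * (\<tau>\<^sup>2 * H)\<bar> \<le> \<bar>\<alpha>\<bar> * (\<tau>\<^sup>2 * 1)"
    unfolding abs_mult using H by (intro mult_mono) auto
  also have "\<bar>\<beta> * (\<tau>\<^sup>2 * X)\<bar> \<le> \<bar>\<beta>\<bar> * (\<tau>\<^sup>2 * (10 * T + 1))"
    unfolding abs_mult using X by (intro mult_mono) auto
  also have "\<bar>c * Eq\<bar> \<le> \<bar>c\<bar> * (\<tau>\<^sup>2 * (q * (q - 1) * 2 powr q * (Kp * T powr (q / 2) + Kp)))"
    unfolding abs_mult using Eq by (intro mult_left_mono) auto
  also have "\<bar>d * Ep\<bar> \<le> \<bar>d\<bar> * (\<tau>\<^sup>2 * (p * (p - 1) * 2 powr p * (Kp * T powr (p / 2) + Kp)))"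
    unfolding abs_mult using Ep by (intro mult_left_mono) auto
  finally show ?thesis unfolding quartic_rem_def by (simp add: algebra_simps)
qed

lemma energy_eq:
  assumes "0 < p"
  shows "energy \<Omega> a b p lam u = quartic p (a / 2) (b / 4) (1 / q) (lam / p) u"
proof -
  have "H01_norm \<Omega> u ^ 4 = ((H01_norm \<Omega> u)\<^sup>2)\<^sup>2" by simp
  then show ?thesis using assms q_bounds
    by (simp add: energy_def quartic_def H01_norm_power2 Lq_norm_powr q_eq[symmetric])
qed

text \<open>Criticality bounds the increment of the energy by a small multiple of the norm, while
  \<open>quartic_expansion\<close> identifies its linear part, so the linear part vanishes. The
  expansion requires directions with Dirichlet integral at most 1; homogeneity removes this
  restriction.\<close>

lemma euler_lagrange:
  assumes sol: "kirchhoff_solution \<Omega> a b p lam u" and p: "2 < p" "p \<le> q"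
  shows "u \<in> H01 \<Omega>" "h \<in> H01 \<Omega> \<Longrightarrow> (a + b * DE u) * DF u h = Mr q u h + lam * Mr p u h"
proof -
  have p0: "0 < p" using p by simp
  show u: "u \<in> H01 \<Omega>" using sol by (simp add: kirchhoff_solution_def critical_point_H01_def)
  let ?E = "quartic p (a / 2) (b / 4) (1 / q) (lam / p)"
  let ?D = "quartic_deriv p (a / 2) (b / 4) (1 / q) (lam / p) u"
  have crit: "\<exists>\<delta>>0. \<forall>v\<in>H01 \<Omega>. H01_norm \<Omega> v < \<delta> \<longrightarrow> \<bar>?E (\<lambda>x. u x + v x) - ?E u\<bar> \<le> \<epsilon> * H01_norm \<Omega> v" if "\<epsilon> > 0" for \<epsilon>
    using sol that by (simp add: kirchhoff_solution_def critical_point_H01_def energy_eq[OF p0])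
  have small: "?D h = 0" if h: "h \<in> H01 \<Omega>" and h1: "DE h \<le> 1" for h
  proof (rule ccontr)
    assume "?D h \<noteq> 0"
    define D where "D = \<bar>?D h\<bar>"
    have D: "D > 0" using \<open>?D h \<noteq> 0\<close> by (simp add: D_def)
    define T where "T = 1 + DE u"
    have T: "DE u \<le> T" "1 \<le> T" by (auto simp: T_def)
    define R where "R = \<bar>quartic_rem p (a / 2) (b / 4) (1 / q) (lam / p) T\<bar>"
    obtain \<delta> where \<delta>: "\<delta> > 0" "\<And>v. v \<in> H01 \<Omega> \<Longrightarrow> H01_norm \<Omega> v < \<delta> \<Longrightarrow> \<bar>?E (\<lambda>x. u x + v x) - ?E u\<bar> \<le> D / 2 * H01_norm \<Omega> v"
      using crit[of "D / 2"] D by auto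
    \<comment> \<open>The bound \<delta> / 2 keeps \<tau> h inside the ball of radius \<delta>, and
      D / (4 (R + 1)) makes the remainder at most \<tau> D / 4. Together they give D <= D / 2 + D /
      4.\<close>
    define \<tau> where "\<tau> = min 1 (min (\<delta> / 2) (D / (4 * (R + 1))))"
    have R0: "R \<ge> 0" by (simp add: R_def)
    have \<tau>: "0 < \<tau>" "\<tau> \<le> 1" "\<tau> \<le> \<delta> / 2" "\<tau> \<le> D / (4 * (R + 1))"
    proof -
      show "0 < \<tau>" using \<delta>(1) D R0 by (simp add: \<tau>_def)
      show "\<tau> \<le> 1" "\<tau> \<le> \<delta> / 2" "\<tau> \<le> D / (4 * (R + 1))"
        unfolding \<tau>_def by (rule min.cobounded1 min.coboundedI2 order_refl | rule min.cobounded2)+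
    qed
    have nh: "H01_norm \<Omega> (\<lambda>x. \<tau> * h x) = \<tau> * sqrt (DE h)"
      using DF_scale[OF H01_H1[OF h], of \<tau>] \<tau> by (simp add: H01_norm_eq real_sqrt_mult)
    have sh: "sqrt (DE h) \<le> 1" using h1 by simp
    then have "\<tau> * sqrt (DE h) \<le> \<tau> * 1" using \<tau> by (intro mult_left_mono) auto
    then have n1: "H01_norm \<Omega> (\<lambda>x. \<tau> * h x) \<le> \<tau>" by (simp add: nh)
    then have n2: "H01_norm \<Omega> (\<lambda>x. \<tau> * h x) < \<delta>" using \<tau>(3) \<delta>(1) by linarith
    have "\<bar>?E (\<lambda>x. u x + \<tau> * h x) - ?E u\<bar> \<le> D / 2 * H01_norm \<Omega> (\<lambda>x. \<tau> * h x)"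
      by (rule \<delta>(2)[OF H01_scale[OF h] n2])
    also have "\<dots> \<le> D / 2 * \<tau>" using n1 D by (intro mult_left_mono) auto
    finally have 1: "\<bar>?E (\<lambda>x. u x + \<tau> * h x) - ?E u\<bar> \<le> D / 2 * \<tau>" .
    have 2: "\<bar>?E (\<lambda>x. u x + \<tau> * h x) - ?E u - \<tau> * ?D h\<bar> \<le> \<tau>\<^sup>2 * R"
      using quartic_expansion[OF u h p \<tau>(1,2) T h1, of "a / 2" "b / 4" "1 / q" "lam / p"]
        mult_left_mono[OF abs_ge_self zero_le_power2, of \<tau> "quartic_rem p (a / 2) (b / 4) (1 / q) (lam / p) T"]
      unfolding R_def by linarith
    have "\<tau> * D = \<bar>\<tau> * ?D h\<bar>" using \<tau> by (simp add: D_def abs_mult)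
    also have "\<dots> \<le> D / 2 * \<tau> + \<tau>\<^sup>2 * R" using 1 2 by linarith
    finally have "\<tau> * D \<le> \<tau> * (D / 2 + \<tau> * R)" by (simp add: power2_eq_square algebra_simps)
    then have "D \<le> D / 2 + \<tau> * R" using \<tau>(1) by simp
    moreover have "\<tau> * R \<le> D / (4 * (R + 1)) * (R + 1)" using \<tau> R0 by (intro mult_mono) auto
    moreover have "D / (4 * r) * r = D / 4" if "r > 0" for r using that by simp
    from this[of "R + 1"] have "D / (4 * (R + 1)) * (R + 1) = D / 4" using R0 by simp
    ultimately show False using D by linarith
  qed
  assume h: "h \<in> H01 \<Omega>"
  \<comment> \<open>Adding 1 in the denominator normalises h even when its Dirichlet integral is
    0.\<close>
  define s where "s = 1 / (1 + sqrt (DE h))"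
  have s: "s > 0" by (simp add: s_def add_pos_nonneg)
  have "DE (\<lambda>x. s * h x) \<le> 1"
  proof -
    have "s * sqrt (DE h) \<le> 1" by (simp add: s_def add_pos_nonneg field_simps)
    moreover have "0 \<le> s * sqrt (DE h)" using s by simp
    ultimately have "(s * sqrt (DE h))\<^sup>2 \<le> 1" by (simp add: power_le_one)
    then show ?thesis using DF_scale[OF H01_H1[OF h], of s] by (simp add: power_mult_distrib)
  qed
  then have "s * ?D h = 0" using small[OF H01_scale[OF h, of s]] quartic_deriv_scale[OF u h] by simp
  then show "(a + b * DE u) * DF u h = Mr q u h + lam * Mr p u h"
    using s p q_bounds by (simp add: quartic_deriv_def)
qed

lemma nehari:
  assumes "kirchhoff_solution \<Omega> a b p lam u" "2 < p" "p \<le> q"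
  shows "quartic p a b 1 lam u = 0"
  using euler_lagrange(2)[OF assms euler_lagrange(1)[OF assms]]
  by (simp add: Mr_self quartic_def algebra_simps power2_eq_square)

end

section \<open>Coercivity and the extremal parameter\<close>

locale kirchhoff = sobolev_domain \<Omega> q for \<Omega> :: "'a::euclidean_space set" and q :: real +
  fixes a b p :: real
  assumes a: "a > 0" and b: "b > 0" and p: "2 < p" "p < q"
    and strict: "a powr ((real DIM('a) - 4) / 2) * b > C2 \<Omega>"
    and nontriv: "H01_nonzero \<Omega> \<noteq> {}"
begin

abbreviation "A \<equiv> DE"
abbreviation "Pq \<equiv> Lq_int q \<Omega>"
abbreviation "Pp \<equiv> Lq_int p \<Omega>"
abbreviation "S \<equiv> S_const \<Omega>"
abbreviation "H0 \<equiv> H01_nonzero \<Omega>"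

lemma H0D:
  assumes "u \<in> H0"
  shows "u \<in> H01 \<Omega>" "A u > 0" "Pq u > 0" "Pp u > 0"
proof -
  show u: "u \<in> H01 \<Omega>" using assms by (simp add: H01_nonzero_def)
  have nz: "\<not> zero_on \<Omega> u" using assms by (simp add: H01_nonzero_def)
  show "A u > 0" using nz DF_zero_imp[OF u] by (metis dirichlet_nonneg order_less_le)
  show "Pq u > 0" using nz zero_on_iff[OF u, of q] q_bounds Lq_int_nonneg[of q \<Omega> u] by (simp add: order_less_le)
  show "Pp u > 0" using nz zero_on_iff[OF u, of p] p Lq_int_nonneg[of p \<Omega> u] by (simp add: order_less_le)
qed

lemma H01_not_H0:
  assumes "u \<in> H01 \<Omega>" "u \<notin> H0"
  shows "Pq u = 0" "Pp u = 0"
proof -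
  have "zero_on \<Omega> u" using assms by (simp add: H01_nonzero_def)
  then show "Pq u = 0" "Pp u = 0"
    using zero_on_iff[OF assms(1), of q] zero_on_iff[OF assms(1), of p] q_bounds p by auto
qed

lemma sobolev_quotient: "(H01_norm \<Omega> u)\<^sup>2 / (Lq_norm (crit_exp DIM('a)) \<Omega> u)\<^sup>2 = A u / Pq u powr (2 / q)"
proof -
  have "(Lq_norm (crit_exp DIM('a)) \<Omega> u)\<^sup>2 = (Pq u powr (1 / q)) powr 2"
    by (simp add: Lq_norm_def Lq_int_def q_eq)
  also have "\<dots> = Pq u powr (2 / q)" by (simp add: powr_powr)
  finally show ?thesis by (simp add: H01_norm_power2)
qed

text \<open>The Sobolev constant gives a positive lower bound for all quotients; the set of
  quotients is nonempty by \<open>nontriv\<close>.\<close>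

lemma S_pos: "S > 0"
proof -
  have qp: "q > 0" using q_bounds by simp
  have Ks: "Ks > 0" unfolding Ks_def using qp by simp
  have "Ks powr (- (2 / q)) \<le> S"
    unfolding S_const_def
  proof (rule cINF_greatest[OF nontriv])
    fix u assume u: "u \<in> H0"
    have "Pq u powr (2 / q) \<le> (Ks * A u powr (q / 2)) powr (2 / q)"
      using sobolev_H01(2)[OF H0D(1)[OF u]] qp by (intro powr_mono2) auto
    also have "\<dots> = Ks powr (2 / q) * A u"
      using H0D(2)[OF u] qp by (simp add: powr_mult powr_powr)
    finally have le: "Pq u powr (2 / q) \<le> Ks powr (2 / q) * A u" .
    have "Ks powr (- (2 / q)) * Pq u powr (2 / q) \<le> Ks powr (- (2 / q)) * (Ks powr (2 / q) * A u)"
      using le by (intro mult_left_mono) auto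
    also have "\<dots> = A u" using Ks by (simp add: powr_minus)
    finally show "Ks powr (- (2 / q)) \<le> (H01_norm \<Omega> u)\<^sup>2 / (Lq_norm (crit_exp DIM('a)) \<Omega> u)\<^sup>2"
      unfolding sobolev_quotient using H0D(3)[OF u] by (simp add: pos_le_divide_eq)
  qed
  moreover have "Ks powr (- (2 / q)) > 0" using Ks by simp
  ultimately show ?thesis by linarith
qed

lemma Pq_le_S:
  assumes u: "u \<in> H01 \<Omega>"
  shows "Pq u \<le> S powr (- (q / 2)) * A u powr (q / 2)"
proof (cases "u \<in> H0")
  case True
  have qp: "q > 0" using q_bounds by simp
  have "S \<le> (H01_norm \<Omega> u)\<^sup>2 / (Lq_norm (crit_exp DIM('a)) \<Omega> u)\<^sup>2"
    unfolding S_const_def by (rule cINF_lower[OF _ True]) (auto intro!: bdd_belowI2[of _ 0])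
  then have "S * Pq u powr (2 / q) \<le> A u"
    unfolding sobolev_quotient using H0D(3)[OF True] by (simp add: pos_le_divide_eq)
  then have "(S * Pq u powr (2 / q)) powr (q / 2) \<le> A u powr (q / 2)"
    using S_pos qp by (intro powr_mono2) auto
  then have "S powr (q / 2) * Pq u \<le> A u powr (q / 2)"
    using H0D(3)[OF True] qp by (simp add: powr_mult powr_powr)
  moreover have "S powr (q / 2) > 0" using S_pos by simp
  ultimately show ?thesis by (simp add: powr_minus field_simps)
next
  case False
  then show ?thesis using H01_not_H0[OF u] by simp
qed

text \<open>Weighted Young inequality: \<Lambda> is the best constant in \<Lambda> t^(q/2) <= a t +
  b t^2, and t = A u bounds the critical integral. The hypothesis \<open>strict\<close> says
  precisely that \<Lambda> exceeds the constant S^(-q/2) of the Sobolev inequality, which explains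
  the form of \<open>C2\<close>.\<close>

lemma coercive: obtains \<theta> where "\<theta> < 1" "\<And>u. u \<in> H01 \<Omega> \<Longrightarrow> Pq u \<le> \<theta> * (a * A u + b * (A u)\<^sup>2)"
proof -
  define N where "N = real DIM('a)"
  have N: "N > 4" using dim by (simp add: N_def)
  have q: "q = 2 * N / (N - 2)" by (simp add: q_eq crit_exp_def N_def)
  \<comment> \<open>The weight is determined by \<theta> + 2 (1 - \<theta>) = q / 2, so that the
    geometric mean of t and t^2 is t^(q/2).\<close>
  define \<theta> where "\<theta> = (N - 4) / (N - 2)"
  have \<theta>: "0 < \<theta>" "\<theta> < 1" using N by (auto simp: \<theta>_def)
  have \<theta>': "1 - \<theta> = 2 / (N - 2)" using N by (simp add: \<theta>_def field_simps)
  define \<Lambda> where "\<Lambda> = (a / \<theta>) powr \<theta> * (b / (1 - \<theta>)) powr (1 - \<theta>)"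
  have \<Lambda>0: "\<Lambda> > 0" using a b \<theta> by (simp add: \<Lambda>_def)
  have young: "\<Lambda> * t powr (q / 2) \<le> a * t + b * t\<^sup>2" if "t \<ge> 0" for t
  proof (cases "t = 0")
    case False
    then have t: "t > 0" using that by simp
    have "(a * t / \<theta>) powr \<theta> * (b * t\<^sup>2 / (1 - \<theta>)) powr (1 - \<theta>) \<le> \<theta> * (a * t / \<theta>) + (1 - \<theta>) * (b * t\<^sup>2 / (1 - \<theta>))"
      using a b t \<theta> by (intro Youngs_inequality_0) auto
    also have "\<dots> = a * t + b * t\<^sup>2" using \<theta> by simp
    finally have y: "(a * t / \<theta>) powr \<theta> * (b * t\<^sup>2 / (1 - \<theta>)) powr (1 - \<theta>) \<le> a * t + b * t\<^sup>2" .
    have e: "a * t / \<theta> = (a / \<theta>) * t" "b * t\<^sup>2 / (1 - \<theta>) = (b / (1 - \<theta>)) * t\<^sup>2" by simp_all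
    have "(t\<^sup>2) powr (1 - \<theta>) = (t powr 2) powr (1 - \<theta>)" using t by simp
    also have "\<dots> = t powr (2 * (1 - \<theta>))" by (rule powr_powr)
    finally have t2: "t powr \<theta> * (t\<^sup>2) powr (1 - \<theta>) = t powr (\<theta> + 2 * (1 - \<theta>))"
      by (simp only: powr_add)
    have "\<theta> + 2 * (1 - \<theta>) = 1 + (1 - \<theta>)" by simp
    also have "\<dots> = q / 2" unfolding \<theta>' using N by (simp add: q field_simps)
    finally have ex: "\<theta> + 2 * (1 - \<theta>) = q / 2" .
    have "(a * t / \<theta>) powr \<theta> * (b * t\<^sup>2 / (1 - \<theta>)) powr (1 - \<theta>) = \<Lambda> * (t powr \<theta> * (t\<^sup>2) powr (1 - \<theta>))"
      unfolding e \<Lambda>_def powr_mult by (simp only: mult_ac)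
    then show ?thesis using y unfolding t2 ex by simp
  qed simp
  have "S powr (- (q / 2)) < \<Lambda>"
  proof -
    \<comment> \<open>Raising to the power k turns 1 - \<theta> into 1 and q / 2 into N / 2, the
      exponents of b and of S in the hypothesis on \<open>C2\<close>.\<close>
    define k where "k = (N - 2) / 2"
    have k: "k > 0" using N by (simp add: k_def)
    have k1: "\<theta> * k = (N - 4) / 2" "(1 - \<theta>) * k = 1" "q / 2 * k = N / 2"
      using N unfolding \<theta>' by (auto simp: \<theta>_def k_def q divide_simps)
    have "(S powr (- (q / 2))) powr k = S powr (- (N / 2))"
      by (simp only: powr_powr minus_mult_left[symmetric] k1(3))
    also have "\<dots> < \<Lambda> powr k"
    proof -
      have L: "\<Lambda> powr k = (a / \<theta>) powr ((N - 4) / 2) * (b / (1 - \<theta>))"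
        unfolding \<Lambda>_def powr_mult powr_powr k1 using b \<theta> by simp
      have p1: "(a / \<theta>) powr ((N - 4) / 2) = a powr ((N - 4) / 2) * ((N - 2) powr ((N - 4) / 2) / (N - 4) powr ((N - 4) / 2))"
        using a N by (simp add: \<theta>_def powr_divide powr_mult)
      have p2: "b / (1 - \<theta>) = b * (N - 2) / 2" using N by (simp add: \<theta>')
      have p3: "(N - 2) powr ((N - 4) / 2) * (N - 2) = (N - 2) powr ((N - 2) / 2)"
      proof -
        have "(N - 2) powr ((N - 4) / 2) * (N - 2) powr 1 = (N - 2) powr ((N - 4) / 2 + 1)"
          by (rule powr_add[symmetric])
        moreover have "(N - 4) / 2 + 1 = (N - 2) / 2" by (simp add: field_simps)
        ultimately show ?thesis using N by simp
      qed
      define c where "c = (N - 2) powr ((N - 2) / 2) / (2 * (N - 4) powr ((N - 4) / 2))"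
      have c: "c > 0" using N by (simp add: c_def)
      have L2: "\<Lambda> powr k = c * (a powr ((N - 4) / 2) * b)"
        unfolding L p1 p2 c_def p3[symmetric] by (simp add: mult_ac)
      have "C2 \<Omega> = 2 * (N - 4) powr ((N - 4) / 2) / ((N - 2) powr ((N - 2) / 2) * S powr (N / 2))"
        by (simp add: C2_def Let_def N_def)
      then have "c * C2 \<Omega> = S powr (- (N / 2))"
        using N S_pos by (simp add: c_def powr_minus field_simps)
      moreover have "c * C2 \<Omega> < c * (a powr ((N - 4) / 2) * b)"
        using strict c by (simp add: N_def)
      ultimately show ?thesis using L2 by simp
    qed
    finally show ?thesis using k \<Lambda>0 by (metis powr_less_cancel2 powr_gt_zero powr_ge_zero order_less_le S_pos)
  qed
  then have "S powr (- (q / 2)) / \<Lambda> < 1" using \<Lambda>0 by simp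
  moreover have "Pq u \<le> S powr (- (q / 2)) / \<Lambda> * (a * A u + b * (A u)\<^sup>2)" if u: "u \<in> H01 \<Omega>" for u
  proof -
    have "Pq u \<le> S powr (- (q / 2)) / \<Lambda> * (\<Lambda> * A u powr (q / 2))"
      using Pq_le_S[OF u] \<Lambda>0 by simp
    also have "\<dots> \<le> S powr (- (q / 2)) / \<Lambda> * (a * A u + b * (A u)\<^sup>2)"
      using young[of "A u"] \<Lambda>0 by (intro mult_left_mono) auto
    finally show ?thesis .
  qed
  ultimately show ?thesis using that by blast
qed

definition \<kappa> :: real where
  "\<kappa> = (SOME k. k > 0 \<and> (\<forall>u\<in>H01 \<Omega>. k * (a * A u + b * (A u)\<^sup>2) \<le> a * A u + b * (A u)\<^sup>2 - Pq u))"

lemma \<kappa>: "\<kappa> > 0" "u \<in> H01 \<Omega> \<Longrightarrow> \<kappa> * (a * A u + b * (A u)\<^sup>2) \<le> a * A u + b * (A u)\<^sup>2 - Pq u"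
proof -
  obtain \<theta> where \<theta>: "\<theta> < 1" "\<And>u. u \<in> H01 \<Omega> \<Longrightarrow> Pq u \<le> \<theta> * (a * A u + b * (A u)\<^sup>2)"
    using coercive by blast
  have "\<exists>k. k > 0 \<and> (\<forall>u\<in>H01 \<Omega>. k * (a * A u + b * (A u)\<^sup>2) \<le> a * A u + b * (A u)\<^sup>2 - Pq u)"
    using \<theta> by (intro exI[of _ "1 - \<theta>"]) (auto simp: left_diff_distrib)
  from someI_ex[OF this]
  show "\<kappa> > 0" "u \<in> H01 \<Omega> \<Longrightarrow> \<kappa> * (a * A u + b * (A u)\<^sup>2) \<le> a * A u + b * (A u)\<^sup>2 - Pq u"
    unfolding \<kappa>_def by blast+
qed

text \<open>For u nonzero this is the only parameter at which u satisfies the Nehari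
  identity.\<close>

definition lam0 :: "('a \<Rightarrow> real) \<Rightarrow> real" where
  "lam0 u = (a * A u + b * (A u)\<^sup>2 - Pq u) / Pp u"

definition c0 :: real where "c0 = \<kappa> * min a b / Kp"

lemma Kp_pos: "Kp > 0"
proof -
  obtain u where u: "u \<in> H0" using nontriv by blast
  have "0 < Kp * A u powr (p / 2)"
    using Lq_int_le[OF H0D(1)[OF u], of p] H0D(4)[OF u] p by linarith
  then show ?thesis using Kp_nonneg by (simp add: zero_less_mult_iff)
qed

lemma c0_pos: "c0 > 0"
  using \<kappa>(1) a b Kp_pos by (simp add: c0_def)

text \<open>Since 1 <= p / 2 <= 2, the power A^(p/2) in the subcritical embedding is at most A +
  A^2, which coercivity bounds by the numerator of \<open>lam0\<close>.\<close>

lemma lam0_lower: assumes u: "u \<in> H0" shows "c0 \<le> lam0 u"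
proof -
  note uH = H0D(1)[OF u] and pos = H0D(2-4)[OF u]
  have "A u powr (p / 2) \<le> A u + (A u)\<^sup>2"
  proof (cases "A u \<le> 1")
    case True
    then have "A u powr (p / 2) \<le> A u powr 1" using pos p by (intro powr_mono') auto
    then show ?thesis using pos by (simp add: add_increasing2)
  next
    case False
    then have "A u powr (p / 2) \<le> A u powr 2" using p q_bounds by (intro powr_mono) auto
    then show ?thesis using pos by simp
  qed
  then have "Kp * A u powr (p / 2) \<le> Kp * (A u + (A u)\<^sup>2)" using Kp_pos by simp
  then have P: "Pp u \<le> Kp * (A u + (A u)\<^sup>2)" using Lq_int_le[OF uH, of p] p by linarith
  have "min a b * (A u + (A u)\<^sup>2) \<le> a * A u + b * (A u)\<^sup>2"
    unfolding distrib_left using pos by (intro add_mono mult_right_mono) auto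
  then have "\<kappa> * (min a b * (A u + (A u)\<^sup>2)) \<le> \<kappa> * (a * A u + b * (A u)\<^sup>2)"
    using \<kappa>(1) by (intro mult_left_mono) auto
  also have "\<dots> \<le> a * A u + b * (A u)\<^sup>2 - Pq u" by (rule \<kappa>(2)[OF uH])
  finally have 1: "\<kappa> * (min a b * (A u + (A u)\<^sup>2)) \<le> a * A u + b * (A u)\<^sup>2 - Pq u" .
  have "c0 * Pp u \<le> c0 * (Kp * (A u + (A u)\<^sup>2))" using P c0_pos by simp
  also have "\<dots> = \<kappa> * (min a b * (A u + (A u)\<^sup>2))" using Kp_pos by (simp add: c0_def)
  finally show ?thesis using 1 pos by (simp add: lam0_def pos_le_divide_eq)
qed

section \<open>The extremal parameter as the minimum of \<open>lam0\<close> along a ray\<close>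

lemma H0_scale: "u \<in> H0 \<Longrightarrow> t > 0 \<Longrightarrow> (\<lambda>x. t * u x) \<in> H0"
  using H01_scale[of u t] by (auto simp: H01_nonzero_def zero_on_def)

lemma lam0_scale:
  assumes u: "u \<in> H0" and t: "t > 0"
  shows "lam0 (\<lambda>x. t * u x) = (a * A u * t\<^sup>2 + b * (A u)\<^sup>2 * t ^ 4 - Pq u * t powr q) / (Pp u * t powr p)"
proof -
  have "(t\<^sup>2 * A u)\<^sup>2 = (A u)\<^sup>2 * t ^ 4" by (simp add: power_mult_distrib)
  then show ?thesis using t DF_scale[OF H01_H1[OF H0D(1)[OF u]], of t]
    by (simp add: lam0_def Lq_int_scale mult_ac)
qed

lemma fibering_eq:
  assumes u: "u \<in> H01 \<Omega>"
  shows "fibering \<Omega> a b p lam u t = a / 2 * A u * t\<^sup>2 + b / 4 * (A u)\<^sup>2 * t ^ 4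
    - 1 / q * Pq u * \<bar>t\<bar> powr q - lam / p * Pp u * \<bar>t\<bar> powr p"
proof -
  have "(t\<^sup>2 * A u)\<^sup>2 = (A u)\<^sup>2 * t ^ 4" by (simp add: power_mult_distrib)
  then show ?thesis using p DF_scale[OF H01_H1[OF u], of t]
    by (simp add: fibering_def energy_eq quartic_def Lq_int_scale mult_ac)
qed

definition \<psi> :: "real \<Rightarrow> ('a \<Rightarrow> real) \<Rightarrow> real \<Rightarrow> real" where
  "\<psi> lam u t = a * A u * t + b * (A u)\<^sup>2 * t ^ 3 - Pq u * t powr (q - 1) - lam * Pp u * t powr (p - 1)"

lemma deriv_fibering:
  assumes u: "u \<in> H01 \<Omega>" and t: "t > 0"
  shows "deriv (fibering \<Omega> a b p lam u) t = \<psi> lam u t"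
proof (rule DERIV_imp_deriv)
  have "((\<lambda>t. a / 2 * A u * t\<^sup>2 + b / 4 * (A u)\<^sup>2 * t ^ 4 - 1 / q * Pq u * \<bar>t\<bar> powr q - lam / p * Pp u * \<bar>t\<bar> powr p)
    has_real_derivative a / 2 * A u * (2 * t) + b / 4 * (A u)\<^sup>2 * (4 * t ^ 3)
      - 1 / q * Pq u * (q * (sgn t * \<bar>t\<bar> powr (q - 1))) - lam / p * Pp u * (p * (sgn t * \<bar>t\<bar> powr (p - 1)))) (at t)"
    by (intro DERIV_diff DERIV_add DERIV_cmult DERIV_abs_powr) (use p q_bounds in \<open>auto intro!: derivative_eq_intros\<close>)
  then show "(fibering \<Omega> a b p lam u has_real_derivative \<psi> lam u t) (at t)"
    unfolding fibering_eq[OF u, abs_def] using t p q_bounds by (simp add: \<psi>_def mult.assoc)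
qed

text \<open>Up to a positive factor the derivative of the fibering map is the gap between
  \<open>lam0\<close> at t u and the parameter. Conditions on the fibering map thus become
  conditions on \<open>lam0\<close> along the ray.\<close>

lemma \<psi>_lam0:
  assumes u: "u \<in> H0" and t: "t > 0"
  shows "\<psi> lam u t = Pp u * t powr (p - 1) * (lam0 (\<lambda>x. t * u x) - lam)"
proof -
  have D: "Pp u > 0" by (rule H0D(4)[OF u])
  have pw: "t powr p = t powr (p - 1) * t" "t powr q = t powr (q - 1) * t"
    using powr_mult_base[of t "p - 1"] powr_mult_base[of t "q - 1"] t by (simp_all add: mult.commute)
  have "Pp u * t powr (p - 1) * lam0 (\<lambda>x. t * u x)
      = (a * A u * t\<^sup>2 + b * (A u)\<^sup>2 * t ^ 4 - Pq u * t powr q) / t"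
    unfolding lam0_scale[OF u t] pw(1) using D t by simp
  also have "\<dots> = a * A u * t + b * (A u)\<^sup>2 * t ^ 3 - Pq u * t powr (q - 1)"
    unfolding pw(2) using t by (simp add: field_simps power2_eq_square power3_eq_cube power4_eq_xxxx)
  finally show ?thesis by (simp add: \<psi>_def right_diff_distrib mult_ac)
qed

text \<open>Coercivity for t u, keeping only the quadratic or only the quartic term. Because 2 < p <
  4 the first bound blows up as t tends to 0 and the second as t tends to infinity.\<close>

lemma lam0_scale_lower:
  assumes u: "u \<in> H0" and t: "t > 0"
  shows "\<kappa> * a * A u / Pp u * t powr (2 - p) \<le> lam0 (\<lambda>x. t * u x)"
    and "\<kappa> * b * (A u)\<^sup>2 / Pp u * t powr (4 - p) \<le> lam0 (\<lambda>x. t * u x)"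
proof -
  note pos = H0D(2-4)[OF u]
  have D: "Pp u * t powr p > 0" using pos t by simp
  have e: "A (\<lambda>x. t * u x) = t\<^sup>2 * A u" "(t\<^sup>2 * A u)\<^sup>2 = (A u)\<^sup>2 * t ^ 4"
    using DF_scale[OF H01_H1[OF H0D(1)[OF u]], of t] by (auto simp: power_mult_distrib)
  have k: "\<kappa> * (a * A u * t\<^sup>2 + b * (A u)\<^sup>2 * t ^ 4) \<le> a * A u * t\<^sup>2 + b * (A u)\<^sup>2 * t ^ 4 - Pq u * t powr q"
    using \<kappa>(2)[OF H01_scale[OF H0D(1)[OF u], of t]] t unfolding e Lq_int_scale by (simp add: mult_ac)
  have n: "0 \<le> \<kappa> * (a * A u * t\<^sup>2)" "0 \<le> \<kappa> * (b * (A u)\<^sup>2 * t ^ 4)"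
    using \<kappa>(1) a b pos t by auto
  have "\<kappa> * a * A u / Pp u * t powr (2 - p) = \<kappa> * (a * A u * t\<^sup>2) / (Pp u * t powr p)"
    using t by (simp add: powr_diff)
  also have "\<dots> \<le> lam0 (\<lambda>x. t * u x)"
    unfolding lam0_scale[OF u t] using k n D by (intro divide_right_mono) (auto simp: distrib_left)
  finally show "\<kappa> * a * A u / Pp u * t powr (2 - p) \<le> lam0 (\<lambda>x. t * u x)" .
  have "t powr 4 = t ^ 4" using t by simp
  then have "\<kappa> * b * (A u)\<^sup>2 / Pp u * t powr (4 - p) = \<kappa> * (b * (A u)\<^sup>2 * t ^ 4) / (Pp u * t powr p)"
    using t by (simp add: powr_diff)
  also have "\<dots> \<le> lam0 (\<lambda>x. t * u x)"
    unfolding lam0_scale[OF u t] using k n D by (intro divide_right_mono) (auto simp: distrib_left)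
  finally show "\<kappa> * b * (A u)\<^sup>2 / Pp u * t powr (4 - p) \<le> lam0 (\<lambda>x. t * u x)" .
qed

lemma lam0_ray_far:
  assumes u: "u \<in> H0" and V: "V > 0"
  obtains \<delta> L where "0 < \<delta>" "\<delta> \<le> 1" "1 \<le> L" "\<And>t. 0 < t \<Longrightarrow> t \<le> \<delta> \<Longrightarrow> V \<le> lam0 (\<lambda>x. t * u x)"
    "\<And>t. L \<le> t \<Longrightarrow> V \<le> lam0 (\<lambda>x. t * u x)"
proof -
  note pos = H0D(2-4)[OF u]
  define c1 c2 where "c1 = \<kappa> * a * A u / Pp u" and "c2 = \<kappa> * b * (A u)\<^sup>2 / Pp u"
  have c: "c1 > 0" "c2 > 0" using \<kappa>(1) a b pos by (auto simp: c1_def c2_def)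
  define \<delta> where "\<delta> = min 1 ((V / c1) powr (1 / (2 - p)))"
  define L where "L = max 1 ((V / c2) powr (1 / (4 - p)))"
  have p4: "4 - p > 0" using p q_bounds by simp
  have "V \<le> lam0 (\<lambda>x. t * u x)" if t: "0 < t" "t \<le> \<delta>" for t
  proof -
    have "t \<le> (V / c1) powr (1 / (2 - p))" using t by (simp add: \<delta>_def)
    then have "((V / c1) powr (1 / (2 - p))) powr (2 - p) \<le> t powr (2 - p)"
      using t p by (intro powr_mono2') auto
    then have "V / c1 \<le> t powr (2 - p)" using p V c by (simp add: powr_powr)
    then have "V \<le> c1 * t powr (2 - p)" using c by (simp add: field_simps)
    also have "\<dots> \<le> lam0 (\<lambda>x. t * u x)" unfolding c1_def by (rule lam0_scale_lower(1)[OF u t(1)])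
    finally show ?thesis .
  qed
  moreover have "V \<le> lam0 (\<lambda>x. t * u x)" if t: "L \<le> t" for t
  proof -
    have t0: "t > 0" using t by (simp add: L_def)
    have "(V / c2) powr (1 / (4 - p)) \<le> t" using t by (simp add: L_def)
    then have "((V / c2) powr (1 / (4 - p))) powr (4 - p) \<le> t powr (4 - p)"
      using p4 by (intro powr_mono2) auto
    then have "V / c2 \<le> t powr (4 - p)" using p4 V c by (simp add: powr_powr)
    then have "V \<le> c2 * t powr (4 - p)" using c by (simp add: field_simps)
    also have "\<dots> \<le> lam0 (\<lambda>x. t * u x)" unfolding c2_def by (rule lam0_scale_lower(2)[OF u t0])
    finally show ?thesis .
  qed
  moreover have "0 < \<delta>" "\<delta> \<le> 1" "1 \<le> L" using V c by (auto simp: \<delta>_def L_def)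
  ultimately show ?thesis using that by blast
qed

lemma lam0_ray_min:
  assumes u: "u \<in> H0"
  obtains t0 where "t0 > 0" "\<And>t. t > 0 \<Longrightarrow> lam0 (\<lambda>x. t0 * u x) \<le> lam0 (\<lambda>x. t * u x)"
proof -
  note pos = H0D(2-4)[OF u]
  \<comment> \<open>V is the value at t = 1, which lies in the compact interval from \<delta> to L.
    Outside the interval all values are at least V, so the minimum over the interval is
    global.\<close>
  define V where "V = lam0 u"
  have V: "V > 0" using lam0_lower[OF u] c0_pos by (simp add: V_def)
  obtain \<delta> L where dL: "0 < \<delta>" "\<delta> \<le> 1" "1 \<le> L" "\<And>t. 0 < t \<Longrightarrow> t \<le> \<delta> \<Longrightarrow> V \<le> lam0 (\<lambda>x. t * u x)"
    "\<And>t. L \<le> t \<Longrightarrow> V \<le> lam0 (\<lambda>x. t * u x)" using lam0_ray_far[OF u V] by blast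
  have "continuous_on {\<delta>..L} (\<lambda>t. (a * A u * t\<^sup>2 + b * (A u)\<^sup>2 * t ^ 4 - Pq u * t powr q) / (Pp u * t powr p))"
    using dL(1) pos by (intro continuous_intros) auto
  then have cont: "continuous_on {\<delta>..L} (\<lambda>t. lam0 (\<lambda>x. t * u x))"
    by (rule continuous_on_eq) (use dL(1) lam0_scale[OF u] in auto)
  obtain t0 where t0: "t0 \<in> {\<delta>..L}" "\<And>t. t \<in> {\<delta>..L} \<Longrightarrow> lam0 (\<lambda>x. t0 * u x) \<le> lam0 (\<lambda>x. t * u x)"
    using continuous_attains_inf[OF _ _ cont] dL by fastforce
  have 1: "lam0 (\<lambda>x. t0 * u x) \<le> V" using t0(2)[of 1] dL by (simp add: V_def)
  have "lam0 (\<lambda>x. t0 * u x) \<le> lam0 (\<lambda>x. t * u x)" if t: "t > 0" for t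
  proof -
    consider "t \<le> \<delta>" | "L \<le> t" | "t \<in> {\<delta>..L}" by fastforce
    then show ?thesis
    proof cases
      case 1 then show ?thesis using dL(4)[OF t] \<open>lam0 (\<lambda>x. t0 * u x) \<le> V\<close> by linarith
    next
      case 2 then show ?thesis using dL(5)[of t] \<open>lam0 (\<lambda>x. t0 * u x) \<le> V\<close> by linarith
    next
      case 3 then show ?thesis by (rule t0(2))
    qed
  qed
  moreover have "t0 > 0" using t0(1) dL(1) by simp
  ultimately show ?thesis using that by blast
qed

text \<open>At the minimal value l of \<open>lam0\<close>, the function \<psi> is nonnegative with a
  zero at \<open>t0\<close>, which gives all three conditions. Conversely, an admissible parameter
  makes \<psi> nonnegative with a zero, so it lies below \<open>lam0\<close> on the whole ray and
  equals it somewhere.\<close>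

lemma extremal_param_min:
  assumes u: "u \<in> H0" and t0: "t0 > 0" "\<And>t. t > 0 \<Longrightarrow> lam0 (\<lambda>x. t0 * u x) \<le> lam0 (\<lambda>x. t * u x)"
  shows "extremal_param \<Omega> a b p u = lam0 (\<lambda>x. t0 * u x)"
  unfolding extremal_param_def
proof (rule the_equality)
  note uH = H0D(1)[OF u] and pos = H0D(2-4)[OF u]
  let ?F = "\<lambda>lam. fibering \<Omega> a b p lam u"
  define l where "l = lam0 (\<lambda>x. t0 * u x)"
  have INF_eq: "(INF s\<in>{0<..}. deriv (?F lam) s) = (INF s\<in>{0<..}. \<psi> lam u s)" for lam
    by (intro INF_cong refl) (simp add: deriv_fibering[OF uH])
  have pf: "Pp u * t powr (p - 1) > 0" if "t > 0" for t using pos that by simp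
  have nn: "\<psi> l u t \<ge> 0" if "t > 0" for t
    unfolding \<psi>_lam0[OF u that] l_def using pf[OF that] t0(2)[OF that] by simp
  have z: "\<psi> l u t0 = 0" unfolding \<psi>_lam0[OF u t0(1)] l_def by simp
  have inf0: "(INF s\<in>{0<..}. \<psi> l u s) = 0"
  proof (rule antisym)
    show "(INF s\<in>{0<..}. \<psi> l u s) \<le> 0"
      unfolding z[symmetric] by (rule cINF_lower) (use t0(1) nn in \<open>auto intro!: bdd_belowI2[of _ 0] simp: z\<close>)
    show "0 \<le> (INF s\<in>{0<..}. \<psi> l u s)" by (rule cINF_greatest) (use nn in auto)
  qed
  have dd: "deriv (deriv (?F l)) t0 = 0"
  proof -
    define D where "D = a * A u + b * (A u)\<^sup>2 * (3 * t0\<^sup>2) - Pq u * ((q - 1) * t0 powr (q - 2)) - l * Pp u * ((p - 1) * t0 powr (p - 2))"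
    have D: "(\<psi> l u has_real_derivative D) (at t0)"
      unfolding \<psi>_def D_def using t0(1) by (auto intro!: derivative_eq_intros simp: algebra_simps)
    have "D = 0"
    proof (rule DERIV_local_min[OF D t0(1)], intro allI impI)
      fix y assume "\<bar>t0 - y\<bar> < t0"
      then have "y > 0" by linarith
      then show "\<psi> l u t0 \<le> \<psi> l u y" using nn z by simp
    qed
    then have "(\<psi> l u has_real_derivative 0) (at t0)" using D by simp
    then have "(deriv (?F l) has_real_derivative 0) (at t0)"
      by (rule has_field_derivative_transform_within_open[OF _ open_greaterThan[of 0]])
        (use t0(1) deriv_fibering[OF uH] in auto)
    then show ?thesis by (rule DERIV_imp_deriv)
  qed
  have l0: "l > 0" using lam0_lower[OF H0_scale[OF u t0(1)]] c0_pos by (simp add: l_def)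
  show "0 < lam0 (\<lambda>x. t0 * u x) \<and> (\<exists>t>0. deriv (?F (lam0 (\<lambda>x. t0 * u x))) t = 0
      \<and> deriv (deriv (?F (lam0 (\<lambda>x. t0 * u x)))) t = 0
      \<and> deriv (?F (lam0 (\<lambda>x. t0 * u x))) t = (INF s\<in>{0<..}. deriv (?F (lam0 (\<lambda>x. t0 * u x))) s))"
    unfolding l_def[symmetric] INF_eq inf0
    using l0 t0(1) dd z by (intro conjI exI[of _ t0]) (simp_all add: deriv_fibering[OF uH])
  fix lam
  assume asm: "0 < lam \<and> (\<exists>t>0. deriv (?F lam) t = 0 \<and> deriv (deriv (?F lam)) t = 0
      \<and> deriv (?F lam) t = (INF s\<in>{0<..}. deriv (?F lam) s))"
  then obtain t where t: "t > 0" "deriv (?F lam) t = 0" "deriv (?F lam) t = (INF s\<in>{0<..}. \<psi> lam u s)"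
    and lam: "lam > 0" unfolding INF_eq by blast
  have zt: "\<psi> lam u t = 0" using t by (simp add: deriv_fibering[OF uH])
  then have eq: "lam0 (\<lambda>x. t * u x) = lam" using \<psi>_lam0[OF u t(1), of lam] pf[OF t(1)] by auto
  obtain \<delta> L where L0: "0 < \<delta>" "\<delta> \<le> 1" "1 \<le> L" "\<And>t. 0 < t \<Longrightarrow> t \<le> \<delta> \<Longrightarrow> lam \<le> lam0 (\<lambda>x. t * u x)"
    "\<And>t. L \<le> t \<Longrightarrow> lam \<le> lam0 (\<lambda>x. t * u x)" using lam0_ray_far[OF u lam] by blast
  note L = L0(3,5)
  \<comment> \<open>The real infimum is a lower bound only for a set bounded below. Beyond L the
    function \<psi> is nonnegative, and before L only the subtracted term, at most its value at L,
    can make it negative.\<close>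
  have "bdd_below (\<psi> lam u ` {0<..})"
  proof (rule bdd_belowI2)
    fix s :: real assume "s \<in> {0<..}"
    then have s: "s > 0" by simp
    show "- (Pp u * L powr (p - 1) * lam) \<le> \<psi> lam u s"
    proof (cases "L \<le> s")
      case True
      then have "0 \<le> \<psi> lam u s" unfolding \<psi>_lam0[OF u s] using pf[OF s] L(2) by simp
      moreover have "0 \<le> Pp u * L powr (p - 1) * lam" using lam by simp
      ultimately show ?thesis by linarith
    next
      case False
      have "s powr (p - 1) \<le> L powr (p - 1)" using False s p by (intro powr_mono2) auto
      then have "Pp u * s powr (p - 1) * lam \<le> Pp u * L powr (p - 1) * lam"
        using pos lam by (intro mult_right_mono mult_left_mono) auto
      moreover have "0 \<le> Pp u * s powr (p - 1) * lam0 (\<lambda>x. s * u x)"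
        using pf[OF s] lam0_lower[OF H0_scale[OF u s]] c0_pos by (intro mult_nonneg_nonneg) auto
      ultimately show ?thesis unfolding \<psi>_lam0[OF u s] by (simp add: right_diff_distrib)
    qed
  qed
  then have "(INF s\<in>{0<..}. \<psi> lam u s) \<le> \<psi> lam u t0"
    by (rule cINF_lower) (use t0(1) in simp)
  then have "0 \<le> \<psi> lam u t0" using t by simp
  then have "lam \<le> l" unfolding \<psi>_lam0[OF u t0(1)] l_def using pf[OF t0(1)] by (simp add: zero_le_mult_iff)
  moreover have "l \<le> lam" using t0(2)[OF t(1)] eq by (simp add: l_def)
  ultimately show "lam = lam0 (\<lambda>x. t0 * u x)" by (simp add: l_def)
qed

lemma extremal_param_bounds:
  assumes u: "u \<in> H0"
  shows "c0 \<le> extremal_param \<Omega> a b p u" "extremal_param \<Omega> a b p u \<le> lam0 u"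
proof -
  obtain t0 where t0: "t0 > 0" "\<And>t. t > 0 \<Longrightarrow> lam0 (\<lambda>x. t0 * u x) \<le> lam0 (\<lambda>x. t * u x)"
    using lam0_ray_min[OF u] by blast
  have "extremal_param \<Omega> a b p u = lam0 (\<lambda>x. t0 * u x)" by (rule extremal_param_min[OF u t0])
  then show "c0 \<le> extremal_param \<Omega> a b p u" "extremal_param \<Omega> a b p u \<le> lam0 u"
    using lam0_lower[OF H0_scale[OF u t0(1)]] t0(2)[of 1] by auto
qed

abbreviation "lstar \<equiv> lambda_star \<Omega> a b p"

lemma lstar_pos: "lstar > 0"
proof -
  have "c0 \<le> lstar"
    unfolding lambda_star_def by (rule cINF_greatest[OF nontriv extremal_param_bounds(1)])
  then show ?thesis using c0_pos by simp
qed

lemma quartic_lstar_nonneg: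
  assumes "u \<in> H01 \<Omega>"
  shows "quartic p a b 1 lstar u \<ge> 0"
proof (cases "u \<in> H0")
  case True
  have "lstar \<le> extremal_param \<Omega> a b p u"
    unfolding lambda_star_def
    by (rule cINF_lower[OF _ True]) (use extremal_param_bounds(1) in \<open>auto intro!: bdd_belowI2[of _ c0]\<close>)
  then have "lstar \<le> lam0 u" using extremal_param_bounds(2)[OF True] by simp
  then show ?thesis using H0D(4)[OF True] by (simp add: lam0_def quartic_def pos_le_divide_eq)
next
  case False
  then show ?thesis using H01_not_H0[OF assms False] a b by (simp add: quartic_def)
qed

end

section \<open>Near-critical functions concentrate on finitely many values\<close>

lemma abs_powr_sum_le:
  fixes s t r :: real
  assumes "r > 0"
  shows "\<bar>s + t\<bar> powr r \<le> 2 powr r * (\<bar>s\<bar> powr r + \<bar>t\<bar> powr r)"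
proof -
  define m where "m = max \<bar>s\<bar> \<bar>t\<bar>"
  have m: "m \<ge> 0" "\<bar>s + t\<bar> \<le> 2 * m" "m = \<bar>s\<bar> \<or> m = \<bar>t\<bar>" by (auto simp: m_def)
  have "\<bar>s + t\<bar> powr r \<le> (2 * m) powr r" using m assms by (intro powr_mono2) auto
  also have "\<dots> = 2 powr r * m powr r" by (rule powr_mult)
  also have "\<dots> \<le> 2 powr r * (\<bar>s\<bar> powr r + \<bar>t\<bar> powr r)"
    using m(3) powr_ge_zero[of "\<bar>s\<bar>" r] powr_ge_zero[of "\<bar>t\<bar>" r] by (intro mult_left_mono) fastforce+
  finally show ?thesis .
qed

text \<open>If \<open>s0\<close> is the positive zero of \<open>s \<mapsto> x * spow q s - y * spow p s\<close>, then this function has the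
  sign of \<open>cutoff s0\<close>, which grows only linearly, so that testing with \<open>cutoff s0 (u x)\<close> is possible.\<close>

definition cutoff :: "real \<Rightarrow> real \<Rightarrow> real" where
  "cutoff s0 s = s * ((s\<^sup>2 - s0\<^sup>2) / (1 + s\<^sup>2))"

definition cutoff' :: "real \<Rightarrow> real \<Rightarrow> real" where
  "cutoff' s0 s = 1 - (1 + s0\<^sup>2) * (1 - s\<^sup>2) / (1 + s\<^sup>2)\<^sup>2"

lemma one_plus_square_pos: "1 + s\<^sup>2 > (0::real)"
  by (simp add: add_pos_nonneg)

lemma DERIV_cutoff: "(cutoff s0 has_real_derivative cutoff' s0 s) (at s)"
proof -
  have n: "1 + s\<^sup>2 \<noteq> 0" using one_plus_square_pos[of s] by simp
  \<comment> \<open>Splitting off the linear part leaves a multiple of s / (1 + s^2), whose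
    derivative is bounded.\<close>
  have e: "cutoff s0 = (\<lambda>s. s - (1 + s0\<^sup>2) * (s / (1 + s\<^sup>2)))"
  proof
    fix s :: real
    have "1 + s\<^sup>2 \<noteq> 0" using one_plus_square_pos[of s] by simp
    then show "cutoff s0 s = s - (1 + s0\<^sup>2) * (s / (1 + s\<^sup>2))"
      by (simp add: cutoff_def field_simps power2_eq_square)
  qed
  have "((\<lambda>s. s / (1 + s\<^sup>2)) has_real_derivative (1 * (1 + s\<^sup>2) - s * (2 * s)) / ((1 + s\<^sup>2) * (1 + s\<^sup>2))) (at s)"
    using n by (auto intro!: derivative_eq_intros)
  from DERIV_diff[OF DERIV_ident DERIV_cmult[OF this, of "1 + s0\<^sup>2"]]
  show ?thesis unfolding e cutoff'_def by (simp add: power2_eq_square algebra_simps)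
qed

lemma abs_cutoff'_le: "\<bar>cutoff' s0 s\<bar> \<le> 2 + s0\<^sup>2"
proof -
  have pos: "(1 + s\<^sup>2)\<^sup>2 > 0" using one_plus_square_pos[of s] by simp
  have "\<bar>1 - s\<^sup>2\<bar> \<le> 1 + s\<^sup>2" by (simp add: abs_le_iff)
  also have "\<dots> \<le> (1 + s\<^sup>2)\<^sup>2" by (rule self_le_power) auto
  finally have *: "\<bar>1 - s\<^sup>2\<bar> \<le> (1 + s\<^sup>2)\<^sup>2" .
  define r where "r = (1 - s\<^sup>2) / (1 + s\<^sup>2)\<^sup>2"
  have "\<bar>r\<bar> \<le> 1" using pos * by (simp add: r_def abs_divide)
  then have "(1 + s0\<^sup>2) * \<bar>r\<bar> \<le> (1 + s0\<^sup>2) * 1" by (intro mult_left_mono) auto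
  then have "\<bar>(1 + s0\<^sup>2) * r\<bar> \<le> 1 + s0\<^sup>2" by (simp add: abs_mult)
  moreover have "cutoff' s0 s = 1 - (1 + s0\<^sup>2) * r" by (simp add: cutoff'_def r_def)
  ultimately show ?thesis by linarith
qed

lemma cutoff_lipschitz: "\<bar>cutoff s0 s - cutoff s0 t\<bar> \<le> (2 + s0\<^sup>2) * \<bar>s - t\<bar>"
  using field_differentiable_bound[of UNIV "cutoff s0" "cutoff' s0" "2 + s0\<^sup>2" s t] abs_cutoff'_le DERIV_cutoff
  by simp

lemma cutoff_0 [simp]: "cutoff s0 0 = 0" by (simp add: cutoff_def)

lemma abs_cutoff_le: "\<bar>cutoff s0 s\<bar> \<le> (2 + s0\<^sup>2) * \<bar>s\<bar>"
  using cutoff_lipschitz[of s0 s 0] by simp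

lemma continuous_on_cutoff [continuous_intros]: "continuous_on B f \<Longrightarrow> continuous_on B (\<lambda>x. cutoff s0 (f x))"
  unfolding cutoff_def using one_plus_square_pos by (intro continuous_intros) (auto simp: less_imp_neq[symmetric])

text \<open>This is the purpose of the rational form of \<open>cutoff\<close>: its denominator has
  no zeros, so composition preserves smoothness, and it vanishes at 0, so the support stays compact
  in the domain.\<close>

lemma cutoff_test_function:
  assumes "\<phi> \<in> test_functions \<Omega>"
  shows "(\<lambda>x. cutoff s0 (\<phi> x)) \<in> test_functions \<Omega>"
proof -
  note c = test_functionsD(1)[OF assms]
  have "Ck k (\<lambda>x. (\<phi> x * \<phi> x + (- s0\<^sup>2)) * inverse (1 + \<phi> x * \<phi> x))" for k
    using one_plus_square_pos
    by (intro Ck_mult Ck_add Ck_inverse Ck_const c) (auto simp: power2_eq_square less_imp_neq[symmetric])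
  from test_function_mult_smooth[OF assms this]
  show ?thesis by (simp add: cutoff_def power2_eq_square divide_inverse)
qed

text \<open>The integrand that results from testing the limiting equation with
  \<open>cutoff s0\<close> of the function itself. It acts as a potential with three wells, at 0 and
  at the two points +-s0.\<close>

definition pot :: "real \<Rightarrow> real \<Rightarrow> real \<Rightarrow> real \<Rightarrow> real \<Rightarrow> real \<Rightarrow> real" where
  "pot x y p q s0 s = (x * spow q s - y * spow p s) * cutoff s0 s"

lemma pot_eq:
  assumes "s0 > 0" "y = x * s0 powr (q - p)"
  shows "pot x y p q s0 s = x * \<bar>s\<bar> powr p * (\<bar>s\<bar> powr (q - p) - s0 powr (q - p)) * ((s\<^sup>2 - s0\<^sup>2) / (1 + s\<^sup>2))"
proof -
  have "pot x y p q s0 s = (x * (spow q s * s) - y * (spow p s * s)) * ((s\<^sup>2 - s0\<^sup>2) / (1 + s\<^sup>2))"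
    by (simp add: pot_def cutoff_def algebra_simps)
  also have "x * (spow q s * s) - y * (spow p s * s) = x * \<bar>s\<bar> powr p * (\<bar>s\<bar> powr (q - p) - s0 powr (q - p))"
  proof -
    have "\<bar>s\<bar> powr q = \<bar>s\<bar> powr p * \<bar>s\<bar> powr (q - p)" by (simp flip: powr_add)
    then show ?thesis unfolding spow_self assms(2) by (simp add: algebra_simps)
  qed
  finally show ?thesis .
qed

text \<open>The differences |s|^(q-p) - s0^(q-p) and s^2 - s0^2 have the same sign, both being
  increasing in |s|.\<close>

lemma pot_nonneg_pos:
  assumes "s0 > 0" "y = x * s0 powr (q - p)" "x > 0" "p < q"
  shows "pot x y p q s0 s \<ge> 0" "s \<noteq> 0 \<Longrightarrow> \<bar>s\<bar> \<noteq> s0 \<Longrightarrow> pot x y p q s0 s > 0"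
proof -
  have sq: "s\<^sup>2 - s0\<^sup>2 = (\<bar>s\<bar> - s0) * (\<bar>s\<bar> + s0)" by (simp add: power2_eq_square algebra_simps)
  have d: "1 + s\<^sup>2 > 0" by (rule one_plus_square_pos)
  define Q where "Q = (\<bar>s\<bar> powr (q - p) - s0 powr (q - p)) * ((s\<^sup>2 - s0\<^sup>2) / (1 + s\<^sup>2))"
  have e: "pot x y p q s0 s = x * \<bar>s\<bar> powr p * Q"
    unfolding pot_eq[OF assms(1,2)] Q_def by (simp only: mult.assoc)
  have pow: "x * \<bar>s\<bar> powr p \<ge> 0" "s \<noteq> 0 \<Longrightarrow> x * \<bar>s\<bar> powr p > 0" using assms(3) by auto
  consider "\<bar>s\<bar> < s0" | "\<bar>s\<bar> = s0" | "\<bar>s\<bar> > s0" by linarith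
  then have main: "pot x y p q s0 s \<ge> 0 \<and> (s \<noteq> 0 \<longrightarrow> \<bar>s\<bar> \<noteq> s0 \<longrightarrow> pot x y p q s0 s > 0)"
  proof cases
    case 1
    then have "\<bar>s\<bar> powr (q - p) < s0 powr (q - p)" using assms by (intro powr_less_mono2) auto
    moreover have "(s\<^sup>2 - s0\<^sup>2) / (1 + s\<^sup>2) < 0" unfolding sq using 1 assms d by (simp add: divide_neg_pos mult_neg_pos)
    ultimately have "Q > 0" unfolding Q_def
      by (intro mult_neg_neg) auto
    then show ?thesis unfolding e using pow by (simp add: mult_nonneg_nonneg)
  next
    case 2
    then show ?thesis unfolding e Q_def by simp
  next
    case 3
    then have "s0 powr (q - p) < \<bar>s\<bar> powr (q - p)" using assms by (intro powr_less_mono2) auto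
    moreover have "(s\<^sup>2 - s0\<^sup>2) / (1 + s\<^sup>2) > 0" unfolding sq using 3 assms d by simp
    ultimately have "Q > 0" unfolding Q_def
      by (intro mult_pos_pos) auto
    then show ?thesis unfolding e using pow by (simp add: mult_nonneg_nonneg)
  qed
  then show "pot x y p q s0 s \<ge> 0" "s \<noteq> 0 \<Longrightarrow> \<bar>s\<bar> \<noteq> s0 \<Longrightarrow> pot x y p q s0 s > 0" by auto
qed

lemma continuous_on_spow: "r > 1 \<Longrightarrow> continuous_on UNIV (spow r)"
  unfolding spow_def by (intro continuous_on_sgn_abs_powr continuous_on_id) simp

lemma continuous_on_pot: "p > 1 \<Longrightarrow> q > 1 \<Longrightarrow> continuous_on UNIV (pot x y p q s0)"
  unfolding pot_def by (intro continuous_intros continuous_on_spow)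

text \<open>With this derivative, the gradient of W(v) has length at most sqrt(F(v)) |grad v|, ready
  for Cauchy-Schwarz. The minimum with 1 keeps the integrand bounded under approximation. W is
  nondecreasing, and strictly increasing near 0, so it stays away from 0 outside each neighbourhood
  of 0.\<close>

lemma primitive_sqrt:
  fixes F :: "real \<Rightarrow> real"
  assumes F: "continuous_on UNIV F" "\<And>s. F s \<ge> 0" "s0 > 0" "\<And>s. s \<noteq> 0 \<Longrightarrow> \<bar>s\<bar> \<noteq> s0 \<Longrightarrow> F s > 0"
  obtains W where "W 0 = 0" "\<And>s. (W has_real_derivative sqrt (min 1 (F s))) (at s)"
    "\<And>\<delta>. \<delta> > 0 \<Longrightarrow> \<exists>w>0. \<forall>s. \<delta> \<le> \<bar>s\<bar> \<longrightarrow> w \<le> \<bar>W s\<bar>"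
proof -
  define \<omega> where "\<omega> s = sqrt (min 1 (F s))" for s
  have c: "continuous_on UNIV \<omega>" unfolding \<omega>_def using F(1) by (intro continuous_intros)
  obtain W0 where "\<forall>s. (W0 has_vector_derivative \<omega> s) (at s)"
    using einterval_antiderivative[of "-\<infinity>" "\<infinity>" \<omega>] c by (auto simp: continuous_on_eq_continuous_at)
  then have W0: "(W0 has_real_derivative \<omega> s) (at s)" for s
    by (simp add: has_real_derivative_iff_has_vector_derivative)
  define W where "W s = W0 s - W0 0" for s
  have W: "(W has_real_derivative \<omega> s) (at s)" for s
    unfolding W_def using DERIV_diff[OF W0[of s] DERIV_const[of "W0 0"]] by simp
  have \<omega>0: "\<omega> s \<ge> 0" for s using F(2) by (simp add: \<omega>_def)
  have mono: "W s \<le> W t" if "s \<le> t" for s t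
    by (rule DERIV_nonneg_imp_nondecreasing[OF that]) (use W \<omega>0 in blast)
  have strict: "W s < W t" if st: "s < t" "\<And>r. s < r \<Longrightarrow> r < t \<Longrightarrow> \<omega> r > 0" for s t
  proof -
    obtain r where r: "s < r" "r < t" "W t - W s = (t - s) * \<omega> r"
      using MVT2[OF st(1), of W \<omega>] W by auto
    have "(t - s) * \<omega> r > 0" using r st by simp
    then show ?thesis using r(3) by linarith
  qed
  have \<omega>pos: "\<omega> r > 0" if "r \<noteq> 0" "\<bar>r\<bar> < s0" for r
    using F(4)[of r] that by (auto simp: \<omega>_def)
  have "\<exists>w>0. \<forall>s. \<delta> \<le> \<bar>s\<bar> \<longrightarrow> w \<le> \<bar>W s\<bar>" if \<delta>: "\<delta> > 0" for \<delta>
  proof -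
    \<comment> \<open>Positivity of the derivative is used only between 0 and the wells +-s0;
      further out monotonicity suffices.\<close>
    define c where "c = min \<delta> s0"
    have c: "c > 0" "c \<le> \<delta>" "c \<le> s0" using \<delta> F(3) by (auto simp: c_def)
    have p: "W 0 < W c" by (rule strict) (use c \<omega>pos in auto)
    have n: "W (- c) < W 0" by (rule strict) (use c \<omega>pos in auto)
    have "W 0 = 0" by (simp add: W_def)
    define w where "w = min (W c) (- W (- c))"
    have "w > 0" using p n \<open>W 0 = 0\<close> by (simp add: w_def)
    moreover have "w \<le> \<bar>W s\<bar>" if "\<delta> \<le> \<bar>s\<bar>" for s
    proof (cases "s \<ge> 0")
      case True
      then have "W c \<le> W s" using that c by (intro mono) auto
      then show ?thesis by (simp add: w_def)
    next
      case False
      then have "W s \<le> W (- c)" using that c by (intro mono) auto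
      then show ?thesis by (simp add: w_def)
    qed
    ultimately show ?thesis by blast
  qed
  then show ?thesis using that[of W] W by (simp add: W_def \<omega>_def)
qed

section \<open>Testing the near-critical equation, and passing from approximants back to the
  sequence\<close>

context sobolev_domain
begin

text \<open>Young's inequality with a small weight \<sigma> on the fixed function takes the place of
  Hoelder's inequality: the first part is small by the choice of \<sigma>, the second by convergence
  of w k.\<close>

lemma spow_integral_tendsto_0:
  assumes u: "u \<in> H01 \<Omega>" and w: "\<And>k::nat. w k \<in> H01 \<Omega>" and r: "1 < r" "r \<le> q"
    and lim: "(\<lambda>k. Lq_int r \<Omega> (w k)) \<longlonglongrightarrow> 0"
  shows "(\<lambda>k. \<integral>x. \<bar>spow r (u x)\<bar> * \<bar>w k x\<bar> \<partial>M) \<longlonglongrightarrow> 0"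
proof (rule LIMSEQ_I)
  fix e :: real assume e: "e > 0"
  define P where "P = Lq_int r \<Omega> u"
  have P: "P \<ge> 0" by (simp add: P_def)
  define \<sigma> where "\<sigma> = e / (2 * (P + 1))"
  have \<sigma>: "\<sigma> > 0" using e P by (simp add: \<sigma>_def)
  have \<sigma>P: "\<sigma> * P < e / 2"
  proof -
    have "\<sigma> * P < \<sigma> * (P + 1)" using \<sigma> by simp
    moreover have "e / (2 * r) * r = e / 2" if "r > 0" for r :: real using that by simp
    from this[of "P + 1"] have "\<sigma> * (P + 1) = e / 2" using P unfolding \<sigma>_def by simp
    ultimately show ?thesis by simp
  qed
  \<comment> \<open>This comes from \<open>spow_mult_le\<close> with w / \<sigma> in place of w,
    multiplied by \<sigma>.\<close>
  define c where "c = \<sigma> * (1 / \<sigma>) powr r"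
  have le: "(\<integral>x. \<bar>spow r (u x)\<bar> * \<bar>w k x\<bar> \<partial>M) \<le> \<sigma> * P + c * Lq_int r \<Omega> (w k)" for k
  proof -
    have i: "integrable M (\<lambda>x. \<bar>u x\<bar> powr r)" "integrable M (\<lambda>x. \<bar>w k x\<bar> powr r)"
      using r by (auto intro!: H01_integrable_powr u w)
    have "(\<integral>x. \<bar>spow r (u x)\<bar> * \<bar>w k x\<bar> \<partial>M) \<le> (\<integral>x. \<sigma> * \<bar>u x\<bar> powr r + c * \<bar>w k x\<bar> powr r \<partial>M)"
    proof (rule integral_mono)
      show "integrable M (\<lambda>x. \<bar>spow r (u x)\<bar> * \<bar>w k x\<bar>)"
        using integrable_abs[OF Mr_integrable[OF u w r, of k]] by (simp add: abs_mult)
      show "integrable M (\<lambda>x. \<sigma> * \<bar>u x\<bar> powr r + c * \<bar>w k x\<bar> powr r)" using i by simp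
      fix x
      have "\<bar>spow r (u x)\<bar> * \<bar>w k x\<bar> = \<sigma> * \<bar>spow r (u x) * ((1 / \<sigma>) * w k x)\<bar>"
        using \<sigma> by (simp add: abs_mult)
      also have "\<dots> \<le> \<sigma> * (\<bar>u x\<bar> powr r + \<bar>(1 / \<sigma>) * w k x\<bar> powr r)"
        using \<sigma> by (intro mult_left_mono spow_mult_le r) auto
      also have "\<bar>(1 / \<sigma>) * w k x\<bar> powr r = (1 / \<sigma>) powr r * \<bar>w k x\<bar> powr r"
        using \<sigma> unfolding abs_mult powr_mult by simp
      finally show "\<bar>spow r (u x)\<bar> * \<bar>w k x\<bar> \<le> \<sigma> * \<bar>u x\<bar> powr r + c * \<bar>w k x\<bar> powr r"
        by (simp add: c_def algebra_simps)
    qed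
    also have "\<dots> = \<sigma> * P + c * Lq_int r \<Omega> (w k)" using i by (simp add: P_def Lq_int_def)
    finally show ?thesis .
  qed
  have "(\<lambda>k. c * Lq_int r \<Omega> (w k)) \<longlonglongrightarrow> c * 0" by (intro tendsto_intros lim)
  then have "\<forall>\<^sub>F k in sequentially. c * Lq_int r \<Omega> (w k) < e / 2"
    using e by (intro order_tendstoD(2)) auto
  then obtain k0 where k0: "\<And>k. k \<ge> k0 \<Longrightarrow> c * Lq_int r \<Omega> (w k) < e / 2"
    by (auto simp: eventually_sequentially)
  have "norm ((\<integral>x. \<bar>spow r (u x)\<bar> * \<bar>w k x\<bar> \<partial>M) - 0) < e" if "k \<ge> k0" for k
  proof -
    have "0 \<le> (\<integral>x. \<bar>spow r (u x)\<bar> * \<bar>w k x\<bar> \<partial>M)" by (rule integral_nonneg_AE) simp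
    then show ?thesis using le[of k] k0[OF that] \<sigma>P by simp
  qed
  then show "\<exists>k0. \<forall>k\<ge>k0. norm ((\<integral>x. \<bar>spow r (u x)\<bar> * \<bar>w k x\<bar> \<partial>M) - 0) < e" by blast
qed

lemma Lq_int_approx:
  assumes u: "u \<in> H01 \<Omega>" and \<phi>: "\<And>n::nat. \<phi> n \<in> TF" and lim: "(\<lambda>n. DE (\<lambda>x. u x - \<phi> n x)) \<longlonglongrightarrow> 0"
    and r: "0 < r" "r \<le> q"
  shows "(\<lambda>x. u x - \<phi> n x) \<in> H01 \<Omega>" "(\<lambda>n. Lq_int r \<Omega> (\<lambda>x. u x - \<phi> n x)) \<longlonglongrightarrow> 0"
proof -
  show w: "(\<lambda>x. u x - \<phi> n x) \<in> H01 \<Omega>" for n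
    using H01_lincomb[OF u TF_H01[OF \<phi>[of n]], of "-1"] by simp
  show "(\<lambda>n. Lq_int r \<Omega> (\<lambda>x. u x - \<phi> n x)) \<longlonglongrightarrow> 0"
  proof (rule tendsto_sandwich[OF _ _ tendsto_const])
    show "\<forall>\<^sub>F n in sequentially. Lq_int r \<Omega> (\<lambda>x. u x - \<phi> n x) \<le> Kp * DE (\<lambda>x. u x - \<phi> n x) powr (r / 2)"
      by (intro always_eventually allI Lq_int_le w r)
    have "(\<lambda>n. Kp * DE (\<lambda>x. u x - \<phi> n x) powr (r / 2)) \<longlonglongrightarrow> Kp * 0 powr (r / 2)"
      using r by (intro tendsto_mult tendsto_const tendsto_powr'[OF lim]) auto
    then show "(\<lambda>n. Kp * DE (\<lambda>x. u x - \<phi> n x) powr (r / 2)) \<longlonglongrightarrow> 0" by simp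
  qed simp
qed

lemma DF_cutoff:
  assumes \<phi>: "\<phi> \<in> TF"
  shows "DE (\<lambda>x. cutoff s0 (\<phi> x)) \<le> (2 + s0\<^sup>2)\<^sup>2 * DE \<phi>"
proof -
  have i: "integrable M (\<lambda>x. (norm (grad \<phi> x))\<^sup>2)" using TF_L2(2)[OF \<phi>] by (simp add: L2_space_def)
  have g: "(norm (grad (\<lambda>x. cutoff s0 (\<phi> x)) x))\<^sup>2 \<le> (2 + s0\<^sup>2)\<^sup>2 * (norm (grad \<phi> x))\<^sup>2" for x
  proof -
    have "norm (grad (\<lambda>x. cutoff s0 (\<phi> x)) x) = \<bar>cutoff' s0 (\<phi> x)\<bar> * norm (grad \<phi> x)"
      by (simp add: grad_compose[OF \<phi> DERIV_cutoff])
    also have "\<dots> \<le> (2 + s0\<^sup>2) * norm (grad \<phi> x)"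
      by (intro mult_right_mono abs_cutoff'_le) auto
    finally show ?thesis unfolding power_mult_distrib[symmetric] by (intro power_mono) auto
  qed
  have "(\<integral>x. (norm (grad (\<lambda>x. cutoff s0 (\<phi> x)) x))\<^sup>2 \<partial>M) \<le> (\<integral>x. (2 + s0\<^sup>2)\<^sup>2 * (norm (grad \<phi> x))\<^sup>2 \<partial>M)"
    using TF_L2(2)[OF cutoff_test_function[OF \<phi>, of s0]] i
    by (intro integral_mono g) (simp_all add: L2_space_def)
  then show ?thesis by (simp add: DF_TF[OF cutoff_test_function[OF \<phi>]] DF_TF[OF \<phi>])
qed

lemma spow_cutoff_integrable:
  assumes u: "u \<in> H01 \<Omega>" and r: "1 < r" "r \<le> q"
  shows "integrable M (\<lambda>x. spow r (u x) * cutoff s0 (u x))"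
proof (rule Bochner_Integration.integrable_bound[of _ "\<lambda>x. (2 + s0\<^sup>2) * \<bar>u x\<bar> powr r"])
  note [measurable] = H01_measurable[OF u]
  show "integrable M (\<lambda>x. (2 + s0\<^sup>2) * \<bar>u x\<bar> powr r)" using H01_integrable_powr[OF u] r by simp
  show "(\<lambda>x. spow r (u x) * cutoff s0 (u x)) \<in> borel_measurable M" unfolding cutoff_def by measurable
  show "AE x in M. norm (spow r (u x) * cutoff s0 (u x)) \<le> norm ((2 + s0\<^sup>2) * \<bar>u x\<bar> powr r)"
  proof (intro AE_I2)
    fix x
    have "norm (spow r (u x) * cutoff s0 (u x)) \<le> \<bar>spow r (u x)\<bar> * ((2 + s0\<^sup>2) * \<bar>u x\<bar>)"
      unfolding real_norm_def abs_mult by (intro mult_left_mono abs_cutoff_le) auto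
    also have "\<dots> = (2 + s0\<^sup>2) * \<bar>spow r (u x) * u x\<bar>" by (simp add: abs_mult)
    finally show "norm (spow r (u x) * cutoff s0 (u x)) \<le> norm ((2 + s0\<^sup>2) * \<bar>u x\<bar> powr r)"
      by (simp add: spow_self)
  qed
qed

lemma pot_integral_le:
  assumes u: "u \<in> H01 \<Omega>" and T: "DE u \<le> T" and p: "2 < p" "p < q"
    and near: "\<And>h. h \<in> H01 \<Omega> \<Longrightarrow> DE h \<le> 1 \<Longrightarrow> \<bar>x * Mr q u h - y * Mr p u h\<bar> \<le> \<eta>"
  shows "integrable M (\<lambda>z. pot x y p q s0 (u z))"
    and "(\<integral>z. pot x y p q s0 (u z) \<partial>M) \<le> (2 + s0\<^sup>2) * sqrt (T + 1) * \<eta>"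
proof -
  obtain \<phi> where \<phi>: "\<And>n::nat. \<phi> n \<in> TF" "(\<lambda>n. \<integral>x. (u x - \<phi> n x)\<^sup>2 \<partial>M) \<longlonglongrightarrow> 0"
    "(\<lambda>n. DE (\<lambda>x. u x - \<phi> n x)) \<longlonglongrightarrow> 0"
    "(\<lambda>n. DF (\<phi> n) (\<phi> n)) \<longlonglongrightarrow> DE u"
    "AE x in M. (\<lambda>n. \<phi> n x) \<longlonglongrightarrow> u x"
    using H01_approx[OF u] by blast
  have qp: "1 < q" "1 < p" "p \<le> q" using p by auto
  have T0: "0 \<le> T" using T dirichlet_nonneg[of \<Omega> u] by linarith
  \<comment> \<open>R^2 bounds the Dirichlet integral of \<open>g k\<close> once that of
    \<open>\<phi> k\<close> is below T + 1, so that g k / R is an admissible direction in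
    \<open>near\<close>.\<close>
  define R where "R = (2 + s0\<^sup>2) * sqrt (T + 1)"
  have R: "R > 0" using T0 by (simp add: R_def add_pos_nonneg)
  define I where "I r = (\<integral>z. spow r (u z) * cutoff s0 (u z) \<partial>M)" for r
  define g where "g k = (\<lambda>z. cutoff s0 (\<phi> k z))" for k
  have gH: "g k \<in> H01 \<Omega>" for k unfolding g_def by (intro TF_H01 cutoff_test_function \<phi>)
  have conv: "(\<lambda>k. Mr r u (g k)) \<longlonglongrightarrow> I r" if r: "1 < r" "r \<le> q" for r
  proof -
    have w: "(\<lambda>x. u x - \<phi> k x) \<in> H01 \<Omega>" for k
      using Lq_int_approx(1)[OF u \<phi>(1,3), of r] r by auto
    have l: "(\<lambda>k. (2 + s0\<^sup>2) * (\<integral>x. \<bar>spow r (u x)\<bar> * \<bar>u x - \<phi> k x\<bar> \<partial>M)) \<longlonglongrightarrow> (2 + s0\<^sup>2) * 0"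
      using r by (intro tendsto_mult tendsto_const spow_integral_tendsto_0 u w Lq_int_approx(2)[OF u \<phi>(1,3)]) auto
    have "(\<lambda>k. Mr r u (g k) - I r) \<longlonglongrightarrow> 0"
    proof (rule Lim_null_comparison)
      show "(\<lambda>k. (2 + s0\<^sup>2) * (\<integral>x. \<bar>spow r (u x)\<bar> * \<bar>u x - \<phi> k x\<bar> \<partial>M)) \<longlonglongrightarrow> 0" using l by simp
      show "\<forall>\<^sub>F k in sequentially. norm (Mr r u (g k) - I r) \<le> (2 + s0\<^sup>2) * (\<integral>x. \<bar>spow r (u x)\<bar> * \<bar>u x - \<phi> k x\<bar> \<partial>M)"
      proof (intro always_eventually allI)
        fix k
        note i = Mr_integrable[OF u gH[of k] r] spow_cutoff_integrable[OF u r, of s0]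
        have "norm (Mr r u (g k) - I r) = \<bar>\<integral>z. spow r (u z) * g k z - spow r (u z) * cutoff s0 (u z) \<partial>M\<bar>"
          using i by (simp add: Mr_def I_def)
        also have "\<dots> \<le> (\<integral>z. \<bar>spow r (u z) * g k z - spow r (u z) * cutoff s0 (u z)\<bar> \<partial>M)"
          by (rule integral_abs_bound)
        also have "\<dots> \<le> (\<integral>z. (2 + s0\<^sup>2) * (\<bar>spow r (u z)\<bar> * \<bar>u z - \<phi> k z\<bar>) \<partial>M)"
        proof (rule integral_mono)
          show "integrable M (\<lambda>z. \<bar>spow r (u z) * g k z - spow r (u z) * cutoff s0 (u z)\<bar>)"
            using i by auto
          show "integrable M (\<lambda>z. (2 + s0\<^sup>2) * (\<bar>spow r (u z)\<bar> * \<bar>u z - \<phi> k z\<bar>))"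
            using integrable_abs[OF Mr_integrable[OF u w[of k] r]] by (simp add: abs_mult)
          fix z
          have "\<bar>spow r (u z) * g k z - spow r (u z) * cutoff s0 (u z)\<bar> = \<bar>spow r (u z)\<bar> * \<bar>cutoff s0 (\<phi> k z) - cutoff s0 (u z)\<bar>"
            by (simp add: g_def right_diff_distrib flip: abs_mult)
          also have "\<dots> \<le> \<bar>spow r (u z)\<bar> * ((2 + s0\<^sup>2) * \<bar>\<phi> k z - u z\<bar>)"
            by (intro mult_left_mono cutoff_lipschitz) auto
          finally show "\<bar>spow r (u z) * g k z - spow r (u z) * cutoff s0 (u z)\<bar> \<le> (2 + s0\<^sup>2) * (\<bar>spow r (u z)\<bar> * \<bar>u z - \<phi> k z\<bar>)"
            by (simp add: abs_minus_commute mult_ac)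
        qed
        finally show "norm (Mr r u (g k) - I r) \<le> (2 + s0\<^sup>2) * (\<integral>x. \<bar>spow r (u x)\<bar> * \<bar>u x - \<phi> k x\<bar> \<partial>M)" by simp
      qed
    qed
    then show ?thesis by (simp add: LIM_zero_iff)
  qed
  have lim: "(\<lambda>k. x * Mr q u (g k) - y * Mr p u (g k)) \<longlonglongrightarrow> x * I q - y * I p"
    using qp by (intro tendsto_intros conv) auto
  have "\<forall>\<^sub>F k in sequentially. DF (\<phi> k) (\<phi> k) < T + 1"
    using \<phi>(4) T by (intro order_tendstoD(2)) auto
  then have "\<forall>\<^sub>F k in sequentially. x * Mr q u (g k) - y * Mr p u (g k) \<le> R * \<eta>"
  proof eventually_elim
    case (elim k)
    have "DE (g k) \<le> (2 + s0\<^sup>2)\<^sup>2 * (T + 1)"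
      using DF_cutoff[OF \<phi>(1)[of k], of s0] mult_left_mono[OF less_imp_le[OF elim] zero_le_power2, of "2 + s0\<^sup>2"]
      unfolding g_def by linarith
    also have "\<dots> = R\<^sup>2" using T0 by (simp add: R_def power_mult_distrib)
    finally have "(1 / R)\<^sup>2 * DE (g k) \<le> (1 / R)\<^sup>2 * R\<^sup>2" by (intro mult_left_mono) auto
    also have "\<dots> = 1" using R by (simp add: power_divide)
    finally have "DE (\<lambda>z. (1 / R) * g k z) \<le> 1"
      unfolding DF_scale[OF H01_H1[OF gH]] .
    from near[OF H01_scale[OF gH] this]
    have "(1 / R) * (x * Mr q u (g k) - y * Mr p u (g k)) \<le> \<eta>"
      unfolding Mr_scale by (simp add: algebra_simps abs_le_iff)
    then show ?case using R by (simp add: field_simps)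
  qed
  from tendsto_upperbound[OF lim this] have le: "x * I q - y * I p \<le> R * \<eta>" by simp
  have e: "pot x y p q s0 (u z) = x * (spow q (u z) * cutoff s0 (u z)) - y * (spow p (u z) * cutoff s0 (u z))" for z
    by (simp add: pot_def algebra_simps)
  have i: "integrable M (\<lambda>z. spow q (u z) * cutoff s0 (u z))" "integrable M (\<lambda>z. spow p (u z) * cutoff s0 (u z))"
    using qp by (auto intro!: spow_cutoff_integrable u)
  show "integrable M (\<lambda>z. pot x y p q s0 (u z))" unfolding e using i by simp
  have "(\<integral>z. pot x y p q s0 (u z) \<partial>M) = x * I q - y * I p"
    unfolding e I_def using i by simp
  then show "(\<integral>z. pot x y p q s0 (u z) \<partial>M) \<le> (2 + s0\<^sup>2) * sqrt (T + 1) * \<eta>"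
    using le by (simp add: R_def)
qed

text \<open>W(\<psi>) is only continuously differentiable, which the L^1 gradient inequality allows.
  Cauchy-Schwarz then separates sqrt(min 1 F) from the gradient and accounts for the factor 1/2 in
  the exponent.\<close>

lemma gns_primitive:
  assumes \<psi>: "\<psi> \<in> TF" and F: "continuous_on UNIV F" "\<And>s. F s \<ge> 0" "F 0 = 0"
    and W: "W 0 = 0" "\<And>s. (W has_real_derivative sqrt (min 1 (F s))) (at s)"
    and m: "DIM('a) = Suc m"
  shows "integrable M (\<lambda>x. \<bar>W (\<psi> x)\<bar> powr (real (Suc m) / real m))"
    and "(\<integral>x. \<bar>W (\<psi> x)\<bar> powr (real (Suc m) / real m) \<partial>M)
      \<le> ((\<integral>x. min 1 (F (\<psi> x)) \<partial>M) * DE \<psi>) powr (real (Suc m) / real m / 2)"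
proof -
  define s where "s = real (Suc m) / real m"
  have m0: "m > 0" using m dim by simp
  have s: "s > 0" using m0 by (simp add: s_def)
  define \<omega> where "\<omega> r = sqrt (min 1 (F r))" for r
  have \<omega>0: "\<omega> r \<ge> 0" for r using F(2) by (simp add: \<omega>_def)
  have \<omega>c: "continuous_on UNIV \<omega>" unfolding \<omega>_def using F(1) by (intro continuous_intros)
  have \<omega>2: "(\<omega> r)\<^sup>2 = min 1 (F r)" for r using F(2) by (simp add: \<omega>_def)
  note \<psi>c = test_functionsD(3)[OF \<psi>] and gc = continuous_grad_test_function[OF \<psi>]
  have \<omega>\<psi>c: "continuous_on UNIV (\<lambda>x. \<omega> (\<psi> x))" by (rule continuous_on_compose2[OF \<omega>c \<psi>c]) auto
  obtain K R where K: "\<And>x. x \<notin> K \<Longrightarrow> \<psi> x = 0" "\<And>x. norm x \<ge> R \<Longrightarrow> x \<notin> K"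
    using test_function_support[OF \<psi>] by metis
  have Wc: "continuous_on UNIV W"
    by (rule DERIV_continuous_on) (rule DERIV_subset[OF W(2)], simp)
  have W\<psi>c: "continuous_on UNIV (\<lambda>x. \<bar>W (\<psi> x)\<bar> powr s)"
    using s by (intro continuous_on_abs_powr continuous_on_compose2[OF Wc \<psi>c]) auto
  have f1: "\<bar>W 0\<bar> powr s = 0" "(\<lambda>r (g::'a). \<omega> r * norm g) 0 0 = 0" "(\<omega> 0)\<^sup>2 = 0" "(norm (0::'a))\<^sup>2 = 0"
    using W(1) \<omega>2[of 0] F(3) by simp_all
  have gnc: "continuous_on UNIV (\<lambda>x. \<omega> (\<psi> x) * norm (grad \<psi> x))" by (intro continuous_intros \<omega>\<psi>c gc)
  have oc: "continuous_on UNIV (\<lambda>x. (\<omega> (\<psi> x))\<^sup>2)" by (intro continuous_intros \<omega>\<psi>c)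
  have nc: "continuous_on UNIV (\<lambda>x. (norm (grad \<psi> x))\<^sup>2)" by (intro continuous_intros gc)
  note i1 = TF_integral[OF \<psi>, of "\<lambda>r _. \<bar>W r\<bar> powr s", OF f1(1) W\<psi>c]
  note i2 = TF_integral[OF \<psi>, of "\<lambda>r g. \<omega> r * norm g", OF f1(2) gnc]
  note i3 = TF_integral[OF \<psi>, of "\<lambda>r _. (\<omega> r)\<^sup>2", OF f1(3) oc]
  note i4 = TF_integral[OF \<psi>, of "\<lambda>_ g. (norm g)\<^sup>2", OF f1(4) nc]
  show "integrable M (\<lambda>x. \<bar>W (\<psi> x)\<bar> powr (real (Suc m) / real m))" using i1(1) unfolding s_def .
  have "(\<integral>x. \<bar>W (\<psi> x)\<bar> powr s \<partial>lborel) \<le> (\<integral>x. \<omega> (\<psi> x) * norm (grad \<psi> x) \<partial>lborel) powr s"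
    unfolding s_def
  proof (rule gagliardo_nirenberg_sobolev(2)[OF m m0, where v' = "\<lambda>x h. \<omega> (\<psi> x) * (grad \<psi> x \<bullet> h)" and R = R])
    fix x
    show "((\<lambda>x. W (\<psi> x)) has_derivative (\<lambda>h. \<omega> (\<psi> x) * (grad \<psi> x \<bullet> h))) (at x)"
      unfolding \<omega>_def
      by (rule has_derivative_compose[OF has_derivative_test_function[OF \<psi>] W(2)[unfolded has_field_derivative_def]])
    show "W (\<psi> x) = 0" if "norm x \<ge> R" using K that W(1) by simp
  next
    fix i :: 'a assume i: "i \<in> Basis"
    show "continuous_on UNIV (\<lambda>x. \<omega> (\<psi> x) * (grad \<psi> x \<bullet> i))"
      by (intro continuous_intros \<omega>\<psi>c gc)
    fix x
    show "\<bar>\<omega> (\<psi> x) * (grad \<psi> x \<bullet> i)\<bar> \<le> \<omega> (\<psi> x) * norm (grad \<psi> x)"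
      using \<omega>0[of "\<psi> x"] abs_partial_le_norm_grad[OF i, of \<psi> x] unfolding abs_mult
      by (simp add: mult_left_mono del: grad_inner)
  next
    show "(\<lambda>x. \<omega> (\<psi> x) * norm (grad \<psi> x)) \<in> borel_measurable borel"
      using gnc by (rule borel_measurable_continuous_onI)
  qed (rule i2(2))
  also have "\<dots> \<le> ((\<integral>x. (\<omega> (\<psi> x))\<^sup>2 \<partial>lborel) * (\<integral>x. (norm (grad \<psi> x))\<^sup>2 \<partial>lborel)) powr (s / 2)"
  proof -
    define X where "X = (\<integral>x. \<omega> (\<psi> x) * norm (grad \<psi> x) \<partial>lborel)"
    have X0: "X \<ge> 0" unfolding X_def by (intro integral_nonneg_AE AE_I2 mult_nonneg_nonneg \<omega>0) auto
    have X2: "X\<^sup>2 \<le> (\<integral>x. (\<omega> (\<psi> x))\<^sup>2 \<partial>lborel) * (\<integral>x. (norm (grad \<psi> x))\<^sup>2 \<partial>lborel)"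
      unfolding X_def
    proof (rule cauchy_schwarz_integral(2)[OF _ _ i3(2) i4(2)])
      show "(\<lambda>x. \<omega> (\<psi> x)) \<in> borel_measurable lborel" using \<omega>\<psi>c borel_measurable_continuous_onI by auto
      show "(\<lambda>x. norm (grad \<psi> x)) \<in> borel_measurable lborel"
        using borel_measurable_continuous_onI[OF continuous_on_norm[OF gc]] by simp
    qed
    have "X powr s = (X powr 2) powr (s / 2)" unfolding powr_powr by simp
    also have "\<dots> = (X\<^sup>2) powr (s / 2)" using X0 by simp
    also have "\<dots> \<le> ((\<integral>x. (\<omega> (\<psi> x))\<^sup>2 \<partial>lborel) * (\<integral>x. (norm (grad \<psi> x))\<^sup>2 \<partial>lborel)) powr (s / 2)"
      using X2 s by (intro powr_mono2) auto
    finally show ?thesis by (simp add: X_def)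
  qed
  finally show "(\<integral>x. \<bar>W (\<psi> x)\<bar> powr (real (Suc m) / real m) \<partial>M)
      \<le> ((\<integral>x. min 1 (F (\<psi> x)) \<partial>M) * DE \<psi>) powr (real (Suc m) / real m / 2)"
    using i1(3) i3(3) i4(3) by (simp add: s_def \<omega>2 DF_TF[OF \<psi>])
qed

text \<open>Since \<open>gns_primitive\<close> is about test functions, u must be replaced by one.
  The integral of min 1 F passes to the limit because the constant 1 is integrable over the bounded
  domain; for F itself there would be no such majorant.\<close>

lemma concentration_approx:
  assumes u: "u \<in> H01 \<Omega>" and T: "DE u \<le> T" and p: "0 < p" "p \<le> q" and F: "continuous_on UNIV F" "\<And>s. F s \<ge> 0"
    and int: "integrable M (\<lambda>x. F (u x))" and e: "e > 0"
  obtains \<psi> where "\<psi> \<in> TF" "DE \<psi> \<le> T + 1" "(\<integral>x. min 1 (F (\<psi> x)) \<partial>M) \<le> (\<integral>x. F (u x) \<partial>M) + e"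
    "Lq_int p \<Omega> (\<lambda>x. u x - \<psi> x) \<le> e"
proof -
  obtain \<phi> where \<phi>: "\<And>n::nat. \<phi> n \<in> TF" "(\<lambda>n. \<integral>x. (u x - \<phi> n x)\<^sup>2 \<partial>M) \<longlonglongrightarrow> 0"
    "(\<lambda>n. DE (\<lambda>x. u x - \<phi> n x)) \<longlonglongrightarrow> 0"
    "(\<lambda>n. DF (\<phi> n) (\<phi> n)) \<longlonglongrightarrow> DE u"
    "AE x in M. (\<lambda>n. \<phi> n x) \<longlonglongrightarrow> u x"
    using H01_approx[OF u] by blast
  have [measurable]: "F \<in> borel_measurable borel" using F(1) by (rule borel_measurable_continuous_onI)
  have [measurable]: "\<phi> n \<in> borel_measurable M" for n using TF_L2(1)[OF \<phi>(1)[of n]] by (simp add: L2_space_def)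
  note [measurable] = H01_measurable[OF u]
  have "(\<lambda>n. \<integral>x. min 1 (F (\<phi> n x)) \<partial>M) \<longlonglongrightarrow> (\<integral>x. min 1 (F (u x)) \<partial>M)"
  proof (rule integral_dominated_convergence[where w = "\<lambda>_. 1"])
    show "AE x in M. (\<lambda>n. min 1 (F (\<phi> n x))) \<longlonglongrightarrow> min 1 (F (u x))"
      using \<phi>(5)
    proof eventually_elim
      case (elim x)
      have "isCont F (u x)" using F(1) by (simp add: continuous_on_eq_continuous_at)
      from isCont_tendsto_compose[OF this elim] show ?case by (intro tendsto_intros)
    qed
    show "AE x in M. norm (min 1 (F (\<phi> n x))) \<le> 1" for n using F(2) by (intro AE_I2) simp
  qed auto
  moreover have "(\<integral>x. min 1 (F (u x)) \<partial>M) \<le> (\<integral>x. F (u x) \<partial>M)"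
  proof (rule integral_mono[OF _ int])
    show "integrable M (\<lambda>x. min 1 (F (u x)))"
      by (rule Bochner_Integration.integrable_bound[OF int]) (use F(2) in auto)
  qed auto
  ultimately have "\<forall>\<^sub>F n in sequentially. (\<integral>x. min 1 (F (\<phi> n x)) \<partial>M) < (\<integral>x. F (u x) \<partial>M) + e"
    using e by (intro order_tendstoD(2)) auto
  moreover have "\<forall>\<^sub>F n in sequentially. DF (\<phi> n) (\<phi> n) < T + 1"
    using \<phi>(4) T by (intro order_tendstoD(2)) auto
  moreover have "\<forall>\<^sub>F n in sequentially. Lq_int p \<Omega> (\<lambda>x. u x - \<phi> n x) < e"
    using Lq_int_approx(2)[OF u \<phi>(1,3) p] e by (intro order_tendstoD(2)) auto
  ultimately have "\<forall>\<^sub>F n in sequentially. (\<integral>x. min 1 (F (\<phi> n x)) \<partial>M) < (\<integral>x. F (u x) \<partial>M) + e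
      \<and> DF (\<phi> n) (\<phi> n) < T + 1 \<and> Lq_int p \<Omega> (\<lambda>x. u x - \<phi> n x) < e"
    by eventually_elim simp
  then obtain n where "(\<integral>x. min 1 (F (\<phi> n x)) \<partial>M) < (\<integral>x. F (u x) \<partial>M) + e
      \<and> DF (\<phi> n) (\<phi> n) < T + 1 \<and> Lq_int p \<Omega> (\<lambda>x. u x - \<phi> n x) < e"
    using eventually_happens'[OF sequentially_bot] by blast
  then show ?thesis using that[of "\<phi> n"] \<phi>(1) by simp
qed

text \<open>Small values are bounded by \<delta>, large ones by the higher power q, and the values
  between \<delta> and L by W, which is at least w there.\<close>

lemma powr_le_split:
  fixes W :: "real \<Rightarrow> real"
  assumes "0 < p" "p < q" "0 < \<delta>" "0 < L" "0 < w" "0 < s" "\<And>r. \<delta> \<le> \<bar>r\<bar> \<Longrightarrow> w \<le> \<bar>W r\<bar>"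
  shows "\<bar>r::real\<bar> powr p \<le> \<delta> powr p + L powr p / w powr s * \<bar>W r\<bar> powr s + L powr (p - q) * \<bar>r\<bar> powr q"
proof -
  have nn: "0 \<le> \<delta> powr p" "0 \<le> L powr p / w powr s * \<bar>W r\<bar> powr s" "0 \<le> L powr (p - q) * \<bar>r\<bar> powr q" by auto
  consider "\<bar>r\<bar> \<le> \<delta>" | "L \<le> \<bar>r\<bar>" | "\<delta> \<le> \<bar>r\<bar>" "\<bar>r\<bar> \<le> L" by linarith
  then show ?thesis
  proof cases
    case 1
    then have "\<bar>r\<bar> powr p \<le> \<delta> powr p" using assms by (intro powr_mono2) auto
    then show ?thesis using nn by linarith
  next
    case 2
    have "\<bar>r\<bar> powr p = \<bar>r\<bar> powr (p - q) * \<bar>r\<bar> powr q" by (simp flip: powr_add)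
    also have "\<dots> \<le> L powr (p - q) * \<bar>r\<bar> powr q"
      using 2 assms by (intro mult_right_mono powr_mono2') auto
    finally show ?thesis using nn by linarith
  next
    case 3
    have "w powr s \<le> \<bar>W r\<bar> powr s" using assms(7)[OF 3(1)] assms by (intro powr_mono2) auto
    then have "1 \<le> \<bar>W r\<bar> powr s / w powr s" using assms by simp
    then have "L powr p * 1 \<le> L powr p * (\<bar>W r\<bar> powr s / w powr s)" by (intro mult_left_mono) auto
    moreover have "\<bar>r\<bar> powr p \<le> L powr p" using 3 assms by (intro powr_mono2) auto
    moreover have "L powr p / w powr s * \<bar>W r\<bar> powr s = L powr p * (\<bar>W r\<bar> powr s / w powr s)" by simp
    ultimately show ?thesis using nn by linarith
  qed
qed

text \<open>The potential F has small integral along v n, so W of nearby test functions tends to 0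
  in L^(N/(N-1)). As |W| is bounded below away from 0, these test functions are small in measure,
  and their bound in L^q with q > p turns this into smallness in L^p, against a positive d.\<close>

lemma concentration:
  assumes p: "2 < p" "p < q" and xy: "x > 0" "y > 0"
    and v: "\<And>n::nat. v n \<in> H01 \<Omega>" "\<And>n. DE (v n) \<le> T"
    and near: "\<And>n h. h \<in> H01 \<Omega> \<Longrightarrow> DE h \<le> 1 \<Longrightarrow> \<bar>x * Mr q (v n) h - y * Mr p (v n) h\<bar> \<le> \<eta> n"
    and \<eta>: "\<eta> \<longlonglongrightarrow> 0" and d: "\<And>n. d \<le> Lq_int p \<Omega> (v n)"
  shows "d \<le> 0"
proof (rule ccontr)
  assume "\<not> d \<le> 0"
  then have d0: "d > 0" by simp
  have T0: "0 \<le> T" using v(2)[of 0] dirichlet_nonneg[of \<Omega> "v 0"] by linarith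
  \<comment> \<open>The positive zero of x s^(q-1) - y s^(p-1).\<close>
  define s0 where "s0 = (y / x) powr (1 / (q - p))"
  have s0: "s0 > 0" using xy by (simp add: s0_def)
  have ys: "y = x * s0 powr (q - p)" using p xy by (simp add: s0_def powr_powr)
  define F where "F = pot x y p q s0"
  have Fc: "continuous_on UNIV F" unfolding F_def using p by (intro continuous_on_pot) auto
  have F0: "F s \<ge> 0" "s \<noteq> 0 \<Longrightarrow> \<bar>s\<bar> \<noteq> s0 \<Longrightarrow> F s > 0" for s
    unfolding F_def using pot_nonneg_pos[OF s0 ys xy(1) p(2)] by auto
  have F00: "F 0 = 0" by (simp add: F_def pot_def)
  obtain W where W: "W 0 = 0" "\<And>s. (W has_real_derivative sqrt (min 1 (F s))) (at s)"
    "\<And>\<delta>. \<delta> > 0 \<Longrightarrow> \<exists>w>0. \<forall>s. \<delta> \<le> \<bar>s\<bar> \<longrightarrow> w \<le> \<bar>W s\<bar>"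
    using primitive_sqrt[OF Fc F0(1) s0 F0(2)] by blast
  define C where "C = (2 + s0\<^sup>2) * sqrt (T + 1)"
  have pi: "integrable M (\<lambda>z. F (v n z))" "(\<integral>z. F (v n z) \<partial>M) \<le> C * \<eta> n" for n
    unfolding F_def C_def by (rule pot_integral_le[OF v(1) v(2) p near]; assumption)+
  obtain m where m: "DIM('a) = Suc m" using dim by (cases "DIM('a)") auto
  define s where "s = real (Suc m) / real m"
  have s: "s > 0" using m dim by (simp add: s_def)
  define e where "e n = 1 / real (Suc n)" for n
  have e: "e n > 0" for n by (simp add: e_def)
  have elim: "e \<longlonglongrightarrow> 0" using LIMSEQ_inverse_real_of_nat by (simp add: e_def[abs_def] inverse_eq_divide)
  have "\<exists>\<psi>. \<psi> \<in> TF \<and> DE \<psi> \<le> T + 1 \<and> (\<integral>x. min 1 (F (\<psi> x)) \<partial>M) \<le> C * \<eta> n + e n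
      \<and> Lq_int p \<Omega> (\<lambda>x. v n x - \<psi> x) \<le> e n" for n
  proof -
    obtain \<psi> where "\<psi> \<in> TF" "DE \<psi> \<le> T + 1" "(\<integral>x. min 1 (F (\<psi> x)) \<partial>M) \<le> (\<integral>x. F (v n x) \<partial>M) + e n"
      "Lq_int p \<Omega> (\<lambda>x. v n x - \<psi> x) \<le> e n"
      using concentration_approx[OF v(1)[of n] v(2)[of n], of p F "e n"] p Fc F0(1) pi(1)[of n] e[of n] by auto
    then show ?thesis using pi(2)[of n] by force
  qed
  then obtain \<psi> where \<psi>: "\<And>n. \<psi> n \<in> TF" "\<And>n. DF (\<psi> n) (\<psi> n) \<le> T + 1"
    "\<And>n. (\<integral>x. min 1 (F (\<psi> n x)) \<partial>M) \<le> C * \<eta> n + e n" "\<And>n. Lq_int p \<Omega> (\<lambda>x. v n x - \<psi> n x) \<le> e n"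
    by metis
  define I where "I n = (\<integral>x. \<bar>W (\<psi> n x)\<bar> powr s \<partial>M)" for n
  have Ilim: "I \<longlonglongrightarrow> 0"
  proof (rule tendsto_sandwich[OF _ _ tendsto_const])
    show "\<forall>\<^sub>F n in sequentially. 0 \<le> I n" by (simp add: I_def)
    have "0 \<le> C * \<eta> n + e n" for n
      using \<psi>(3)[of n] F0(1) by (intro order_trans[OF integral_nonneg_AE \<psi>(3)]) auto
    then have pos: "0 \<le> (C * \<eta> n + e n) * (T + 1)" for n using T0 by simp
    have lim: "(\<lambda>n. (C * \<eta> n + e n) * (T + 1)) \<longlonglongrightarrow> (C * 0 + 0) * (T + 1)"
      by (intro tendsto_intros \<eta> elim)
    have "(\<lambda>n. ((C * \<eta> n + e n) * (T + 1)) powr (s / 2)) \<longlonglongrightarrow> ((C * 0 + 0) * (T + 1)) powr (s / 2)"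
      using s pos by (intro tendsto_powr'[OF lim tendsto_const]) auto
    then show "(\<lambda>n. ((C * \<eta> n + e n) * (T + 1)) powr (s / 2)) \<longlonglongrightarrow> 0" by simp
    show "\<forall>\<^sub>F n in sequentially. I n \<le> ((C * \<eta> n + e n) * (T + 1)) powr (s / 2)"
    proof (intro always_eventually allI)
      fix n
      have "(\<integral>x. min 1 (F (\<psi> n x)) \<partial>M) \<ge> 0" using F0(1) by (intro integral_nonneg_AE) auto
      then have "(\<integral>x. min 1 (F (\<psi> n x)) \<partial>M) * DF (\<psi> n) (\<psi> n) \<le> (C * \<eta> n + e n) * (T + 1)"
        using \<psi>(2,3)[of n] by (intro mult_mono) auto
      moreover have "0 \<le> (\<integral>x. min 1 (F (\<psi> n x)) \<partial>M) * DF (\<psi> n) (\<psi> n)"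
        using \<open>(\<integral>x. min 1 (F (\<psi> n x)) \<partial>M) \<ge> 0\<close> by simp
      ultimately have "((\<integral>x. min 1 (F (\<psi> n x)) \<partial>M) * DF (\<psi> n) (\<psi> n)) powr (s / 2) \<le> ((C * \<eta> n + e n) * (T + 1)) powr (s / 2)"
        using s by (intro powr_mono2) auto
      then show "I n \<le> ((C * \<eta> n + e n) * (T + 1)) powr (s / 2)"
        using gns_primitive(2)[OF \<psi>(1)[of n] Fc F0(1) F00 W(1,2) m] unfolding I_def s_def by linarith
    qed
  qed
  define Q0 where "Q0 = Kp * (T + 1) powr (q / 2)"
  have Q0: "Q0 \<ge> 0" using Kp_nonneg by (simp add: Q0_def)
  have Pq: "Lq_int q \<Omega> (\<psi> n) \<le> Q0" for n
  proof -
    have "Lq_int q \<Omega> (\<psi> n) \<le> Kp * DF (\<psi> n) (\<psi> n) powr (q / 2)"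
      using q_bounds by (intro Lq_int_le TF_H01 \<psi>) auto
    also have "\<dots> \<le> Q0" unfolding Q0_def using \<psi>(2)[of n] Kp_nonneg q_bounds by (intro mult_left_mono powr_mono2) auto
    finally show ?thesis .
  qed
  \<comment> \<open>The small and the large values will each contribute at most \<sigma>, the
    intermediate ones tend to 0, and the triangle inequality in L^p costs the factor 2^p. In the
    limit d is at most 2^p times 2 \<sigma>, which is d / 4.\<close>
  define \<sigma> where "\<sigma> = d / (8 * 2 powr p)"
  have \<sigma>: "\<sigma> > 0" using d0 by (simp add: \<sigma>_def)
  define \<mu> where "\<mu> = measure M \<Omega>"
  have \<mu>: "\<mu> \<ge> 0" by (simp add: \<mu>_def)
  define \<delta> where "\<delta> = (\<sigma> / (\<mu> + 1)) powr (1 / p)"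
  have \<delta>: "\<delta> > 0" using \<sigma> \<mu> by (simp add: \<delta>_def)
  have \<delta>p: "\<delta> powr p * \<mu> \<le> \<sigma>"
  proof -
    have "\<delta> powr p = \<sigma> / (\<mu> + 1)" using p \<sigma> \<mu> by (simp add: \<delta>_def powr_powr)
    moreover have "\<sigma> / (\<mu> + 1) * \<mu> \<le> \<sigma> / (\<mu> + 1) * (\<mu> + 1)" using \<sigma> \<mu> by (intro mult_left_mono) auto
    moreover have "\<sigma> / (\<mu> + 1) * (\<mu> + 1) = \<sigma>" using \<mu> by simp
    ultimately show ?thesis by simp
  qed
  \<comment> \<open>The exponent p - q is negative, so this level makes the contribution of values
    above L at most \<sigma>, given the uniform bound Q0 for the critical integrals.\<close>
  define L where "L = (\<sigma> / (Q0 + 1)) powr (1 / (p - q))"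
  have L: "L > 0" using \<sigma> Q0 by (simp add: L_def)
  have Lq: "L powr (p - q) * Q0 \<le> \<sigma>"
  proof -
    have "L powr (p - q) = \<sigma> / (Q0 + 1)" using p \<sigma> Q0 by (simp add: L_def powr_powr)
    moreover have "\<sigma> / (Q0 + 1) * Q0 \<le> \<sigma> / (Q0 + 1) * (Q0 + 1)" using \<sigma> Q0 by (intro mult_left_mono) auto
    moreover have "\<sigma> / (Q0 + 1) * (Q0 + 1) = \<sigma>" using Q0 by simp
    ultimately show ?thesis by simp
  qed
  obtain w where w: "w > 0" "\<And>r. \<delta> \<le> \<bar>r\<bar> \<Longrightarrow> w \<le> \<bar>W r\<bar>" using W(3)[OF \<delta>] by blast
  define B where "B = L powr p / w powr s"
  have Pp: "Lq_int p \<Omega> (\<psi> n) \<le> \<sigma> + B * I n + \<sigma>" for n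
  proof -
    have i: "integrable M (\<lambda>x. \<bar>W (\<psi> n x)\<bar> powr s)" "integrable M (\<lambda>x. \<bar>\<psi> n x\<bar> powr q)" "integrable M (\<lambda>x. \<bar>\<psi> n x\<bar> powr p)"
      using gns_primitive(1)[OF \<psi>(1)[of n] Fc F0(1) F00 W(1,2) m] p q_bounds
      unfolding s_def by (auto intro!: H01_integrable_powr TF_H01 \<psi>)
    have "Lq_int p \<Omega> (\<psi> n) \<le> (\<integral>x. \<delta> powr p + B * \<bar>W (\<psi> n x)\<bar> powr s + L powr (p - q) * \<bar>\<psi> n x\<bar> powr q \<partial>M)"
      unfolding Lq_int_def
    proof (rule integral_mono[OF i(3)])
      show "integrable M (\<lambda>x. \<delta> powr p + B * \<bar>W (\<psi> n x)\<bar> powr s + L powr (p - q) * \<bar>\<psi> n x\<bar> powr q)"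
        using i by simp
      show "\<bar>\<psi> n x\<bar> powr p \<le> \<delta> powr p + B * \<bar>W (\<psi> n x)\<bar> powr s + L powr (p - q) * \<bar>\<psi> n x\<bar> powr q" for x
        unfolding B_def using p \<delta> L w s by (intro powr_le_split) auto
    qed
    also have "\<dots> = \<delta> powr p * \<mu> + B * I n + L powr (p - q) * Lq_int q \<Omega> (\<psi> n)"
      using i by (simp add: \<mu>_def I_def Lq_int_def)
    also have "\<dots> \<le> \<sigma> + B * I n + \<sigma>"
      using \<delta>p Lq mult_left_mono[OF Pq[of n], of "L powr (p - q)"] by (simp add: add_mono)
    finally show ?thesis .
  qed
  have lim: "(\<lambda>n. 2 powr p * ((\<sigma> + B * I n + \<sigma>) + e n)) \<longlonglongrightarrow> 2 powr p * ((\<sigma> + B * 0 + \<sigma>) + 0)"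
    by (intro tendsto_intros Ilim elim)
  have le: "d \<le> 2 powr p * ((\<sigma> + B * I n + \<sigma>) + e n)" for n
  proof -
    have w: "(\<lambda>x. v n x - \<psi> n x) \<in> H01 \<Omega>"
      using H01_lincomb[OF v(1)[of n] TF_H01[OF \<psi>(1)[of n]], of "-1"] by simp
    have i: "integrable M (\<lambda>x. \<bar>\<psi> n x\<bar> powr p)" "integrable M (\<lambda>x. \<bar>v n x - \<psi> n x\<bar> powr p)" "integrable M (\<lambda>x. \<bar>v n x\<bar> powr p)"
      using p by (auto intro!: H01_integrable_powr[OF w] H01_integrable_powr[OF TF_H01[OF \<psi>(1)]] H01_integrable_powr[OF v(1)])
    have "Lq_int p \<Omega> (v n) \<le> (\<integral>x. 2 powr p * (\<bar>\<psi> n x\<bar> powr p + \<bar>v n x - \<psi> n x\<bar> powr p) \<partial>M)"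
      unfolding Lq_int_def
    proof (rule integral_mono[OF i(3)])
      show "integrable M (\<lambda>x. 2 powr p * (\<bar>\<psi> n x\<bar> powr p + \<bar>v n x - \<psi> n x\<bar> powr p))" using i by simp
      show "\<bar>v n x\<bar> powr p \<le> 2 powr p * (\<bar>\<psi> n x\<bar> powr p + \<bar>v n x - \<psi> n x\<bar> powr p)" for x
        using abs_powr_sum_le[of p "\<psi> n x" "v n x - \<psi> n x"] p by simp
    qed
    also have "\<dots> = 2 powr p * (Lq_int p \<Omega> (\<psi> n) + Lq_int p \<Omega> (\<lambda>x. v n x - \<psi> n x))"
      using i by (simp add: Lq_int_def)
    also have "\<dots> \<le> 2 powr p * ((\<sigma> + B * I n + \<sigma>) + e n)"
      by (intro mult_left_mono add_mono Pp \<psi>) auto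
    finally show ?thesis using d[of n] by linarith
  qed
  have "d \<le> 2 powr p * ((\<sigma> + B * 0 + \<sigma>) + 0)"
    by (rule LIMSEQ_le_const[OF lim]) (use le in blast)
  also have "\<dots> = d / 4" by (simp add: \<sigma>_def)
  finally show False using d0 by simp
qed

end

section \<open>Non-existence slightly above the extremal parameter\<close>

context kirchhoff
begin

text \<open>The Nehari identities at the two parameters differ only in the coefficient of the
  subcritical integral, and J is nonnegative.\<close>

lemma lstar_le_solution:
  assumes u: "kirchhoff_solution \<Omega> a b p lam u" "u \<in> H0"
  shows "lstar \<le> lam" "quartic p a b 1 lstar u = (lam - lstar) * Pp u"
proof -
  show e: "quartic p a b 1 lstar u = (lam - lstar) * Pp u"
    using nehari[OF u(1)] p by (simp add: quartic_def algebra_simps)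
  have "0 \<le> (lam - lstar) * Pp u"
    using quartic_lstar_nonneg[OF H0D(1)[OF u(2)]] e by simp
  then show "lstar \<le> lam" using H0D(4)[OF u(2)] by (simp add: zero_le_mult_iff)
qed

text \<open>Nehari and coercivity bound both \<kappa> a A and \<kappa> b A^2 by \<Lambda> Kp
  A^(p/2). As 1 < p / 2 < 2, the first keeps A away from 0 and the second keeps it bounded; the
  lower bound for A then returns one for \<open>Pp u\<close>.\<close>

lemma solution_bounds:
  assumes \<Lambda>: "\<Lambda> > 0"
  obtains T d where "T \<ge> 1" "d > 0"
    "\<And>lam u. 0 < lam \<Longrightarrow> lam \<le> \<Lambda> \<Longrightarrow> kirchhoff_solution \<Omega> a b p lam u \<Longrightarrow> u \<in> H0 \<Longrightarrow> A u \<le> T \<and> d \<le> Pp u"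
proof -
  define T1 where "T1 = (\<Lambda> * Kp / (\<kappa> * b)) powr (1 / (2 - p / 2))"
  define Tm where "Tm = (\<kappa> * a / (\<Lambda> * Kp)) powr (1 / (p / 2 - 1))"
  have p4: "p < 4" using p q_bounds by simp
  have Tm: "Tm > 0" using \<kappa>(1) a \<Lambda> Kp_pos by (simp add: Tm_def)
  define d where "d = \<kappa> * a * Tm / \<Lambda>"
  have d: "d > 0" using \<kappa>(1) a \<Lambda> Tm by (simp add: d_def)
  have main: "A u \<le> max 1 T1 \<and> d \<le> Pp u"
    if lam: "0 < lam" "lam \<le> \<Lambda>" and sol: "kirchhoff_solution \<Omega> a b p lam u" and u: "u \<in> H0" for lam u
  proof
    note uH = H0D(1)[OF u]
    define t where "t = A u"
    have t: "t > 0" using H0D(2)[OF u] by (simp add: t_def)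
    have ne: "a * t + b * t\<^sup>2 - Pq u = lam * Pp u"
      using nehari[OF sol] p by (simp add: quartic_def t_def)
    have k: "\<kappa> * (a * t + b * t\<^sup>2) \<le> lam * Pp u" using \<kappa>(2)[OF uH] ne by (simp add: t_def)
    have P: "lam * Pp u \<le> \<Lambda> * Pp u" using lam by (intro mult_right_mono) auto
    have "Pp u \<le> Kp * t powr (p / 2)" unfolding t_def using p by (intro Lq_int_le uH) auto
    then have P2: "lam * Pp u \<le> \<Lambda> * (Kp * t powr (p / 2))"
      using P mult_left_mono[of "Pp u" "Kp * t powr (p / 2)" \<Lambda>] \<Lambda> by linarith
    have kk: "\<kappa> * (a * t) \<le> lam * Pp u" "\<kappa> * (b * t\<^sup>2) \<le> lam * Pp u"
    proof -
      have "0 \<le> \<kappa> * (a * t)" "0 \<le> \<kappa> * (b * t\<^sup>2)" using \<kappa>(1) a b t by auto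
      then show "\<kappa> * (a * t) \<le> lam * Pp u" "\<kappa> * (b * t\<^sup>2) \<le> lam * Pp u"
        using k unfolding distrib_left by linarith+
    qed
    have "t\<^sup>2 = t powr (2 - p / 2) * t powr (p / 2)" using t by (simp flip: powr_add)
    then have "\<kappa> * b * t powr (2 - p / 2) * t powr (p / 2) \<le> \<Lambda> * Kp * t powr (p / 2)"
      using kk(2) P2 by (simp add: mult.assoc)
    then have "\<kappa> * b * t powr (2 - p / 2) \<le> \<Lambda> * Kp" using t by simp
    then have "t powr (2 - p / 2) \<le> \<Lambda> * Kp / (\<kappa> * b)" using \<kappa>(1) b by (simp add: field_simps)
    then have "(t powr (2 - p / 2)) powr (1 / (2 - p / 2)) \<le> T1"
      unfolding T1_def using p4 by (intro powr_mono2) auto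
    then have "t \<le> T1" using t p4 by (simp add: powr_powr)
    then show "A u \<le> max 1 T1" by (simp add: t_def)
    have "t powr (p / 2) = t powr (p / 2 - 1) * t"
      using powr_mult_base[of t "p / 2 - 1"] t by (simp add: mult.commute)
    then have "\<kappa> * a * t \<le> \<Lambda> * Kp * t powr (p / 2 - 1) * t" using kk(1) P2 by (simp add: mult.assoc)
    then have "\<kappa> * a \<le> \<Lambda> * Kp * t powr (p / 2 - 1)" using t by simp
    then have "\<kappa> * a / (\<Lambda> * Kp) \<le> t powr (p / 2 - 1)" using \<Lambda> Kp_pos by (simp add: field_simps)
    then have "Tm \<le> (t powr (p / 2 - 1)) powr (1 / (p / 2 - 1))"
      unfolding Tm_def using p \<kappa>(1) a \<Lambda> Kp_pos by (intro powr_mono2) auto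
    then have "Tm \<le> t" using t p by (simp add: powr_powr)
    then have "\<kappa> * a * Tm \<le> \<kappa> * a * t" using \<kappa>(1) a by (intro mult_left_mono) auto
    then have "\<kappa> * a * Tm \<le> \<Lambda> * Pp u" using kk(1) P by simp
    then show "d \<le> Pp u" using \<Lambda> by (simp add: d_def field_simps)
  qed
  show ?thesis using that[of "max 1 T1" d] d main by simp
qed

text \<open>J is nonnegative at u + \<tau> h, so its expansion there bounds the negative of the
  derivative after division by \<tau>; applying this to -h gives the other sign. A value J(u) of
  order \<tau>^2 matches the order of the remainder.\<close>

lemma quartic_deriv_small:
  assumes u: "u \<in> H01 \<Omega>" and T: "A u \<le> T" "1 \<le> T" and h: "h \<in> H01 \<Omega>" "A h \<le> 1"
    and \<tau>: "0 < \<tau>" "\<tau> \<le> 1" and J: "quartic p a b 1 lstar u \<le> \<tau>\<^sup>2 * P"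
  shows "\<bar>quartic_deriv p a b 1 lstar u h\<bar> \<le> \<tau> * (P + quartic_rem p a b 1 lstar T)"
proof -
  let ?J = "quartic p a b 1 lstar" and ?D = "quartic_deriv p a b 1 lstar u"
  have le: "- ?D h \<le> \<tau> * (P + quartic_rem p a b 1 lstar T)" if h: "h \<in> H01 \<Omega>" "A h \<le> 1" for h
  proof -
    have "0 \<le> ?J (\<lambda>x. u x + \<tau> * h x)" by (intro quartic_lstar_nonneg H01_lincomb u h)
    moreover have "\<bar>?J (\<lambda>x. u x + \<tau> * h x) - ?J u - \<tau> * ?D h\<bar> \<le> \<tau>\<^sup>2 * quartic_rem p a b 1 lstar T"
      using p by (intro quartic_expansion u h \<tau> T) auto
    ultimately have "\<tau> * (- ?D h) \<le> \<tau>\<^sup>2 * P + \<tau>\<^sup>2 * quartic_rem p a b 1 lstar T" using J by simp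
    also have "\<dots> = \<tau> * (\<tau> * (P + quartic_rem p a b 1 lstar T))" by (simp add: power2_eq_square algebra_simps)
    finally show ?thesis using \<tau>(1) by (subst (asm) mult_le_cancel_left_pos)
  qed
  have "A (\<lambda>x. (-1) * h x) \<le> 1" using DF_scale[OF H01_H1[OF h(1)], of "-1"] h by simp
  from le[OF H01_scale[OF h(1)] this] have "?D h \<le> \<tau> * (P + quartic_rem p a b 1 lstar T)"
    unfolding quartic_deriv_scale[OF u h(1)] by simp
  then show ?thesis using le[OF h] by (simp add: abs_le_iff)
qed

text \<open>For a solution the gradient term of the derivative of \<open>quartic\<close> can be eliminated by the
  Euler-Lagrange equation, which leaves a combination of the two powers.\<close>

definition ratio :: "('a \<Rightarrow> real) \<Rightarrow> real" where
  "ratio u = (2 * a + 4 * b * A u) / (a + b * A u)"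

lemma ratio_bounds: "0 \<le> ratio u" "ratio u \<le> 4"
proof -
  have "a + b * A u > 0" using a b by (simp add: add_pos_nonneg)
  then show "0 \<le> ratio u" "ratio u \<le> 4" using a b by (auto simp: ratio_def field_simps)
qed

lemma quartic_deriv_solution:
  assumes sol: "kirchhoff_solution \<Omega> a b p lam u" and h: "h \<in> H01 \<Omega>"
  shows "quartic_deriv p a b 1 lstar u h = (ratio u - q) * Mr q u h + (ratio u * lam - lstar * p) * Mr p u h"
proof -
  have pos: "a + b * A u > 0" using a b by (simp add: add_pos_nonneg)
  have "(a + b * A u) * DF u h = Mr q u h + lam * Mr p u h"
    using p by (intro euler_lagrange(2)[OF sol _ _ h]) auto
  then have "ratio u * (Mr q u h + lam * Mr p u h) = ratio u * ((a + b * A u) * DF u h)" by simp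
  also have "\<dots> = (2 * a + 4 * b * A u) * DF u h" using pos by (simp add: ratio_def)
  finally show ?thesis by (simp add: quartic_deriv_def algebra_simps)
qed

text \<open>On a set of finite measure |v|^p <= \<delta>^p + \<delta>^(p-q) |v|^q, so critical
  integrals tending to 0 would force the subcritical ones below d.\<close>

lemma Pq_pos_of_Pp_pos:
  assumes v: "\<And>n::nat. v n \<in> H01 \<Omega>" and lim: "(\<lambda>n. Pq (v n)) \<longlonglongrightarrow> c" and d: "d > 0" "\<And>n. d \<le> Pp (v n)"
  shows "c > 0"
proof (rule ccontr)
  assume "\<not> c > 0"
  moreover have "c \<ge> 0" by (rule LIMSEQ_le_const[OF lim]) auto
  ultimately have c: "c = 0" by simp
  define \<mu> where "\<mu> = measure M \<Omega>"
  have \<mu>: "\<mu> \<ge> 0" by (simp add: \<mu>_def)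
  \<comment> \<open>Chosen so that the values below \<delta> contribute at most d / 2.\<close>
  define \<delta> where "\<delta> = (d / (2 * (\<mu> + 1))) powr (1 / p)"
  have \<delta>: "\<delta> > 0" using d \<mu> by (simp add: \<delta>_def)
  have \<delta>p: "\<delta> powr p * \<mu> \<le> d / 2"
  proof -
    have half: "d / (2 * r) * r = d / 2" if "r > 0" for r :: real using that by simp
    have "\<delta> powr p * \<mu> = d / (2 * (\<mu> + 1)) * \<mu>" using p d \<mu> by (simp add: \<delta>_def powr_powr)
    also have "\<dots> \<le> d / (2 * (\<mu> + 1)) * (\<mu> + 1)" using d \<mu> by (intro mult_left_mono) auto
    also have "d / (2 * (\<mu> + 1)) * (\<mu> + 1) = d / 2" using half[of "\<mu> + 1"] \<mu> by simp
    finally show ?thesis .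
  qed
  have le: "d \<le> d / 2 + \<delta> powr (p - q) * Pq (v n)" for n
  proof -
    have i: "integrable M (\<lambda>x. \<bar>v n x\<bar> powr q)" "integrable M (\<lambda>x. \<bar>v n x\<bar> powr p)"
      using p q_bounds by (auto intro!: H01_integrable_powr v)
    have "Pp (v n) \<le> (\<integral>x. \<delta> powr p + \<delta> powr (p - q) * \<bar>v n x\<bar> powr q \<partial>M)"
      unfolding Lq_int_def
    proof (rule integral_mono[OF i(2)])
      fix x
      show "\<bar>v n x\<bar> powr p \<le> \<delta> powr p + \<delta> powr (p - q) * \<bar>v n x\<bar> powr q"
      proof (cases "\<bar>v n x\<bar> \<le> \<delta>")
        case True
        then have "\<bar>v n x\<bar> powr p \<le> \<delta> powr p" using p by (intro powr_mono2) auto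
        then show ?thesis by (simp add: add_increasing2)
      next
        case False
        have "\<bar>v n x\<bar> powr p = \<bar>v n x\<bar> powr (p - q) * \<bar>v n x\<bar> powr q" by (simp flip: powr_add)
        also have "\<dots> \<le> \<delta> powr (p - q) * \<bar>v n x\<bar> powr q"
          using False \<delta> p by (intro mult_right_mono powr_mono2') auto
        finally show ?thesis by (simp add: add_increasing)
      qed
    qed (use i in simp)
    also have "\<dots> = \<delta> powr p * \<mu> + \<delta> powr (p - q) * Pq (v n)"
      using i by (simp add: \<mu>_def Lq_int_def)
    finally show ?thesis using d(2)[of n] \<delta>p by linarith
  qed
  have "(\<lambda>n. d / 2 + \<delta> powr (p - q) * Pq (v n)) \<longlonglongrightarrow> d / 2 + \<delta> powr (p - q) * c"
    by (intro tendsto_intros lim)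
  then have "d \<le> d / 2 + \<delta> powr (p - q) * c"
    by (rule LIMSEQ_le_const) (use le in blast)
  then show False using c d by simp
qed

lemma no_solution_near_lstar:
  "\<exists>\<epsilon>>0. \<forall>lam. 0 < lam \<and> lam < lstar + \<epsilon> \<longrightarrow> \<not> (\<exists>u. kirchhoff_solution \<Omega> a b p lam u \<and> \<not> zero_on \<Omega> u)"
proof (rule ccontr)
  assume neg: "\<not> ?thesis"
  define e where "e n = 1 / real (Suc n)" for n
  have e: "0 < e n" "e n \<le> 1" for n by (auto simp: e_def)
  have elim: "e \<longlonglongrightarrow> 0" using LIMSEQ_inverse_real_of_nat by (simp add: e_def[abs_def] inverse_eq_divide)
  have "\<exists>lam u. 0 < lam \<and> lam < lstar + e n \<and> kirchhoff_solution \<Omega> a b p lam u \<and> \<not> zero_on \<Omega> u" for n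
    using neg e(1)[of n] by blast
  then obtain L U where LU: "\<And>n. 0 < L n" "\<And>n. L n < lstar + e n" "\<And>n. kirchhoff_solution \<Omega> a b p (L n) (U n)"
    "\<And>n. \<not> zero_on \<Omega> (U n)" by metis
  have UH: "U n \<in> H01 \<Omega>" for n using euler_lagrange(1)[OF LU(3)] p by simp
  have U0: "U n \<in> H0" for n using UH LU(4) by (simp add: H01_nonzero_def)
  have Lge: "lstar \<le> L n" for n by (rule lstar_le_solution(1)[OF LU(3) U0])
  define \<Lambda> where "\<Lambda> = lstar + 1"
  have \<Lambda>: "\<Lambda> > 0" using lstar_pos by (simp add: \<Lambda>_def)
  obtain T d where Td: "T \<ge> 1" "d > 0"
    "\<And>lam u. 0 < lam \<Longrightarrow> lam \<le> \<Lambda> \<Longrightarrow> kirchhoff_solution \<Omega> a b p lam u \<Longrightarrow> u \<in> H0 \<Longrightarrow> A u \<le> T \<and> d \<le> Pp u"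
    using solution_bounds[OF \<Lambda>] by blast
  have "L n \<le> \<Lambda>" for n using LU(2)[of n] e(2)[of n] by (simp add: \<Lambda>_def)
  then have UT: "A (U n) \<le> T" and Ud: "d \<le> Pp (U n)" for n using Td(3)[OF LU(1) _ LU(3) U0] by auto
  define P where "P = Kp * T powr (p / 2)"
  define Q where "Q = Kp * T powr (q / 2)"
  have bound: "Lq_int r \<Omega> v \<le> Kp * T powr (r / 2)" if "v \<in> H01 \<Omega>" "A v \<le> T" "0 < r" "r \<le> q" for v r
  proof -
    have "Lq_int r \<Omega> v \<le> Kp * A v powr (r / 2)" using that by (intro Lq_int_le)
    also have "\<dots> \<le> Kp * T powr (r / 2)" using that Kp_nonneg by (intro mult_left_mono powr_mono2) auto
    finally show ?thesis .
  qed
  have UP: "Pp (U n) \<le> P" and UQ: "Pq (U n) \<le> Q" for n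
    unfolding P_def Q_def using bound[OF UH UT] p q_bounds by auto
  have P0: "P \<ge> 0" using Kp_nonneg by (simp add: P_def)
  define Rm where "Rm = P + quartic_rem p a b 1 lstar T"
  \<comment> \<open>With this step the bound J(U n) <= e n * P is exactly of the form \<tau>^2
    P.\<close>
  define \<tau> where "\<tau> n = sqrt (e n)" for n
  have \<tau>: "0 < \<tau> n" "\<tau> n \<le> 1" "(\<tau> n)\<^sup>2 = e n" for n using e[of n] by (auto simp: \<tau>_def)
  have \<tau>lim: "\<tau> \<longlonglongrightarrow> 0" using tendsto_real_sqrt[OF elim] by (simp add: \<tau>_def[abs_def])
  have small: "\<bar>(ratio (U n) - q) * Mr q (U n) h + (ratio (U n) * L n - lstar * p) * Mr p (U n) h\<bar> \<le> \<tau> n * Rm"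
    if h: "h \<in> H01 \<Omega>" "A h \<le> 1" for n h
    unfolding quartic_deriv_solution[OF LU(3) h(1), symmetric] Rm_def
  proof (rule quartic_deriv_small[OF UH UT Td(1) h \<tau>(1,2)])
    have "quartic p a b 1 lstar (U n) = (L n - lstar) * Pp (U n)"
      by (rule lstar_le_solution(2)[OF LU(3) U0])
    also have "\<dots> \<le> e n * P" using LU(2)[of n] Lge[of n] UP[of n] P0 by (intro mult_mono) auto
    finally show "quartic p a b 1 lstar (U n) \<le> (\<tau> n)\<^sup>2 * P" by (simp add: \<tau>)
  qed
  \<comment> \<open>Only two bounded real sequences are made to converge; the functions themselves
    need no convergence.\<close>
  obtain k c \<rho> where \<rho>: "strict_mono \<rho>" "(\<lambda>n. ratio (U (\<rho> n))) \<longlonglongrightarrow> k" "(\<lambda>n. Pq (U (\<rho> n))) \<longlonglongrightarrow> c"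
  proof -
    have "bounded (range (\<lambda>n. (ratio (U n), Pq (U n))))"
    proof (rule bounded_subset[OF bounded_cbox])
      show "range (\<lambda>n. (ratio (U n), Pq (U n))) \<subseteq> cbox (0, 0) (4, Q)"
        using ratio_bounds UQ by (auto simp: cbox_Pair_eq)
    qed
    from bounded_imp_convergent_subsequence[OF this]
    obtain l \<rho> where l: "strict_mono \<rho>" "((\<lambda>n. (ratio (U n), Pq (U n))) \<circ> \<rho>) \<longlonglongrightarrow> l" by blast
    from tendsto_fst[OF l(2)] tendsto_snd[OF l(2)] show ?thesis
      using l(1) that[of \<rho> "fst l" "snd l"] by (simp add: o_def)
  qed
  have c: "c > 0" by (rule Pq_pos_of_Pp_pos[OF UH \<rho>(3) Td(2) Ud])
  define v where "v n = U (\<rho> n)" for n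
  \<comment> \<open>Limits of the coefficients in \<open>small\<close>, with the overall sign
    reversed: the second one tends to \<open>lstar * k - lstar * p\<close>. The errors of replacing
    the coefficients by their limits are collected in \<open>\<alpha>\<close> and
    \<open>\<beta>\<close>.\<close>
  define x where "x = q - k"
  define y where "y = lstar * (k - p)"
  define \<alpha> where "\<alpha> n = k - ratio (v n)" for n
  define \<beta> where "\<beta> n = ratio (v n) * L (\<rho> n) - lstar * k" for n
  define \<eta> where "\<eta> n = \<tau> (\<rho> n) * Rm + \<bar>\<alpha> n\<bar> * (2 * Q) + \<bar>\<beta> n\<bar> * (2 * P)" for n
  have Llim: "L \<longlonglongrightarrow> lstar"
  proof (rule tendsto_sandwich[OF _ _ tendsto_const])
    show "(\<lambda>n. lstar + e n) \<longlonglongrightarrow> lstar" using tendsto_add[OF tendsto_const elim, of lstar] by simp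
    show "\<forall>\<^sub>F n in sequentially. lstar \<le> L n" using Lge by simp
    show "\<forall>\<^sub>F n in sequentially. L n \<le> lstar + e n" by (intro always_eventually allI less_imp_le LU(2))
  qed
  have \<eta>lim: "\<eta> \<longlonglongrightarrow> 0"
  proof -
    have "(\<lambda>n. L (\<rho> n)) \<longlonglongrightarrow> lstar" using LIMSEQ_subseq_LIMSEQ[OF Llim \<rho>(1)] by (simp add: o_def)
    then have "\<beta> \<longlonglongrightarrow> k * lstar - lstar * k" unfolding \<beta>_def v_def by (intro tendsto_intros \<rho>(2))
    then have b0: "\<beta> \<longlonglongrightarrow> 0" by simp
    have "\<alpha> \<longlonglongrightarrow> k - k" unfolding \<alpha>_def v_def by (intro tendsto_intros \<rho>(2))
    then have a0: "\<alpha> \<longlonglongrightarrow> 0" by simp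
    have t0: "(\<lambda>n. \<tau> (\<rho> n)) \<longlonglongrightarrow> 0" using LIMSEQ_subseq_LIMSEQ[OF \<tau>lim \<rho>(1)] by (simp add: o_def)
    have "\<eta> \<longlonglongrightarrow> 0 * Rm + \<bar>0\<bar> * (2 * Q) + \<bar>0\<bar> * (2 * P)"
      unfolding \<eta>_def by (intro tendsto_intros t0 a0 b0)
    then show ?thesis by simp
  qed
  have near: "\<bar>x * Mr q (v n) h - y * Mr p (v n) h\<bar> \<le> \<eta> n" if h: "h \<in> H01 \<Omega>" "A h \<le> 1" for n h
  proof -
    have hT: "A h \<le> T" using h Td(1) by simp
    have Mq: "\<bar>Mr q (v n) h\<bar> \<le> 2 * Q" and Mp: "\<bar>Mr p (v n) h\<bar> \<le> 2 * P"
    proof -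
      have "\<bar>Mr q (v n) h\<bar> \<le> Pq (v n) + Pq h" "\<bar>Mr p (v n) h\<bar> \<le> Pp (v n) + Pp h"
        unfolding v_def using p q_bounds by (auto intro!: Mr_bound UH h)
      then show "\<bar>Mr q (v n) h\<bar> \<le> 2 * Q" "\<bar>Mr p (v n) h\<bar> \<le> 2 * P"
        using UP[of "\<rho> n"] UQ[of "\<rho> n"] bound[OF h(1) hT, of p] bound[OF h(1) hT, of q] p q_bounds
        unfolding v_def P_def[symmetric] Q_def[symmetric] by auto
    qed
    define Z where "Z = (ratio (v n) - q) * Mr q (v n) h + (ratio (v n) * L (\<rho> n) - lstar * p) * Mr p (v n) h"
    have eq: "x * Mr q (v n) h - y * Mr p (v n) h = - Z - \<alpha> n * Mr q (v n) h + \<beta> n * Mr p (v n) h"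
      by (simp add: Z_def x_def y_def \<alpha>_def \<beta>_def algebra_simps)
    have Z: "\<bar>Z\<bar> \<le> \<tau> (\<rho> n) * Rm" unfolding Z_def v_def by (rule small[OF h])
    have "\<bar>\<alpha> n * Mr q (v n) h\<bar> \<le> \<bar>\<alpha> n\<bar> * (2 * Q)" "\<bar>\<beta> n * Mr p (v n) h\<bar> \<le> \<bar>\<beta> n\<bar> * (2 * P)"
      unfolding abs_mult by (rule mult_left_mono[OF Mq abs_ge_zero], rule mult_left_mono[OF Mp abs_ge_zero])
    with Z show ?thesis unfolding eq \<eta>_def by linarith
  qed
  \<comment> \<open>The near equation is tested with v n itself, divided by sqrt T to make it an
    admissible direction.\<close>
  have self: "\<bar>x * Pq (v n) - y * Pp (v n)\<bar> \<le> sqrt T * \<eta> n" for n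
  proof -
    have T: "sqrt T > 0" using Td(1) by simp
    have vH: "v n \<in> H01 \<Omega>" by (simp add: v_def UH)
    have "A (\<lambda>z. (1 / sqrt T) * v n z) = A (v n) / T"
      using DF_scale[OF H01_H1[OF vH], of "1 / sqrt T"] Td(1) by (simp add: power_divide)
    also have "\<dots> \<le> 1" using UT[of "\<rho> n"] Td(1) by (simp add: v_def)
    finally have "A (\<lambda>z. (1 / sqrt T) * v n z) \<le> 1" .
    from near[OF H01_scale[OF vH] this, of n]
    have "\<bar>x * (1 / sqrt T * Pq (v n)) - y * (1 / sqrt T * Pp (v n))\<bar> \<le> \<eta> n"
      unfolding Mr_scale Mr_self .
    moreover have "x * (1 / sqrt T * Pq (v n)) - y * (1 / sqrt T * Pp (v n)) = (x * Pq (v n) - y * Pp (v n)) / sqrt T"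
      by (simp add: diff_divide_distrib)
    ultimately have "\<bar>x * Pq (v n) - y * Pp (v n)\<bar> / sqrt T \<le> \<eta> n" using T by (simp add: abs_divide)
    then show ?thesis using T by (simp add: field_simps)
  qed
  have lim0: "(\<lambda>n. x * Pq (v n) - y * Pp (v n)) \<longlonglongrightarrow> 0"
  proof (rule Lim_null_comparison)
    show "\<forall>\<^sub>F n in sequentially. norm (x * Pq (v n) - y * Pp (v n)) \<le> sqrt T * \<eta> n" using self by simp
    show "(\<lambda>n. sqrt T * \<eta> n) \<longlonglongrightarrow> 0" using tendsto_mult[OF tendsto_const \<eta>lim, of "sqrt T"] by simp
  qed
  have "(\<lambda>n. x * Pq (v n) - (x * Pq (v n) - y * Pp (v n))) \<longlonglongrightarrow> x * c - 0"
    unfolding v_def by (intro tendsto_intros \<rho>(3) lim0[unfolded v_def])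
  then have yP: "(\<lambda>n. y * Pp (v n)) \<longlonglongrightarrow> x * c" by simp
  \<comment> \<open>At least one of x and y is positive. Since y * Pp (v n) tends to x * c with c >
    0 and Pp (v n) >= d, a positive x or y forces the other to be positive too.\<close>
  have xy: "x + y / lstar = q - p" using lstar_pos by (simp add: x_def y_def)
  have "x > 0 \<and> y > 0"
  proof (cases "y > 0")
    case True
    then have "y * d \<le> x * c"
      by (intro LIMSEQ_le_const[OF yP]) (use Ud in \<open>auto simp: v_def\<close>)
    moreover have "y * d > 0" using True Td(2) by simp
    ultimately have "x * c > 0" by linarith
    then show ?thesis using True c by (simp add: zero_less_mult_iff)
  next
    case False
    then have "y / lstar \<le> 0" using lstar_pos by (simp add: divide_le_0_iff)
    then have "x > 0" using xy p by linarith
    then have "x * c > 0" using c by simp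
    moreover have "x * c \<le> 0"
      by (rule LIMSEQ_le_const2[OF yP]) (use False in \<open>auto intro!: mult_nonpos_nonneg\<close>)
    ultimately show ?thesis by simp
  qed
  then have "d \<le> 0"
    using concentration[OF p, of x y v T \<eta> d] near \<eta>lim UH UT Ud by (simp add: v_def)
  then show False using Td(2) by simp
qed

end

theorem theorem4p3:
  fixes \<Omega> :: "'a::euclidean_space set" and a b p :: real
  assumes "DIM('a) > 4"
    and "2 < p" and "p < crit_exp DIM('a)"
    and "open \<Omega>" and "connected \<Omega>" and "\<Omega> \<noteq> {}" and "bounded \<Omega>"
    and "a > 0" and "b > 0"
    and "a powr ((real DIM('a) - 4) / 2) * b > C2 \<Omega>"
    and "starlike \<Omega>"
  shows "\<exists>\<epsilon>>0. \<forall>lam. 0 < lam \<and> lam < lambda_star \<Omega> a b p + \<epsilon> \<longrightarrow>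
           \<not> (\<exists>u. kirchhoff_solution \<Omega> a b p lam u \<and> \<not> zero_on \<Omega> u)"
proof (cases "H01_nonzero \<Omega> = {}")
  case True
  \<comment> \<open>The infima defining \<open>S_const\<close> and \<open>lambda_star\<close> carry
    no information over the empty set, so this case is settled directly: a solution would belong to
    \<open>H01_nonzero \<Omega>\<close>.\<close>
  then have "\<not> (kirchhoff_solution \<Omega> a b p lam u \<and> \<not> zero_on \<Omega> u)" for lam u
    by (auto simp: kirchhoff_solution_def critical_point_H01_def H01_nonzero_def)
  then show ?thesis by (intro exI[of _ 1]) auto
next
  case False
  interpret kirchhoff \<Omega> "crit_exp DIM('a)" a b p
    by unfold_locales (use assms False in auto)
  show ?thesis by (rule no_solution_near_lstar)
qed

end
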